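(* Let $\mathcal{A}$ be a hyperplane arrangement over a number field $K$, given by affine linear polynomials over the ring of integers $\mathcal{O}_K$. For indeterminates $\boldsymbol{s}=(s_x)_{x\in\widetilde{\mathcal{L}}(\mathcal{A})}$ and $\boldsymbol{r}=(r_x)_{x\in\widetilde{\mathcal{L}}(\mathcal{A})}$ and $x\in\widetilde{\mathcal{L}}(\mathcal{A})$, let $$g_x(\boldsymbol{s})=\mathrm{rk}(x)+\sum_{y\in\widetilde{\mathcal{L}}(\mathcal{A}_x)}s_y,\qquad h_x(\boldsymbol{r})=\sum_{y\in\widetilde{\mathcal{L}}(\mathcal{A}_x)}(r_y-\mathrm{rk}(y))\,\mu(y,x).$$ If $\mathfrak{o}$ is a compact discrete valuation ring and an $\mathcal{O}_K$-module with residue field cardinality $q$ such that $\mathcal{A}$ has good reduction over $\mathbb{F}_q$, then $$\zeta_{\mathcal{A}(\mathfrak{o})}(\boldsymbol{s})=\mathsf{fHP}_{\mathcal{A}}\left(-q^{-1},\left(q^{-g_x(\boldsymbol{s})}\right)_{x\in\widetilde{\mathcal{L}}(\mathcal{A})}\right)$$ and $$\mathsf{fHP}_{\mathcal{A}}\left(-q^{-1},\left(q^{-r_x}\right)_{x\in\widetilde{\mathcal{L}}(\mathcal{A})}\right)=\zeta_{\mathcal{A}(\mathfrak{o})}\left(\left(h_x(\boldsymbol{r})\right)_{x\in\widetilde{\mathcal{L}}(\mathcal{A})}\right).$$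
   Context: A hyperplane arrangement over a field $\mathbb{K}$ is a finite set $\mathcal{A}$ of affine hyperplanes in $\mathbb{K}^d$, $d=\dim(\mathcal{A})$. Its intersection poset $\mathcal{L}(\mathcal{A})$ is the set of all nonempty intersections of subsets of $\mathcal{A}$ (including $\mathbb{K}^d$), ordered by reverse inclusion, with bottom element $\hat{0}=\mathbb{K}^d$; $\mu(\cdot,\cdot)$ is its Möbius function. Put $\widetilde{\mathcal{L}}(\mathcal{A})=\mathcal{L}(\mathcal{A})\setminus\{\hat{0}\}$. $\mathrm{rk}(x)$ is the supremum of lengths of chains from $\hat{0}$ to $x$. For a poset $P$, $\Delta(P)$ is the set of all finite flags $F=(x_1<\cdots<x_\ell)$ in $P$, including the empty flag. For $x\in\mathcal{L}(\mathcal{A})$ let $\mathcal{A}_x=\{H\in\mathcal{A}\mid x\subseteq H\}$ (so $\widetilde{\mathcal{L}}(\mathcal{A}_x)=\{y\in\widetilde{\mathcal{L}}(\mathcal{A})\mid y\leq x\}$) and $\mathcal{A}^x=\{x\cap H\mid H\in\mathcal{A}\setminus\mathcal{A}_x,\ x\cap H\neq\varnothing\}$, an arrangement in $x$. Set $\mathcal{A}_\emptyset:=\mathcal{A}$ ($\emptyset$ a formal symbol) and $\mathcal{A}^x_y:=(\mathcal{A}_y)^x$. The Poincaré polynomial is $\pi_{\mathcal{A}}(Y)=\sum_{x\in\mathcal{L}(\mathcal{A})}\mu(\hat{0},x)(-Y)^{\mathrm{rk}(x)}$. For $F=(x_1<\cdots<x_\ell)$ put $x_0=\hat{0}$, $x_{\ell+1}=\emptyset$,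 $\pi_F(Y)=\prod_{k=0}^\ell\pi_{\mathcal{A}^{x_k}_{x_{k+1}}}(Y)$. The flag Hilbert–Poincaré series is $\mathsf{fHP}_{\mathcal{A}}(Y,\boldsymbol{T})=\sum_{F\in\Delta(\widetilde{\mathcal{L}}(\mathcal{A}))}\pi_F(Y)\prod_{x\in F}\frac{T_x}{1-T_x}$, with indeterminates $\boldsymbol{T}=(T_x)_{x\in\widetilde{\mathcal{L}}(\mathcal{A})}$. Each hyperplane of $\mathcal{A}$ is given as the zero locus $V(L)$ of a fixed affine linear polynomial $L(\boldsymbol{X})=c_L+\sum_{j=1}^d\alpha_{L,j}X_j\in\mathcal{O}_K[X_1,\dots,X_d]$, and $\mathcal{A}$ is identified with the set of these polynomials. $\mathfrak{o}$ is a compact discrete valuation ring (any characteristic) with an $\mathcal{O}_K$-module structure (via a ring homomorphism $\mathcal{O}_K\to\mathfrak{o}$), maximal ideal $\mathfrak{p}$, residue field $\mathbb{F}_q$, and absolute value $|\cdot|$ normalized so that a uniformizer has absolute value $q^{-1}$. $\mathcal{A}$ has good reduction over $\mathbb{F}_q$ if its reduction $\mathcal{A}(\mathfrak{o}/\mathfrak{p})$ modulo $\mathfrak{p}$ (a hyperplane arrangement over $\mathfrak{o}/\mathfrak{p}$) satisfies $\mathcal{L}(\mathcal{A})\cong\mathcal{L}(\mathcal{A}(\mathfrak{o}/\mathfrak{p}))$. The analytic zeta function of $\mathcal{A}$ over $\mathfrak{o}$ is $\zeta_{\mathcal{A}(\mathfrak{o})}(\boldsymbol{s})=\int_{\mathfrak{o}^{d}}\prod_{x\in\widetilde{\mathcal{L}}(\mathcal{A})}\|\mathcal{A}_x\|^{s_x}\,|\mathrm{d}\boldsymbol{X}|$,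 where the $s_x$ are complex variables, $\|\mathcal{A}_x\|=\max\{|L(\boldsymbol{X})| : L\in\mathcal{A}_x\}$, and $|\mathrm{d}\boldsymbol{X}|$ is the additive Haar measure with $\mathfrak{o}^d$ of measure $1$. The integral converges e.g. when all $s_x$ have nonnegative real part; the identities are understood as identities of the rational functions in $q^{-s_x}$ (resp. $q^{-r_x}$) that represent both sides. *)

theory Defs
  imports "HOL-Analysis.Analysis"
begin

section \<open>Intersection posets\<close>

text \<open>
  An arrangement in an ambient affine space \<open>E\<close> is represented by the set \<open>H\<close> of its hyperplanes.
  The order on flats is \<^emph>\<open>reverse\<close> inclusion: \<open>x \<le> y\<close> in the poset means \<open>y \<subseteq> x\<close> as sets,
  and the bottom element is \<open>E\<close> itself.
\<close>

definition flats :: "'v set \<Rightarrow> 'v set set \<Rightarrow> 'v set set" where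
  "flats E H = {E \<inter> \<Inter>S | S. S \<subseteq> H \<and> E \<inter> \<Inter>S \<noteq> {}}"

definition proper_flats :: "'v set \<Rightarrow> 'v set set \<Rightarrow> 'v set set" where
  "proper_flats E H = flats E H - {E}"

function moebius :: "'v set set \<Rightarrow> 'v set \<Rightarrow> 'v set \<Rightarrow> int" where
  "moebius P x y =
    (if finite P \<and> x \<in> P \<and> y \<in> P
     then if x = y then 1
          else if y \<subset> x then - (\<Sum>z \<in> {z \<in> P. z \<subseteq> x \<and> y \<subset> z}. moebius P x z)
          else 0
     else 0)"
  by auto
termination
proof (relation "Wellfounded.measure (\<lambda>(P, x, y). card {w \<in> P. y \<subset> w})", goal_cases)
  case 1
  show ?case by simp
next
  case (2 P x y z)
  then have "{w \<in> P. z \<subset> w} \<subset> {w \<in> P. y \<subset> w}" by auto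
  with 2 show ?case by (auto intro!: psubset_card_mono)
qed

declare moebius.simps [simp del]

definition rk :: "'v set \<Rightarrow> 'v set set \<Rightarrow> 'v set \<Rightarrow> nat" where
  "rk E H x = Sup {card C - 1 | C.
     C \<subseteq> flats E H \<and> finite C \<and> chain_subset C \<and> E \<in> C \<and> x \<in> C \<and> (\<forall>z\<in>C. x \<subseteq> z)}"

definition localization :: "'v set set \<Rightarrow> 'v set \<Rightarrow> 'v set set" where
  "localization H x = {h \<in> H. x \<subseteq> h}"

text \<open>The case \<^term>\<open>None\<close> is the formal symbol \<open>\<emptyset>\<close>, for which the localization is all of \<open>H\<close>.\<close>

fun localization_opt :: "'v set set \<Rightarrow> 'v set option \<Rightarrow> 'v set set" where
  "localization_opt H None = H"
| "localization_opt H (Some x) = localization H x"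

text \<open>The restriction is an arrangement in the ambient space \<open>x\<close>.\<close>

definition restriction :: "'v set set \<Rightarrow> 'v set \<Rightarrow> 'v set set" where
  "restriction H x = {x \<inter> h | h. h \<in> H - localization H x \<and> x \<inter> h \<noteq> {}}"

definition poincare :: "'v set \<Rightarrow> 'v set set \<Rightarrow> 'c::comm_ring_1 \<Rightarrow> 'c" where
  "poincare E H Y = (\<Sum>x \<in> flats E H. of_int (moebius (flats E H) E x) * (- Y) ^ rk E H x)"

section \<open>The flag Hilbert--Poincare series\<close>

definition flags :: "'v set set \<Rightarrow> 'v set list set" where
  "flags P = {F. set F \<subseteq> P \<and> sorted_wrt (\<lambda>x y. y \<subset> x) F}"

definition flag_poincare :: "'v set \<Rightarrow> 'v set set \<Rightarrow> 'v set list \<Rightarrow> 'c::comm_ring_1 \<Rightarrow> 'c" where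
  "flag_poincare E H F Y =
    (\<Prod>k \<le> length F.
       let x = (E # F) ! k; y = (map Some F @ [None]) ! k
       in poincare x (restriction (localization_opt H y) x) Y)"

definition fHP :: "'v set \<Rightarrow> 'v set set \<Rightarrow> 'c::field \<Rightarrow> ('v set \<Rightarrow> 'c) \<Rightarrow> 'c" where
  "fHP E H Y T =
    (\<Sum>F \<in> flags (proper_flats E H). flag_poincare E H F Y * (\<Prod>x \<in> set F. T x / (1 - T x)))"

section \<open>Arrangements given by affine linear polynomials\<close>

text \<open>The pair \<open>(c, \<alpha>)\<close> stands for the polynomial \<open>c + \<alpha>\<^sub>1 X\<^sub>1 + \<dots> + \<alpha>\<^sub>d X\<^sub>d\<close>.\<close>

type_synonym ('a, 'd) affine_poly = "'a \<times> ('a ^ 'd)"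

definition eval_affine :: "('a::comm_ring_1, 'd::finite) affine_poly \<Rightarrow> 'a ^ 'd \<Rightarrow> 'a" where
  "eval_affine L X = fst L + (\<Sum>j\<in>UNIV. snd L $ j * X $ j)"

definition zero_locus :: "('a::comm_ring_1, 'd::finite) affine_poly \<Rightarrow> ('a ^ 'd) set" where
  "zero_locus L = {X. eval_affine L X = 0}"

definition map_affine :: "('a \<Rightarrow> 'b) \<Rightarrow> ('a, 'd::finite) affine_poly \<Rightarrow> ('b, 'd) affine_poly" where
  "map_affine f L = (f (fst L), \<chi> j. f (snd L $ j))"

definition hyperplanes :: "('a::comm_ring_1, 'd::finite) affine_poly set \<Rightarrow> ('a ^ 'd) set set" where
  "hyperplanes A = zero_locus ` A"

text \<open>The linear part is nonzero, so that the zero locus over a field is a hyperplane.\<close>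

definition nondegenerate :: "('a::zero, 'd::finite) affine_poly \<Rightarrow> bool" where
  "nondegenerate L \<longleftrightarrow> snd L \<noteq> 0"

abbreviation arr_flats :: "('a::comm_ring_1, 'd::finite) affine_poly set \<Rightarrow> ('a ^ 'd) set set" where
  "arr_flats A \<equiv> flats UNIV (hyperplanes A)"

abbreviation arr_proper_flats ::
    "('a::comm_ring_1, 'd::finite) affine_poly set \<Rightarrow> ('a ^ 'd) set set" where
  "arr_proper_flats A \<equiv> proper_flats UNIV (hyperplanes A)"

definition ring_of_integers :: "'k::field_char_0 set" where
  "ring_of_integers = {x. algebraic_int x}"

definition number_field :: "'k::field_char_0 itself \<Rightarrow> bool" where
  "number_field _ \<longleftrightarrow>
    (\<exists>B::'k set. finite B \<and> module.span (\<lambda>(c::rat) x. of_rat c * x) B = UNIV)"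

text \<open>
  Distinct polynomials of the arrangement define distinct hyperplanes, so that hyperplanes and
  polynomials can be identified.
\<close>

definition integral_arrangement :: "('k::field_char_0, 'd::finite) affine_poly set \<Rightarrow> bool" where
  "integral_arrangement A \<longleftrightarrow>
    finite A \<and> inj_on zero_locus A \<and>
    (\<forall>L\<in>A. nondegenerate L \<and> fst L \<in> ring_of_integers \<and> (\<forall>j. snd L $ j \<in> ring_of_integers))"

section \<open>Compact discrete valuation rings\<close>

definition ring_ideal :: "'o::comm_ring_1 set \<Rightarrow> bool" where
  "ring_ideal I \<longleftrightarrow> module.subspace (*) I"

definition prime_ideal :: "'o::comm_ring_1 set \<Rightarrow> bool" where
  "prime_ideal I \<longleftrightarrow> ring_ideal I \<and> I \<noteq> UNIV \<and> (\<forall>x y. x * y \<in> I \<longrightarrow> x \<in> I \<or> y \<in> I)"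

text \<open>A principal ideal domain with exactly one nonzero prime ideal.\<close>

definition discrete_valuation_ring :: "'o::idom itself \<Rightarrow> bool" where
  "discrete_valuation_ring _ \<longleftrightarrow>
    (\<forall>I::'o set. ring_ideal I \<longrightarrow> (\<exists>a. I = range ((*) a))) \<and>
    (\<exists>!I::'o set. prime_ideal I \<and> I \<noteq> {0})"

definition max_ideal :: "'o::comm_ring_1 set" where
  "max_ideal = {x. \<not> x dvd 1}"

definition uniformizer :: "'o::comm_ring_1 \<Rightarrow> bool" where
  "uniformizer \<pi> \<longleftrightarrow> range ((*) \<pi>) = max_ideal"

definition valuation :: "'o::comm_ring_1 \<Rightarrow> nat" where
  "valuation x = (GREATEST n. \<exists>\<pi>. uniformizer \<pi> \<and> \<pi> ^ n dvd x)"

text \<open>The parameter \<open>q\<close> is the cardinality of the residue field.\<close>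

definition absval :: "nat \<Rightarrow> 'o::comm_ring_1 \<Rightarrow> real" where
  "absval q x = (if x = 0 then 0 else (1 / real q) ^ valuation x)"

definition compact_dvr :: "'o::{idom, topological_space} itself \<Rightarrow> bool" where
  "compact_dvr _ \<longleftrightarrow>
    discrete_valuation_ring TYPE('o) \<and>
    (\<forall>\<pi>::'o. uniformizer \<pi> \<longrightarrow>
      (\<forall>U::'o set. open U \<longleftrightarrow> (\<forall>x\<in>U. \<exists>n. \<forall>y. \<pi> ^ n dvd y - x \<longrightarrow> y \<in> U))) \<and>
    compact (UNIV :: 'o set)"

definition ring_hom_on :: "'a::comm_ring_1 set \<Rightarrow> ('a \<Rightarrow> 'b::comm_ring_1) \<Rightarrow> bool" where
  "ring_hom_on R f \<longleftrightarrow>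
    f 1 = 1 \<and> (\<forall>x\<in>R. \<forall>y\<in>R. f (x + y) = f x + f y \<and> f (x * y) = f x * f y)"

text \<open>The map \<open>res\<close> exhibits the field \<open>'f\<close> as the residue field of \<open>'o\<close>.\<close>

definition residue_map :: "('o::comm_ring_1 \<Rightarrow> 'f::field) \<Rightarrow> bool" where
  "residue_map res \<longleftrightarrow> ring_hom_on UNIV res \<and> surj res \<and> {x. res x = 0} = max_ideal"

definition good_reduction ::
    "('k::comm_ring_1 \<Rightarrow> 'o) \<Rightarrow> ('o \<Rightarrow> 'f::field) \<Rightarrow> ('k, 'd::finite) affine_poly set \<Rightarrow> bool" where
  "good_reduction \<phi> res A \<longleftrightarrow>
    (let B = map_affine (res \<circ> \<phi>) ` A
     in (\<forall>L\<in>B. nondegenerate L) \<and>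
        (\<exists>f. bij_betw f (arr_flats A) (arr_flats B) \<and>
             (\<forall>x\<in>arr_flats A. \<forall>y\<in>arr_flats A. x \<subseteq> y \<longleftrightarrow> f x \<subseteq> f y)))"

section \<open>The analytic zeta function\<close>

definition haar_measure :: "('o::{idom, topological_space} ^ 'd::finite) measure \<Rightarrow> bool" where
  "haar_measure M \<longleftrightarrow>
    sets M = sets borel \<and> emeasure M UNIV = 1 \<and>
    (\<forall>a. \<forall>B\<in>sets M. emeasure M ((+) a ` B) = emeasure M B)"

definition local_norm ::
    "nat \<Rightarrow> ('k::comm_ring_1 \<Rightarrow> 'o::comm_ring_1) \<Rightarrow> ('k, 'd::finite) affine_poly set \<Rightarrow>
     ('k ^ 'd) set \<Rightarrow> 'o ^ 'd \<Rightarrow> real" where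
  "local_norm q \<phi> A x X =
    Max {absval q (eval_affine (map_affine \<phi> L) X) | L. L \<in> A \<and> x \<subseteq> zero_locus L}"

definition zeta_integrand ::
    "nat \<Rightarrow> ('k::comm_ring_1 \<Rightarrow> 'o::comm_ring_1) \<Rightarrow> ('k, 'd::finite) affine_poly set \<Rightarrow>
     (('k ^ 'd) set \<Rightarrow> complex) \<Rightarrow> 'o ^ 'd \<Rightarrow> complex" where
  "zeta_integrand q \<phi> A s X =
    (\<Prod>x \<in> arr_proper_flats A. complex_of_real (local_norm q \<phi> A x X) powr s x)"

definition zeta_integral ::
    "('o::comm_ring_1 ^ 'd::finite) measure \<Rightarrow> nat \<Rightarrow> ('k::comm_ring_1 \<Rightarrow> 'o) \<Rightarrow>
     ('k, 'd) affine_poly set \<Rightarrow> (('k ^ 'd) set \<Rightarrow> complex) \<Rightarrow> complex" where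
  "zeta_integral M q \<phi> A s = (LINT X|M. zeta_integrand q \<phi> A s X)"

text \<open>
  Polynomials over the complex numbers in the variables indexed by \<open>I\<close>, as functions.
\<close>

inductive_set poly_funs :: "'x set \<Rightarrow> (('x \<Rightarrow> complex) \<Rightarrow> complex) set" for I :: "'x set" where
  const: "(\<lambda>t. c) \<in> poly_funs I"
| var: "x \<in> I \<Longrightarrow> (\<lambda>t. t x) \<in> poly_funs I"
| add: "P \<in> poly_funs I \<Longrightarrow> Q \<in> poly_funs I \<Longrightarrow> (\<lambda>t. P t + Q t) \<in> poly_funs I"
| mult: "P \<in> poly_funs I \<Longrightarrow> Q \<in> poly_funs I \<Longrightarrow> (\<lambda>t. P t * Q t) \<in> poly_funs I"

definition qpow :: "nat \<Rightarrow> ('x \<Rightarrow> complex) \<Rightarrow> 'x \<Rightarrow> complex" where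
  "qpow q s = (\<lambda>x. of_nat q powr (- s x))"

text \<open>
  The value at \<open>s\<close> of the rational function in the \<open>q\<^sup>-\<^sup>s\<close> that represents the integral on its
  domain \<open>Re s \<ge> 0\<close>. Any two fractions \<open>P / Q\<close> representing the integral there are equal as
  rational functions, so the value does not depend on the choice of a fraction whose denominator
  does not vanish at \<open>s\<close>.
\<close>

definition zeta ::
    "('o::comm_ring_1 ^ 'd::finite) measure \<Rightarrow> nat \<Rightarrow> ('k::comm_ring_1 \<Rightarrow> 'o) \<Rightarrow>
     ('k, 'd) affine_poly set \<Rightarrow> (('k ^ 'd) set \<Rightarrow> complex) \<Rightarrow> complex" where
  "zeta M q \<phi> A s =
    (THE z. \<exists>P \<in> poly_funs (arr_proper_flats A). \<exists>Q \<in> poly_funs (arr_proper_flats A).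
       (\<forall>t. (\<forall>x \<in> arr_proper_flats A. 0 \<le> Re (t x)) \<longrightarrow>
            Q (qpow q t) * zeta_integral M q \<phi> A t = P (qpow q t)) \<and>
       Q (qpow q s) \<noteq> 0 \<and> z = P (qpow q s) / Q (qpow q s))"

section \<open>The substitutions\<close>

definition g_exp ::
    "('k::comm_ring_1, 'd::finite) affine_poly set \<Rightarrow> (('k ^ 'd) set \<Rightarrow> complex) \<Rightarrow>
     ('k ^ 'd) set \<Rightarrow> complex" where
  "g_exp A s x = of_nat (rk UNIV (hyperplanes A) x) +
    (\<Sum>y \<in> proper_flats UNIV (localization (hyperplanes A) x). s y)"

definition h_exp ::
    "('k::comm_ring_1, 'd::finite) affine_poly set \<Rightarrow> (('k ^ 'd) set \<Rightarrow> complex) \<Rightarrow>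
     ('k ^ 'd) set \<Rightarrow> complex" where
  "h_exp A r x =
    (\<Sum>y \<in> proper_flats UNIV (localization (hyperplanes A) x).
       (r y - of_nat (rk UNIV (hyperplanes A) y)) * of_int (moebius (arr_flats A) y x))"

end

theory Submission
  imports Defs "Jordan_Normal_Form.Char_Poly"
begin

text \<open>
  Fix a uniformizer \<open>p\<close> of \<open>\<oo>\<close>. A point \<open>X\<close> of \<open>\<oo>\<^sup>d\<close> is followed one digit at a time: for every
  \<open>n\<close> let \<open>S\<^sub>n(X)\<close> be the set of the polynomials \<open>L\<close> of the arrangement with \<open>p\<^sup>n\<close> dividing \<open>L(X)\<close>.
  These sets, called \<open>residual n X\<close> below, decrease from \<open>S\<^sub>0(X) = A\<close>. The valuation of \<open>\<parallel>A\<^sub>y\<parallel>\<close> at \<open>X\<close> is the number of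
  levels \<open>n \<ge> 1\<close> with \<open>A\<^sub>y \<subseteq> S\<^sub>n(X)\<close>, so the integrand is the infinite product over \<open>n \<ge> 1\<close> of
  \<open>\<tau>(S\<^sub>n(X))\<close>, where \<open>\<tau>(S)\<close> is the product of the \<open>q\<^sup>-\<^sup>s\<^sub>y\<close> over the flats \<open>y\<close> with
  \<open>A\<^sub>y \<subseteq> S\<close> (lemma \<open>zeta_integrand_limit\<close>).

  Under the Haar measure the sequence \<open>S\<^sub>n(X)\<close> is a Markov chain. Suppose \<open>S\<^sub>n(X) = A\<^sub>x\<close> and write the
  next digits as \<open>X + p\<^sup>n Z\<close>. For \<open>L \<in> A\<^sub>x\<close> the residue of \<open>L(X + p\<^sup>n Z) / p\<^sup>n\<close> is an affine
  function of \<open>Z\<close> with the linear part of \<open>L\<close>. All these functions are, after one and the same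
  translation of \<open>Z\<close>, the reductions of the \<open>L\<close> themselves (lemma \<open>residual_point\<close>). So \<open>S\<^sub>n\<^sub>+\<^sub>1\<close> is
  distributed like the set of the \<open>L \<in> A\<^sub>x\<close> that vanish at a uniformly random point over the residue
  field. By Moebius inversion it equals \<open>A\<^sub>y\<close> with probability \<open>q^(-rk y)\<close> times the Poincare
  polynomial of \<open>A\<^sup>y\<^sub>x\<close> at \<open>-1/q\<close> (lemma \<open>card_points_with_zeros\<close>).

  Let \<open>Z\<^sub>x\<close> be the expectation of the product of the \<open>\<tau>(S\<^sub>n)\<close> for the chain started at \<open>A\<^sub>x\<close>, and put
  \<open>T\<^sub>y = q^(-rk y) \<tau>(A\<^sub>y)\<close>, which is \<open>q\<close> to the power \<open>-g\<^sub>y(s)\<close>. The first step of the chain shows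
  that \<open>Z\<^sub>x\<close> is the sum over \<open>y \<le> x\<close> of the Poincare polynomial of \<open>A\<^sup>y\<^sub>x\<close> at \<open>-1/q\<close> times
  \<open>T\<^sub>y Z\<^sub>y\<close>. The term \<open>y = x\<close> is \<open>T\<^sub>x Z\<^sub>x\<close>. Moving it to the left divides the rest by \<open>1 - T\<^sub>x\<close>, and
  unfolding the recursion produces the sum over flags (lemma \<open>average_tendsto_flag_sum\<close>). To avoid
  convergence questions, the infinite products are truncated after \<open>N\<close> factors and killed unless
  \<open>S\<^sub>N(X)\<close> is empty. The truncations are locally constant and bounded by \<open>1\<close>, and they converge to
  the integrand at every point, because by convention \<open>0\<close> raised to any power is \<open>0\<close>.

  Good reduction is only an abstract isomorphism of the two intersection posets. It forces the
  natural reduction map to be an isomorphism. Independent families of reduced linear parts lift to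
  independent families, by a determinant; independence can be read off the poset; so the two
  posets have equally many independent families, and hence the same ones (lemma \<open>lin_indep_eq\<close>).
  Then central families reduce to central families by Cramer's rule, and again the numbers agree
  (lemma \<open>central_eq\<close>). Cramer's rule needs the algebraic integers to form a ring.

  For the analytic continuation, two fractions that agree on the half space \<open>Re s \<ge> 0\<close> agree
  everywhere, because the points \<open>q^(-s-n)\<close> lie on a line and are eventually in the image of the half
  space (lemma \<open>poly_fun_zero_if_zero_on_half_space\<close>). The second pair of identities follows from
  the first one by the substitution \<open>s = h(r)\<close>, which inverts \<open>g\<close> by the defining property of the
  Moebius function (lemma \<open>g_exp_h_exp\<close>).
\<close>

section \<open>Algebraic integers form a ring\<close>

text \<open>
  Only the characteristic polynomial of matrices of variable size is taken from the imported theory;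
  all other vectors and matrices are those indexed by finite types.
\<close>

no_notation vec_index (infixl \<open>$\<close> 100)
no_notation scalar_prod (infix \<open>\<bullet>\<close> 70)
hide_const (open) Matrix.mat Matrix.vec Matrix.row Matrix.rows Matrix.col Determinant.det
hide_type (open) Matrix.vec Matrix.mat

text \<open>
  A root of the characteristic polynomial of an integer matrix is an algebraic integer. The family
  \<open>v\<close> is an eigenvector of such a matrix, written without an ordering of the index set.
\<close>

lemma algebraic_int_if_integer_eigenvalue:
  fixes v :: "'i \<Rightarrow> 'k::field_char_0"
  assumes "finite I" and nz: "\<exists>i\<in>I. v i \<noteq> 0"
    and eq: "\<And>i. i \<in> I \<Longrightarrow> x * v i = (\<Sum>j\<in>I. of_int (c i j) * v j)"
  shows "algebraic_int x"
proof -
  define n where "n = card I"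
  obtain e where e: "bij_betw e {0..<n} I"
    using ex_bij_betw_nat_finite[OF assms(1)] unfolding n_def by blast
  define C where "C = Matrix.mat n n (\<lambda>(i, j). c (e i) (e j))"
  define w where "w = Matrix.vec n (\<lambda>i. v (e i))"
  define M where "M = map_mat (of_int :: int \<Rightarrow> 'k) C"
  interpret of_int_hom: inj_comm_ring_hom "of_int :: int \<Rightarrow> 'k"
    by unfold_locales auto
  have C: "C \<in> carrier_mat n n" and M: "M \<in> carrier_mat n n"
    and w: "w \<in> carrier_vec n"
    unfolding C_def M_def w_def by auto
  have "w \<noteq> 0\<^sub>v n"
  proof
    assume w0: "w = 0\<^sub>v n"
    from nz obtain i where i: "i \<in> I" "v i \<noteq> 0" by blast
    then obtain k where k: "k < n" "i = e k"
      using e unfolding bij_betw_def by auto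
    have "vec_index w k = v (e k)" using k by (simp add: w_def)
    with w0 k i show False by simp
  qed
  moreover have "M *\<^sub>v w = x \<cdot>\<^sub>v w"
  proof (rule eq_vecI)
    show "dim_vec (M *\<^sub>v w) = dim_vec (x \<cdot>\<^sub>v w)" using M w by simp
    fix i assume "i < dim_vec (x \<cdot>\<^sub>v w)"
    then have i: "i < n" using w by simp
    have "vec_index (M *\<^sub>v w) i = (\<Sum>j = 0..<n. of_int (c (e i) (e j)) * v (e j))"
      using i by (simp add: M_def C_def w_def scalar_prod_def)
    also have "\<dots> = (\<Sum>j\<in>I. of_int (c (e i) j) * v j)"
      by (rule sum.reindex_bij_betw[OF e])
    also have "\<dots> = x * v (e i)"
      using eq[of "e i"] e i by (auto simp: bij_betw_def)
    finally show "vec_index (M *\<^sub>v w) i = vec_index (x \<cdot>\<^sub>v w) i"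
      using i by (simp add: w_def)
  qed
  ultimately have "eigenvalue M x"
    unfolding eigenvalue_def eigenvector_def using M w by auto
  then have "poly (char_poly M) x = 0"
    using eigenvalue_root_char_poly[OF M] by simp
  moreover have "char_poly M = map_poly of_int (char_poly C)"
    unfolding M_def by (rule of_int_hom.char_poly_hom[OF C])
  moreover have "monic (char_poly C)"
    using degree_monic_char_poly[OF C] by simp
  ultimately show ?thesis
    unfolding algebraic_int_altdef_ipoly by metis
qed

lemma algebraic_int_powers:
  fixes a :: "'k::field_char_0"
  assumes "algebraic_int a"
  obtains n c where "n > 0" "a ^ n = (\<Sum>i<n. of_int (c i) * a ^ i)"
proof -
  obtain p where p: "poly (map_poly of_int p) a = 0" "monic p"
    using assms unfolding algebraic_int_altdef_ipoly by blast
  define n where "n = degree p"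
  have "poly (map_poly (of_int :: int \<Rightarrow> 'k) p) a = (\<Sum>i\<le>n. of_int (coeff p i) * a ^ i)"
    by (simp add: poly_altdef n_def coeff_map_poly degree_map_poly)
  also have "\<dots> = (\<Sum>i<n. of_int (coeff p i) * a ^ i) + a ^ n"
    using p(2) by (simp add: n_def flip: lessThan_Suc_atMost)
  finally have s: "(\<Sum>i<n. of_int (coeff p i) * a ^ i) + a ^ n = 0"
    using p(1) by simp
  then have "n > 0" by (cases n) auto
  moreover have "a ^ n = (\<Sum>i<n. of_int (- coeff p i) * a ^ i)"
    using s by (simp add: sum_negf eq_neg_iff_add_eq_0 add.commute)
  ultimately show thesis by (rule that)
qed

text \<open>
  The products of powers of \<open>a\<close> and \<open>b\<close> below the degrees of their equations span a group \<open>W\<close> that is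
  mapped to itself by multiplication with \<open>a\<close> and with \<open>b\<close>, hence also with \<open>a + b\<close> and \<open>a * b\<close>.
\<close>

lemma algebraic_int_add_mult:
  fixes a b :: "'k::field_char_0"
  assumes "algebraic_int a" "algebraic_int b"
  shows "algebraic_int (a + b)" and "algebraic_int (a * b)"
proof -
  obtain m c where m: "m > 0" "a ^ m = (\<Sum>i<m. of_int (c i) * a ^ i)"
    using algebraic_int_powers[OF assms(1)] .
  obtain n d where n: "n > 0" "b ^ n = (\<Sum>j<n. of_int (d j) * b ^ j)"
    using algebraic_int_powers[OF assms(2)] .
  define I where "I = {..<m} \<times> {..<n}"
  define v where "v = (\<lambda>(i, j). a ^ i * b ^ j)"
  define W where "W = {y. \<exists>e. y = (\<Sum>k\<in>I. of_int (e k :: int) * v k)}"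
  have fin: "finite I" by (simp add: I_def)
  have gen: "v k \<in> W" if "k \<in> I" for k
    unfolding W_def
  proof (intro CollectI exI)
    show "v k = (\<Sum>l\<in>I. of_int (if l = k then 1 else 0) * v l)"
      using that fin by (simp add: if_distrib[of of_int] if_distrib[of "\<lambda>x. x * _"] cong: if_cong)
  qed
  have add: "y + z \<in> W" if "y \<in> W" "z \<in> W" for y z
  proof -
    from that obtain e f where "y = (\<Sum>k\<in>I. of_int (e k :: int) * v k)"
      "z = (\<Sum>k\<in>I. of_int (f k :: int) * v k)" unfolding W_def by blast
    then have "y + z = (\<Sum>k\<in>I. of_int (e k + f k) * v k)"
      by (simp add: sum.distrib algebra_simps)
    then show ?thesis unfolding W_def by (intro CollectI exI)
  qed
  have scale: "of_int e * y \<in> W" if "y \<in> W" for e y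
  proof -
    from that obtain f where "y = (\<Sum>k\<in>I. of_int (f k :: int) * v k)" unfolding W_def by blast
    then have "of_int e * y = (\<Sum>k\<in>I. of_int (e * f k) * v k)"
      by (simp add: sum_distrib_left algebra_simps)
    then show ?thesis unfolding W_def by (intro CollectI exI)
  qed
  have zero: "0 \<in> W" unfolding W_def by (auto intro!: exI[of _ "\<lambda>_. 0"])
  have sum: "(\<Sum>i\<in>S. of_int (f i) * g i) \<in> W"
    if "\<And>i. i \<in> S \<Longrightarrow> g i \<in> W" for S :: "'z set" and f g
    using that by (induction S rule: infinite_finite_induct) (auto intro: zero add scale)
  have extend: "x * y \<in> W" if x: "\<And>k. k \<in> I \<Longrightarrow> x * v k \<in> W" and "y \<in> W" for x y
  proof -
    from that(2) obtain e where "y = (\<Sum>k\<in>I. of_int (e k :: int) * v k)" unfolding W_def by blast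
    then have "x * y = (\<Sum>k\<in>I. of_int (e k) * (x * v k))"
      by (simp add: sum_distrib_left algebra_simps)
    also have "\<dots> \<in> W" using x by (rule sum)
    finally show ?thesis .
  qed
  have Wa: "a * v k \<in> W" if "k \<in> I" for k
  proof (cases k)
    case (Pair i j)
    then have ij: "i < m" "j < n" using that by (auto simp: I_def)
    show ?thesis
    proof (cases "Suc i < m")
      case True
      then show ?thesis using gen[of "(Suc i, j)"] ij Pair by (simp add: I_def v_def mult.assoc)
    next
      case False
      then have "Suc i = m" using ij by simp
      then have "a * v k = a ^ m * b ^ j" using Pair by (auto simp: v_def)
      also have "\<dots> = (\<Sum>i<m. of_int (c i) * v (i, j))"
        unfolding m(2) sum_distrib_right v_def by (simp add: mult.assoc)
      also have "\<dots> \<in> W" using ij by (intro sum gen) (auto simp: I_def)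
      finally show ?thesis .
    qed
  qed
  have Wb: "b * v k \<in> W" if "k \<in> I" for k
  proof (cases k)
    case (Pair i j)
    then have ij: "i < m" "j < n" using that by (auto simp: I_def)
    show ?thesis
    proof (cases "Suc j < n")
      case True
      then show ?thesis using gen[of "(i, Suc j)"] ij Pair by (simp add: I_def v_def algebra_simps)
    next
      case False
      then have "Suc j = n" using ij by simp
      then have "b * v k = a ^ i * b ^ n" using Pair by (auto simp: v_def)
      also have "\<dots> = (\<Sum>j<n. of_int (d j) * v (i, j))"
        by (simp add: n(2) sum_distrib_left v_def algebra_simps)
      also have "\<dots> \<in> W" using ij by (intro sum gen) (auto simp: I_def)
      finally show ?thesis .
    qed
  qed
  have nz: "\<exists>k\<in>I. v k \<noteq> 0" using m n by (auto simp: I_def v_def intro!: bexI[of _ "(0, 0)"])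
  \<comment> \<open>multiplication by \<open>x\<close> on the generators of \<open>W\<close> is given by an integer matrix\<close>
  have crit: "algebraic_int x" if "\<And>y. y \<in> W \<Longrightarrow> x * y \<in> W" for x
  proof -
    have "\<forall>k\<in>I. \<exists>e. x * v k = (\<Sum>l\<in>I. of_int (e l :: int) * v l)"
      using that gen unfolding W_def by blast
    then obtain e where "\<And>k. k \<in> I \<Longrightarrow> x * v k = (\<Sum>l\<in>I. of_int (e k l :: int) * v l)"
      by metis
    then show ?thesis using algebraic_int_if_integer_eigenvalue[OF fin nz] by blast
  qed
  show "algebraic_int (a + b)"
    by (rule crit) (auto simp: distrib_right intro: add extend[OF Wa] extend[OF Wb])
  show "algebraic_int (a * b)" by (rule crit) (auto simp: mult.assoc intro: extend[OF Wa] extend[OF Wb])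
qed

section \<open>Flats, rank and Moebius inversion\<close>

lemma moebius_self: "finite P \<Longrightarrow> x \<in> P \<Longrightarrow> moebius P x x = 1"
  by (simp add: moebius.simps)

lemma moebius_interval_sum:
  assumes P: "finite P" "x \<in> P" "y \<in> P"
  shows "(\<Sum>z \<in> {z \<in> P. z \<subseteq> x \<and> y \<subseteq> z}. moebius P x z) = (if x = y then 1 else 0)"
proof (cases "y \<subseteq> x")
  case False
  then have empty: "{z \<in> P. z \<subseteq> x \<and> y \<subseteq> z} = {}" by auto
  show ?thesis unfolding empty using False by auto
next
  case True
  show ?thesis
  proof (cases "x = y")
    case True
    then have single: "{z \<in> P. z \<subseteq> x \<and> y \<subseteq> z} = {x}" using P by auto
    show ?thesis unfolding single using P True by (simp add: moebius_self)
  next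
    case False
    with True have "y \<subset> x" by auto
    have split: "{z \<in> P. z \<subseteq> x \<and> y \<subseteq> z} = insert y {z \<in> P. z \<subseteq> x \<and> y \<subset> z}"
      using True P by auto
    have "moebius P x y = - (\<Sum>z \<in> {z \<in> P. z \<subseteq> x \<and> y \<subset> z}. moebius P x z)"
      using P \<open>y \<subset> x\<close> by (subst moebius.simps) auto
    then show ?thesis using P False unfolding split by (subst sum.insert) auto
  qed
qed

text \<open>
  In the poset order the sum runs over the elements above \<open>y\<close>. In the application \<open>f w\<close> counts points lying on the hyperplanes through \<open>w\<close>
  and on no others, and \<open>g w\<close> counts all points of \<open>w\<close>.
\<close>

lemma moebius_inversion:
  fixes f g :: "'v set \<Rightarrow> 'c::comm_ring_1"
  assumes P: "finite P" and y: "y \<in> P"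
    and g: "\<And>w. w \<in> P \<Longrightarrow> w \<subseteq> y \<Longrightarrow> g w = (\<Sum>v \<in> {v \<in> P. v \<subseteq> w}. f v)"
  shows "f y = (\<Sum>w \<in> {w \<in> P. w \<subseteq> y}. of_int (moebius P y w) * g w)"
proof -
  have "(\<Sum>w \<in> {w \<in> P. w \<subseteq> y}. of_int (moebius P y w) * g w) =
        (\<Sum>w \<in> {w \<in> P. w \<subseteq> y}. \<Sum>v | v \<in> {v \<in> P. v \<subseteq> y} \<and> v \<subseteq> w. of_int (moebius P y w) * f v)"
    by (rule sum.cong) (auto simp: g sum_distrib_left intro!: sum.cong)
  also have "\<dots> = (\<Sum>v \<in> {v \<in> P. v \<subseteq> y}. \<Sum>w | w \<in> {w \<in> P. w \<subseteq> y} \<and> v \<subseteq> w. of_int (moebius P y w) * f v)"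
    using P by (intro sum.swap_restrict) auto
  also have "\<dots> = (\<Sum>v \<in> {v \<in> P. v \<subseteq> y}. of_int (\<Sum>w \<in> {w \<in> P. w \<subseteq> y \<and> v \<subseteq> w}. moebius P y w) * f v)"
    by (simp add: sum_distrib_right conj_assoc)
  also have "\<dots> = (\<Sum>v \<in> {v \<in> P. v \<subseteq> y}. if v = y then f v else 0)"
    using P y by (intro sum.cong) (auto simp: moebius_interval_sum)
  also have "\<dots> = f y" using P y by simp
  finally show ?thesis by simp
qed

lemma finite_flats: "finite H \<Longrightarrow> finite (flats E H)"
proof -
  assume "finite H"
  moreover have "flats E H \<subseteq> (\<lambda>S. E \<inter> \<Inter>S) ` Pow H" unfolding flats_def by auto
  ultimately show ?thesis by (meson finite_Pow_iff finite_imageI finite_subset)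
qed

lemma flats_subset: "x \<in> flats E H \<Longrightarrow> x \<subseteq> E"
  unfolding flats_def by auto

lemma flats_nonempty: "x \<in> flats E H \<Longrightarrow> x \<noteq> {}"
  unfolding flats_def by auto

lemma ambient_in_flats: "E \<noteq> {} \<Longrightarrow> E \<in> flats E H"
  unfolding flats_def by (auto intro!: exI[of _ "{}"])

lemma flat_eq_Inter: "x \<in> flats UNIV H \<Longrightarrow> x = \<Inter>{h \<in> H. x \<subseteq> h}"
  unfolding flats_def by auto

lemma Inter_in_flats: "S \<subseteq> H \<Longrightarrow> \<Inter>S \<noteq> {} \<Longrightarrow> \<Inter>S \<in> flats UNIV H"
  unfolding flats_def by auto

lemma flats_localization:
  assumes "x \<in> flats UNIV H"
  shows "flats UNIV (localization H x) = {y \<in> flats UNIV H. x \<subseteq> y}"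
proof
  show "flats UNIV (localization H x) \<subseteq> {y \<in> flats UNIV H. x \<subseteq> y}"
    unfolding flats_def localization_def by auto
  show "{y \<in> flats UNIV H. x \<subseteq> y} \<subseteq> flats UNIV (localization H x)"
  proof
    fix y assume y: "y \<in> {y \<in> flats UNIV H. x \<subseteq> y}"
    then have "y = \<Inter>{h \<in> H. y \<subseteq> h}" using flat_eq_Inter by auto
    then show "y \<in> flats UNIV (localization H x)"
      using y flats_nonempty[of y UNIV H]
      unfolding flats_def localization_def by (auto intro!: exI[of _ "{h \<in> H. y \<subseteq> h}"])
  qed
qed

text \<open>
  The restriction has \<open>y\<close> as its ambient space, but its flats are flats of the original arrangement,
  so that ranks and Moebius functions on the two sides can be compared inside one poset.
\<close>

lemma flats_restriction:
  assumes y: "y \<in> flats UNIV H"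
  shows "flats y (restriction H y) = {z \<in> flats UNIV H. z \<subseteq> y}"
proof
  show "flats y (restriction H y) \<subseteq> {z \<in> flats UNIV H. z \<subseteq> y}"
  proof
    fix z assume "z \<in> flats y (restriction H y)"
    then obtain S where S: "S \<subseteq> restriction H y" "z = y \<inter> \<Inter>S" "z \<noteq> {}"
      unfolding flats_def by auto
    define S' where "S' = {h \<in> H. y \<subseteq> h} \<union> {h \<in> H. y \<inter> h \<in> S}"
    have "z = \<Inter>S'"
    proof
      show "z \<subseteq> \<Inter>S'" unfolding S(2) S'_def by auto
      have "\<Inter>S' \<subseteq> y" using flat_eq_Inter[OF y] unfolding S'_def by auto
      moreover have "\<Inter>S' \<subseteq> s" if "s \<in> S" for s
      proof -
        from that S(1) obtain h where "h \<in> H" "s = y \<inter> h" unfolding restriction_def by auto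
        then show ?thesis using that \<open>\<Inter>S' \<subseteq> y\<close> unfolding S'_def by auto
      qed
      ultimately show "\<Inter>S' \<subseteq> z" unfolding S(2) by auto
    qed
    then show "z \<in> {z \<in> flats UNIV H. z \<subseteq> y}"
      using S unfolding flats_def S'_def by (auto intro!: exI[of _ S'] simp: S'_def)
  qed
  show "{z \<in> flats UNIV H. z \<subseteq> y} \<subseteq> flats y (restriction H y)"
  proof
    fix z assume z: "z \<in> {z \<in> flats UNIV H. z \<subseteq> y}"
    then have zi: "z = \<Inter>{h \<in> H. z \<subseteq> h}" using flat_eq_Inter by auto
    have ne: "z \<noteq> {}" using z flats_nonempty by auto
    define S where "S = {y \<inter> h | h. h \<in> H \<and> z \<subseteq> h \<and> \<not> y \<subseteq> h}"
    have "z = y \<inter> \<Inter>S"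
    proof
      show "z \<subseteq> y \<inter> \<Inter>S" using z unfolding S_def by auto
      have "y \<inter> \<Inter>S \<subseteq> h" if "h \<in> H" "z \<subseteq> h" for h
        using that unfolding S_def by (cases "y \<subseteq> h") auto
      then show "y \<inter> \<Inter>S \<subseteq> z" by (subst zi) auto
    qed
    moreover have "S \<subseteq> restriction H y"
      using z ne unfolding S_def restriction_def localization_def by auto
    ultimately show "z \<in> flats y (restriction H y)"
      using ne unfolding flats_def by auto
  qed
qed

text \<open>
  A chain strictly increases \<open>r\<close>, which bounds its length. The steps of height one, applied from the
  top down, build a chain that attains the bound.
\<close>

lemma rk_eq_grading:
  fixes r :: "'v set \<Rightarrow> nat"
  assumes fin: "finite (flats E H)" and E: "E \<noteq> {}" and x: "x \<in> flats E H"
    and strict: "\<And>y z. y \<in> flats E H \<Longrightarrow> z \<in> flats E H \<Longrightarrow> z \<subset> y \<Longrightarrow> r y < r z"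
    and step: "\<And>y. y \<in> flats E H \<Longrightarrow> x \<subset> y \<Longrightarrow>
                 \<exists>w \<in> flats E H. x \<subseteq> w \<and> w \<subset> y \<and> r w = Suc (r y)"
  shows "rk E H x = r x - r E"
proof -
  have ex: "\<exists>C. C \<subseteq> flats E H \<and> finite C \<and> chain_subset C \<and> y \<in> C \<and> x \<in> C \<and>
      (\<forall>z\<in>C. x \<subseteq> z \<and> z \<subseteq> y) \<and> card C = Suc (r x - r y)"
    if "y \<in> flats E H" "x \<subseteq> y" for y
    using that
  proof (induction "r x - r y" arbitrary: y rule: less_induct)
    case less
    show ?case
    proof (cases "x = y")
      case True
      then show ?thesis using x by (intro exI[of _ "{x}"]) (auto simp: chain_subset_def)
    next
      case False
      with less.prems have xy: "x \<subset> y" by auto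
      from step[OF less.prems(1) xy] obtain w
        where w: "w \<in> flats E H" "x \<subseteq> w" "w \<subset> y" "r w = Suc (r y)" by blast
      have "r y < r x" using strict[OF less.prems(1) x xy] .
      then have "r x - r w < r x - r y" using w by auto
      from less.hyps[OF this w(1,2)] obtain C where
        C: "C \<subseteq> flats E H" "finite C" "chain_subset C" "w \<in> C" "x \<in> C"
          "\<forall>z\<in>C. x \<subseteq> z \<and> z \<subseteq> w" "card C = Suc (r x - r w)" by blast
      have "y \<notin> C" using C(6) w(3) by auto
      then have "card (insert y C) = Suc (r x - r y)"
        using C w \<open>r y < r x\<close> by auto
      moreover have "chain_subset (insert y C)"
        using C(3,6) w(3) unfolding chain_subset_def by blast
      moreover have "\<forall>z\<in>insert y C. x \<subseteq> z \<and> z \<subseteq> y" using C(6) w(3) less.prems by blast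
      ultimately show ?thesis using C less.prems by (intro exI[of _ "insert y C"]) auto
    qed
  qed
  have bound: "card C - 1 \<le> r x - r E"
    if C: "C \<subseteq> flats E H" "finite C" "chain_subset C" "\<forall>z\<in>C. x \<subseteq> z" for C
  proof -
    have mono: "r z \<le> r y" if "y \<in> flats E H" "z \<in> flats E H" "y \<subseteq> z" for y z
      using strict[OF that(2,1)] that(3) by (cases "y = z") (simp_all add: psubset_eq)
    have inj: "inj_on r C"
    proof (rule inj_onI)
      fix y z assume yz: "y \<in> C" "z \<in> C" "r y = r z"
      then have "y \<subseteq> z \<or> z \<subseteq> y" using C(3) unfolding chain_subset_def by auto
      then show "y = z" using strict[of y z] strict[of z y] yz C(1) by auto
    qed
    have "r ` C \<subseteq> {r E..r x}"
    proof clarify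
      fix z assume "z \<in> C"
      then have z: "z \<in> flats E H" "x \<subseteq> z" using C by auto
      show "r z \<in> {r E..r x}"
        using mono[OF z(1) ambient_in_flats[OF E] flats_subset[OF z(1)]] mono[OF x z] by simp
    qed
    then have "card (r ` C) \<le> card {r E..r x}" by (intro card_mono) auto
    then show ?thesis using card_image[OF inj] by auto
  qed
  have "Sup {card C - 1 | C. C \<subseteq> flats E H \<and> finite C \<and> chain_subset C \<and> E \<in> C \<and> x \<in> C \<and>
      (\<forall>z\<in>C. x \<subseteq> z)} = r x - r E"
  proof (rule cSup_eq_maximum)
    obtain C where "C \<subseteq> flats E H \<and> finite C \<and> chain_subset C \<and> E \<in> C \<and> x \<in> C \<and>
      (\<forall>z\<in>C. x \<subseteq> z \<and> z \<subseteq> E) \<and> card C = Suc (r x - r E)"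
      using ex[OF ambient_in_flats[OF E] flats_subset[OF x]] by blast
    then show "r x - r E \<in> {card C - 1 | C. C \<subseteq> flats E H \<and> finite C \<and> chain_subset C \<and> E \<in> C \<and> x \<in> C \<and>
      (\<forall>z\<in>C. x \<subseteq> z)}" by (intro CollectI exI[of _ C]) auto
  qed (use bound in auto)
  then show ?thesis unfolding rk_def .
qed

section \<open>Linear algebra of families of affine polynomials\<close>

text \<open>
  Families of polynomials are indexed, because the arrangement over the number field and its
  reduction are compared through a common index set.
\<close>

definition locus :: "('i \<Rightarrow> ('a::comm_ring_1, 'd::finite) affine_poly) \<Rightarrow> 'i set \<Rightarrow> ('a ^ 'd) set" where
  "locus u S = {X. \<forall>i\<in>S. eval_affine (u i) X = 0}"

abbreviation lin_parts :: "('i \<Rightarrow> ('a, 'd::finite) affine_poly) \<Rightarrow> 'i set \<Rightarrow> ('a ^ 'd) set" where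
  "lin_parts u S \<equiv> (\<lambda>i. snd (u i)) ` S"

definition lin_indep :: "('i \<Rightarrow> ('a::field, 'd::finite) affine_poly) \<Rightarrow> 'i set \<Rightarrow> bool" where
  "lin_indep u I \<longleftrightarrow> inj_on (\<lambda>i. snd (u i)) I \<and> vec.independent (lin_parts u I)"

definition lin_span :: "('i \<Rightarrow> ('a::field, 'd::finite) affine_poly) \<Rightarrow> 'i set \<Rightarrow> ('a ^ 'd) set" where
  "lin_span u S = vec.span (lin_parts u S)"

definition lin_rank :: "('i \<Rightarrow> ('a::field, 'd::finite) affine_poly) \<Rightarrow> 'i set \<Rightarrow> nat" where
  "lin_rank u S = vec.dim (lin_parts u S)"

lemma locus_antimono: "S \<subseteq> T \<Longrightarrow> locus u T \<subseteq> locus u S"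
  unfolding locus_def by auto

lemma locus_insert: "locus u (insert i S) = locus u {i} \<inter> locus u S"
  unfolding locus_def by auto

lemma locus_single: "locus u {i} = zero_locus (u i)"
  unfolding locus_def zero_locus_def by auto

lemma locus_eq_Inter: "locus u S = \<Inter>((\<lambda>i. zero_locus (u i)) ` S)"
  unfolding locus_def zero_locus_def by auto

lemma lin_indep_finite: "lin_indep u I \<Longrightarrow> finite I"
  unfolding lin_indep_def using vec.finiteI_independent finite_imageD by blast

lemma lin_indep_mono: "lin_indep u I \<Longrightarrow> J \<subseteq> I \<Longrightarrow> lin_indep u J"
  unfolding lin_indep_def by (meson image_mono inj_on_subset vec.independent_mono)

lemma lin_span_mono: "S \<subseteq> T \<Longrightarrow> lin_span u S \<subseteq> lin_span u T"
  unfolding lin_span_def by (intro vec.span_mono image_mono)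

lemma lin_span_base: "i \<in> S \<Longrightarrow> snd (u i) \<in> lin_span u S"
  unfolding lin_span_def by (intro vec.span_base) auto

lemma lin_indep_iff_not_in_span:
  "lin_indep u I \<longleftrightarrow> (\<forall>i\<in>I. snd (u i) \<notin> lin_span u (I - {i}))"
proof
  assume ind: "lin_indep u I"
  show "\<forall>i\<in>I. snd (u i) \<notin> lin_span u (I - {i})"
  proof
    fix i assume "i \<in> I"
    then have "lin_parts u (I - {i}) = lin_parts u I - {snd (u i)}"
      using ind unfolding lin_indep_def inj_on_def by auto
    then show "snd (u i) \<notin> lin_span u (I - {i})"
      using ind \<open>i \<in> I\<close> unfolding lin_indep_def lin_span_def vec.dependent_def by auto
  qed
next
  assume *: "\<forall>i\<in>I. snd (u i) \<notin> lin_span u (I - {i})"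
  have inj: "inj_on (\<lambda>i. snd (u i)) I"
  proof (rule inj_onI, rule ccontr)
    fix i l assume il: "i \<in> I" "l \<in> I" "snd (u i) = snd (u l)" "i \<noteq> l"
    then have "snd (u i) \<in> lin_span u (I - {i})" using lin_span_base[of l "I - {i}" u] by auto
    with * il show False by auto
  qed
  moreover have "vec.independent (lin_parts u I)"
    unfolding vec.dependent_def
  proof
    assume "\<exists>a\<in>lin_parts u I. a \<in> vec.span (lin_parts u I - {a})"
    then obtain i where i: "i \<in> I" "snd (u i) \<in> vec.span (lin_parts u I - {snd (u i)})" by auto
    have "lin_parts u I - {snd (u i)} \<subseteq> lin_parts u (I - {i})" by auto
    then have "snd (u i) \<in> lin_span u (I - {i})"
      using i(2) unfolding lin_span_def using vec.span_mono by blast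
    with * i(1) show False by auto
  qed
  ultimately show "lin_indep u I" unfolding lin_indep_def by auto
qed

lemma lin_indep_insert:
  assumes "lin_indep u I" "snd (u l) \<notin> lin_span u I"
  shows "lin_indep u (insert l I)"
proof -
  have "snd (u l) \<notin> lin_parts u I"
    using assms(2) vec.span_base[of "snd (u l)" "lin_parts u I"] unfolding lin_span_def by auto
  moreover from this have "l \<notin> I" by auto
  ultimately have "inj_on (\<lambda>i. snd (u i)) (insert l I)"
    using assms(1) unfolding lin_indep_def by simp
  moreover have "vec.independent (lin_parts u (insert l I))"
    using assms unfolding lin_indep_def lin_span_def image_insert by (intro vec.independent_insertI) auto
  ultimately show ?thesis unfolding lin_indep_def by blast
qed

lemma exists_basis:
  "\<exists>I\<subseteq>S. lin_indep u I \<and> (\<forall>i\<in>S. snd (u i) \<in> lin_span u I) \<and> card I = lin_rank u S"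
proof -
  let ?v = "\<lambda>i. snd (u i)"
  obtain B where B: "B \<subseteq> ?v ` S" "vec.independent B" "?v ` S \<subseteq> vec.span B"
    "card B = vec.dim (?v ` S)" by (rule vec.basis_exists)
  then obtain I where I: "I \<subseteq> S" "inj_on ?v I" "B = ?v ` I"
    by (meson subset_image_inj)
  show ?thesis
    by (rule exI[of _ I])
      (use B I in \<open>auto simp: lin_indep_def lin_span_def lin_rank_def card_image image_subset_iff\<close>)
qed

lemma span_coefficients:
  assumes "lin_indep u I" "x \<in> lin_span u I"
  obtains c where "x = (\<Sum>i\<in>I. c i *s snd (u i))"
proof -
  have fin: "finite I" using lin_indep_finite[OF assms(1)] .
  from assms(2) obtain c where "x = (\<Sum>v\<in>lin_parts u I. c v *s v)"
    unfolding lin_span_def by (subst (asm) vec.span_finite) (use fin in auto)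
  also have "\<dots> = (\<Sum>i\<in>I. c (snd (u i)) *s snd (u i))"
    using assms(1) unfolding lin_indep_def by (subst sum.reindex) auto
  finally show thesis by (rule that)
qed

lemma det_nonzero_iff_rows_independent:
  fixes w :: "'d::finite \<Rightarrow> 'a::field ^ 'd"
  shows "det (\<chi> k. w k) \<noteq> 0 \<longleftrightarrow> (\<forall>c. (\<Sum>k\<in>UNIV. c k *s w k) = 0 \<longrightarrow> (\<forall>k. c k = 0))"
proof -
  have "row k (\<chi> k. w k) = w k" for k by (simp add: Finite_Cartesian_Product.row_def vec_eq_iff)
  then show ?thesis
    using matrix_right_invertible_independent_rows[of "\<chi> k. w k"]
    by (simp add: invertible_det_nz[symmetric] invertible_right_inverse)
qed

text \<open>
  The linear parts are completed to a basis by unit vectors, which is written as a square matrix with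
  rows \<open>w\<close>; the map \<open>e\<close> gives the row of each member of the family. Unit vectors have entries \<open>0\<close>
  and \<open>1\<close> and therefore lift along every ring homomorphism.
\<close>

lemma lin_indep_complete_to_frame:
  fixes u :: "'i \<Rightarrow> ('a::field, 'd::finite) affine_poly"
  assumes "lin_indep u I"
  shows "\<exists>(e :: 'i \<Rightarrow> 'd) w a. inj_on e I \<and> (\<forall>i\<in>I. w (e i) = snd (u i)) \<and>
    (\<forall>k. k \<notin> e ` I \<longrightarrow> w k = axis (a k) 1) \<and> det (\<chi> k. w k) \<noteq> 0"
proof -
  let ?v = "\<lambda>i. snd (u i)"
  have ind: "vec.independent (?v ` I)" and inj: "inj_on ?v I"
    using assms by (auto simp: lin_indep_def)
  obtain B where B: "?v ` I \<subseteq> B" "B \<subseteq> ?v ` I \<union> cart_basis" "vec.independent B"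
    "?v ` I \<union> cart_basis \<subseteq> vec.span B"
    using vec.maximal_independent_subset_extend[OF Un_upper1 ind] by blast
  have "vec.span cart_basis \<subseteq> vec.span B" using B(4) by (intro vec.span_minimal) auto
  then have "vec.span B = UNIV" by auto
  then have "card B = CARD('d)"
    using vec.dim_eq_card[of B UNIV] B(3) by (auto simp: card_cart_basis)
  moreover have finB: "finite B" using B(3) by (rule vec.finiteI_independent)
  ultimately obtain w where w: "bij_betw w (UNIV :: 'd set) B"
    using finite_same_card_bij[of "UNIV :: 'd set" B] by auto
  define e where "e = (\<lambda>i. inv_into UNIV w (?v i))"
  have winj: "inj w" and wsurj: "range w = B" using w by (auto simp: bij_betw_def)
  have we: "w (e i) = ?v i" if "i \<in> I" for i
    using that B(1) wsurj unfolding e_def by (intro f_inv_into_f) auto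
  have "inj_on e I"
  proof (rule inj_onI)
    fix i l assume il: "i \<in> I" "l \<in> I" "e i = e l"
    then have "snd (u i) = snd (u l)" using we[of i] we[of l] by simp
    then show "i = l" using inj_onD[OF inj] il by blast
  qed
  moreover have "\<exists>j. w k = axis j 1" if "k \<notin> e ` I" for k
  proof -
    have "w k \<noteq> ?v i" if "i \<in> I" for i
      using \<open>k \<notin> e ` I\<close> that we[OF that] injD[OF winj, of k "e i"] by auto
    then have "w k \<notin> ?v ` I" by blast
    moreover have "w k \<in> B" using wsurj by auto
    ultimately have "w k \<in> cart_basis" using B(2) by auto
    then show ?thesis unfolding cart_basis_def by auto
  qed
  then obtain a where "\<And>k. k \<notin> e ` I \<Longrightarrow> w k = axis (a k) 1" by metis
  moreover have "det (\<chi> k. w k) \<noteq> 0"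
    unfolding det_nonzero_iff_rows_independent
  proof (intro allI impI)
    fix c k assume c: "(\<Sum>k\<in>UNIV. c k *s w k) = 0"
    have "(\<Sum>v\<in>B. c (inv_into UNIV w v) *s v) = (\<Sum>k\<in>UNIV. c (inv_into UNIV w (w k)) *s w k)"
      by (rule sum.reindex_bij_betw[OF w, symmetric])
    also have "\<dots> = 0" using c winj by simp
    finally have "\<forall>v\<in>B. c (inv_into UNIV w v) = 0"
      using B(3) finB by (auto simp: vec.dependent_finite)
    then show "c k = 0" using winj wsurj by (metis inv_f_f rangeI)
  qed
  ultimately show ?thesis using we by blast
qed

lemma matrix_bij:
  fixes M :: "'a::field ^ 'd::finite ^ 'd"
  assumes "det M \<noteq> 0"
  shows "bij (\<lambda>X. M *v X)"
  using assms by (metis invertible_det_nz invertible_eq_bij)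

lemma eval_affine_row:
  fixes u :: "'i \<Rightarrow> ('a::field, 'd::finite) affine_poly"
  assumes "w (e i) = snd (u i)"
  shows "eval_affine (u i) X = fst (u i) + ((\<chi> k. w k) *v X) $ e i"
  using assms by (simp add: eval_affine_def matrix_vector_mult_def)

text \<open>
  An independent family of affine polynomials takes all values: they are coordinates of an affine
  chart.
\<close>

lemma lin_indep_solve:
  fixes u :: "'i \<Rightarrow> ('a::field, 'd::finite) affine_poly"
  assumes "lin_indep u I"
  obtains X where "\<And>i. i \<in> I \<Longrightarrow> eval_affine (u i) X = t i"
proof -
  obtain e w a where ew: "inj_on e I" "\<And>i. i \<in> I \<Longrightarrow> w (e i) = snd (u i)"
    "\<And>k. k \<notin> e ` I \<Longrightarrow> w k = axis (a k) 1" and det: "det (\<chi> k. w k) \<noteq> 0"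
    using lin_indep_complete_to_frame[OF assms] by blast
  obtain X where X: "(\<chi> k. w k) *v X = (\<chi> k. t (inv_into I e k) - fst (u (inv_into I e k)))"
    using matrix_bij[OF det] by (metis bij_pointE)
  have "eval_affine (u i) X = t i" if "i \<in> I" for i
    using eval_affine_row[of w e i u X, OF ew(2)[OF that]] that ew(1) by (simp add: X)
  then show thesis by (rule that)
qed

lemma card_coordinates_fixed:
  fixes K :: "'d::finite set" and t :: "'d \<Rightarrow> 'a"
  assumes fin: "finite (UNIV :: 'a set)"
  shows "card {b :: 'a ^ 'd. \<forall>k\<in>K. b $ k = t k} = CARD('a) ^ (CARD('d) - card K)"
proof -
  have "bij_betw vec_nth {b :: 'a ^ 'd. \<forall>k\<in>K. b $ k = t k}
     (PiE UNIV (\<lambda>k. if k \<in> K then {t k} else UNIV))"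
    by (rule bij_betw_byWitness[of _ vec_lambda]) (auto simp: PiE_def Pi_def split: if_splits)
  then have "card {b :: 'a ^ 'd. \<forall>k\<in>K. b $ k = t k} =
      card (PiE UNIV (\<lambda>k. if k \<in> K then {t k} else UNIV))" by (rule bij_betw_same_card)
  also have "\<dots> = (\<Prod>k\<in>UNIV. if k \<in> K then 1 else CARD('a))"
    by (subst card_PiE) (auto intro!: prod.cong)
  also have "\<dots> = CARD('a) ^ card (- K)"
    using fin by (subst prod.If_cases) (auto simp: Compl_eq)
  finally show ?thesis by (simp add: Compl_eq_Diff_UNIV card_Diff_subset)
qed

lemma card_locus_lin_indep:
  fixes u :: "'i \<Rightarrow> ('a::field, 'd::finite) affine_poly"
  assumes fin: "finite (UNIV :: 'a set)" and "lin_indep u I"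
  shows "card (locus u I) = CARD('a) ^ (CARD('d) - card I)"
proof -
  obtain e w a where ew: "inj_on e I" "\<And>i. i \<in> I \<Longrightarrow> w (e i) = snd (u i)"
    "\<And>k. k \<notin> e ` I \<Longrightarrow> w k = axis (a k) 1" and det: "det (\<chi> k. w k) \<noteq> 0"
    using lin_indep_complete_to_frame[OF assms(2)] by blast
  have ev: "eval_affine (u i) X = 0 \<longleftrightarrow> ((\<chi> k. w k) *v X) $ e i = - fst (u i)" if "i \<in> I" for i X
    using eval_affine_row[of w e i u X, OF ew(2)[OF that]]
    by (simp add: eq_neg_iff_add_eq_0 add.commute)
  let ?B = "{b :: 'a ^ 'd. \<forall>k\<in>e ` I. b $ k = - fst (u (inv_into I e k))}"
  have bij: "bij (\<lambda>X. (\<chi> k. w k) *v X)" by (rule matrix_bij[OF det])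
  have "locus u I = (\<lambda>X. (\<chi> k. w k) *v X) -` ?B"
    by (auto simp: locus_def ev ew(1))
  also have "card \<dots> = card ?B"
    by (rule card_vimage_inj[OF bij_is_inj[OF bij]]) (simp add: bij_is_surj[OF bij])
  also have "\<dots> = CARD('a) ^ (CARD('d) - card (e ` I))"
    by (rule card_coordinates_fixed[OF fin])
  finally show ?thesis by (simp add: card_image ew(1))
qed

lemma lin_indep_locus_nonempty: "lin_indep u I \<Longrightarrow> locus u I \<noteq> {}"
  by (erule lin_indep_solve[of u I "\<lambda>_. 0"]) (auto simp: locus_def)

text \<open>
  A linear relation between linear parts extends to the constant terms as soon as there is a common
  zero, since both sides then vanish there.
\<close>

lemma eval_affine_combination:
  fixes u :: "'i \<Rightarrow> ('a::field, 'd::finite) affine_poly"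
  assumes "snd (u l) = (\<Sum>i\<in>I. c i *s snd (u i))" "X0 \<in> locus u (insert l I)"
  shows "fst (u l) = (\<Sum>i\<in>I. c i * fst (u i))"
    and "eval_affine (u l) X = (\<Sum>i\<in>I. c i * eval_affine (u i) X)"
proof -
  have dot: "(\<Sum>j\<in>UNIV. snd (u l) $ j * X $ j) =
      (\<Sum>i\<in>I. c i * (\<Sum>j\<in>UNIV. snd (u i) $ j * X $ j))" for X
    by (simp add: assms(1) sum_distrib_right sum_distrib_left mult.assoc)
      (rule sum.swap)
  have "fst (u l) = - (\<Sum>j\<in>UNIV. snd (u l) $ j * X0 $ j)"
    using assms(2) by (simp add: locus_def eval_affine_def eq_neg_iff_add_eq_0)
  also have "\<dots> = (\<Sum>i\<in>I. c i * - (\<Sum>j\<in>UNIV. snd (u i) $ j * X0 $ j))"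
    by (simp only: dot mult_minus_right sum_negf)
  also have "\<dots> = (\<Sum>i\<in>I. c i * fst (u i))"
  proof (intro sum.cong refl)
    fix i assume "i \<in> I"
    then have "fst (u i) = - (\<Sum>j\<in>UNIV. snd (u i) $ j * X0 $ j)"
      using assms(2) by (simp add: locus_def eval_affine_def eq_neg_iff_add_eq_0)
    then show "c i * - (\<Sum>j\<in>UNIV. snd (u i) $ j * X0 $ j) = c i * fst (u i)" by simp
  qed
  finally show fst: "fst (u l) = (\<Sum>i\<in>I. c i * fst (u i))" .
  show "eval_affine (u l) X = (\<Sum>i\<in>I. c i * eval_affine (u i) X)"
    by (simp add: eval_affine_def fst dot distrib_left sum.distrib)
qed

lemma locus_subset_if_in_span:
  assumes "snd (u l) \<in> lin_span u S" "locus u (insert l S) \<noteq> {}"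
  shows "locus u S \<subseteq> locus u {l}"
proof -
  obtain I where I: "I \<subseteq> S" "lin_indep u I" "\<And>i. i \<in> S \<Longrightarrow> snd (u i) \<in> lin_span u I" "card I = lin_rank u S"
    using exists_basis[of S u] by auto
  have "lin_span u S \<subseteq> lin_span u I"
    using I(3) unfolding lin_span_def by (intro vec.span_minimal) auto
  then obtain c where c: "snd (u l) = (\<Sum>i\<in>I. c i *s snd (u i))"
    using span_coefficients[OF I(2), of "snd (u l)"] assms(1) by auto
  from assms(2) obtain X0 where "X0 \<in> locus u (insert l S)" by blast
  then have X0: "X0 \<in> locus u (insert l I)" using I(1) unfolding locus_def by auto
  show ?thesis
    using eval_affine_combination(2)[of u l c I, OF c X0] I(1) by (auto simp: locus_def subset_iff)
qed

lemma locus_basis: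
  assumes "I \<subseteq> S" "\<And>i. i \<in> S \<Longrightarrow> snd (u i) \<in> lin_span u I" "locus u S \<noteq> {}"
  shows "locus u I = locus u S"
proof
  show "locus u S \<subseteq> locus u I" by (rule locus_antimono[OF assms(1)])
  have "locus u I \<subseteq> locus u {i}" if "i \<in> S" for i
  proof (rule locus_subset_if_in_span[OF assms(2)[OF that]])
    have "locus u S \<subseteq> locus u (insert i I)" using assms(1) that by (intro locus_antimono) auto
    then show "locus u (insert i I) \<noteq> {}" using assms(3) by auto
  qed
  then show "locus u I \<subseteq> locus u S" unfolding locus_def by blast
qed

text \<open>
  Otherwise a basis together with \<open>l\<close> would be independent, and there would be a point where the
  basis vanishes and the polynomial at \<open>l\<close> takes the value \<open>1\<close>.
\<close>

lemma in_span_if_locus_subset: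
  assumes "locus u S \<noteq> {}" "locus u S \<subseteq> locus u {l}"
  shows "snd (u l) \<in> lin_span u S"
proof (rule ccontr)
  assume not: "snd (u l) \<notin> lin_span u S"
  obtain I where I: "I \<subseteq> S" "lin_indep u I" "\<And>i. i \<in> S \<Longrightarrow> snd (u i) \<in> lin_span u I" "card I = lin_rank u S"
    using exists_basis[of S u] by auto
  have "snd (u l) \<notin> lin_span u I" using not lin_span_mono[OF I(1)] by auto
  then have "lin_indep u (insert l I)" "l \<notin> I"
    using lin_indep_insert[OF I(2), of l] lin_span_base[of l I u] by auto
  then obtain X where X: "\<And>i. i \<in> insert l I \<Longrightarrow> eval_affine (u i) X = (if i = l then 1 else 0)"
    by (auto elim!: lin_indep_solve[of u "insert l I" "\<lambda>i. if i = l then 1 else 0"])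
  then have "X \<in> locus u I" using \<open>l \<notin> I\<close> unfolding locus_def by auto
  then have "X \<in> locus u {l}" using locus_basis[OF I(1,3) assms(1)] assms(2) by auto
  then show False using X[of l] by (simp add: locus_def)
qed

text \<open>
  This expresses independence by inclusions between flats, so that it is preserved by
  isomorphisms of intersection posets.
\<close>

lemma lin_indep_iff_irredundant:
  assumes "finite I"
  shows "lin_indep u I \<longleftrightarrow> locus u I \<noteq> {} \<and> (\<forall>i\<in>I. \<not> locus u (I - {i}) \<subseteq> locus u {i})"
proof
  assume ind: "lin_indep u I"
  show "locus u I \<noteq> {} \<and> (\<forall>i\<in>I. \<not> locus u (I - {i}) \<subseteq> locus u {i})"
  proof (intro conjI ballI notI)
    show "locus u I = {} \<Longrightarrow> False" using lin_indep_locus_nonempty[OF ind] by simp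
    fix i assume i: "i \<in> I" "locus u (I - {i}) \<subseteq> locus u {i}"
    have "locus u (I - {i}) \<noteq> {}"
      using lin_indep_locus_nonempty[OF lin_indep_mono[OF ind, of "I - {i}"]] by auto
    then have "snd (u i) \<in> lin_span u (I - {i})" by (rule in_span_if_locus_subset[OF _ i(2)])
    then show False using ind i(1) unfolding lin_indep_iff_not_in_span by blast
  qed
next
  assume *: "locus u I \<noteq> {} \<and> (\<forall>i\<in>I. \<not> locus u (I - {i}) \<subseteq> locus u {i})"
  show "lin_indep u I" unfolding lin_indep_iff_not_in_span
  proof (intro ballI notI)
    fix i assume i: "i \<in> I" "snd (u i) \<in> lin_span u (I - {i})"
    moreover have "insert i (I - {i}) = I" using i by auto
    ultimately have "locus u (I - {i}) \<subseteq> locus u {i}"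
      using * by (intro locus_subset_if_in_span) auto
    with * i show False by auto
  qed
qed

lemma card_locus:
  fixes u :: "'i \<Rightarrow> ('a::field, 'd::finite) affine_poly"
  assumes fin: "finite (UNIV :: 'a set)" and ne: "locus u S \<noteq> {}"
  shows "card (locus u S) = CARD('a) ^ (CARD('d) - lin_rank u S)"
proof -
  obtain I where I: "I \<subseteq> S" "lin_indep u I" "\<And>i. i \<in> S \<Longrightarrow> snd (u i) \<in> lin_span u I"
    "card I = lin_rank u S" using exists_basis[of S u] by auto
  show ?thesis using card_locus_lin_indep[OF fin I(2)] locus_basis[OF I(1,3) ne] I(4) by simp
qed

lemma lin_rank_le: "lin_rank u S \<le> CARD('d)" for u :: "'i \<Rightarrow> ('a::field, 'd::finite) affine_poly"
  unfolding lin_rank_def using vec.dim_subset_UNIV[of "lin_parts u S"] vec_dim_card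
  by (simp add: vec.dimension_def card_cart_basis)

lemma lin_rank_mono: "S \<subseteq> T \<Longrightarrow> lin_rank u S \<le> lin_rank u T"
  unfolding lin_rank_def by (intro vec.dim_subset image_mono)

lemma lin_rank_insert:
  "lin_rank u (insert i S) = (if snd (u i) \<in> lin_span u S then lin_rank u S else Suc (lin_rank u S))"
  unfolding lin_rank_def lin_span_def by (simp add: vec.dim_insert)

section \<open>Arrangements as families of affine polynomials\<close>

text \<open>
  These two notions are meant for a set \<open>T\<close> of hyperplanes: the hyperplanes have a common point, and
  no member of \<open>T\<close> contains the intersection of the others. They only refer to the order of \<open>P\<close>.
\<close>

definition poset_central :: "'b set set \<Rightarrow> 'b set set \<Rightarrow> bool" where
  "poset_central P T \<longleftrightarrow> (\<exists>x\<in>P. \<forall>h\<in>T. x \<subseteq> h)"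

definition poset_irredundant :: "'b set set \<Rightarrow> 'b set set \<Rightarrow> bool" where
  "poset_irredundant P T \<longleftrightarrow> (\<forall>h\<in>T. \<exists>x\<in>P. (\<forall>k\<in>T - {h}. x \<subseteq> k) \<and> \<not> x \<subseteq> h)"

definition atoms :: "'b set set \<Rightarrow> 'b set set" where
  "atoms P = {h \<in> P. h \<noteq> UNIV \<and> (\<forall>x\<in>P. h \<subseteq> x \<longrightarrow> x = h \<or> x = UNIV)}"

locale arrangement =
  fixes u :: "'i \<Rightarrow> ('a::field, 'd::finite) affine_poly" and A :: "'i set"
  assumes finite_A: "finite A"
    and nonzero_lin: "\<And>i. i \<in> A \<Longrightarrow> snd (u i) \<noteq> 0"
    and distinct: "inj_on (\<lambda>i. zero_locus (u i)) A"
begin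

abbreviation "hyp i \<equiv> zero_locus (u i)"
abbreviation "hyps \<equiv> hyp ` A"
abbreviation "L \<equiv> flats UNIV hyps"

definition members :: "('a ^ 'd) set \<Rightarrow> 'i set" where
  "members x = {i \<in> A. x \<subseteq> zero_locus (u i)}"

lemma members_subset: "members x \<subseteq> A"
  unfolding members_def by auto

lemma finite_members: "finite (members x)"
  using finite_subset[OF members_subset finite_A] .

lemma finite_L: "finite L"
  by (rule finite_flats) (simp add: finite_A)

lemma members_antimono: "x \<subseteq> y \<Longrightarrow> members y \<subseteq> members x"
  unfolding members_def by auto

lemma locus_in_L: "S \<subseteq> A \<Longrightarrow> locus u S \<noteq> {} \<Longrightarrow> locus u S \<in> L"
  unfolding locus_eq_Inter by (rule Inter_in_flats) auto

lemma locus_members: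
  assumes "x \<in> L"
  shows "locus u (members x) = x"
proof -
  have "x = \<Inter>{h \<in> hyps. x \<subseteq> h}" by (rule flat_eq_Inter[OF assms])
  moreover have "{h \<in> hyps. x \<subseteq> h} = hyp ` members x"
    unfolding members_def by auto
  ultimately show ?thesis unfolding locus_eq_Inter by simp
qed

lemma members_locus: "S \<subseteq> A \<Longrightarrow> S \<subseteq> members (locus u S)"
  unfolding members_def locus_def zero_locus_def by auto

lemma flat_locus_nonempty: "x \<in> L \<Longrightarrow> locus u (members x) \<noteq> {}"
  using locus_members flats_nonempty by metis

lemma subset_iff_members:
  "x \<in> L \<Longrightarrow> y \<in> L \<Longrightarrow> x \<subseteq> y \<longleftrightarrow> members y \<subseteq> members x"
  using locus_members locus_antimono members_antimono by metis

lemma members_inj: "x \<in> L \<Longrightarrow> y \<in> L \<Longrightarrow> members x = members y \<Longrightarrow> x = y"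
  using locus_members by metis

lemma UNIV_in_L: "UNIV \<in> L"
  by (rule ambient_in_flats) auto

lemma hyperplane_nonempty:
  assumes "i \<in> A"
  shows "zero_locus (u i) \<noteq> {}"
proof -
  have "lin_indep u {i}"
    using nonzero_lin[OF assms] by (simp add: lin_indep_iff_not_in_span lin_span_def)
  then show ?thesis using lin_indep_locus_nonempty locus_single by metis
qed

lemma hyperplane_in_L: "i \<in> A \<Longrightarrow> zero_locus (u i) \<in> L"
  using locus_in_L[of "{i}"] hyperplane_nonempty locus_single by (metis empty_subsetI insert_subset)

lemma hyperplane_not_UNIV:
  assumes "i \<in> A"
  shows "zero_locus (u i) \<noteq> UNIV"
proof
  assume "zero_locus (u i) = UNIV"
  then have "locus u {} \<subseteq> locus u {i}" by (simp add: locus_single)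
  then have "snd (u i) \<in> lin_span u {}" by (intro in_span_if_locus_subset) (auto simp: locus_def)
  then show False using nonzero_lin[OF assms] by (simp add: lin_span_def)
qed

lemma hyperplane_subset_eq:
  assumes "i \<in> A" "l \<in> A" "zero_locus (u i) \<subseteq> zero_locus (u l)"
  shows "zero_locus (u i) = zero_locus (u l)"
proof -
  have ne: "locus u {i} \<noteq> {}" using hyperplane_nonempty[OF assms(1)] by (simp add: locus_single)
  have "snd (u l) \<in> lin_span u {i}"
    using in_span_if_locus_subset[OF ne] assms(3) by (simp add: locus_single)
  then obtain k where k: "snd (u l) = k *s snd (u i)"
    unfolding lin_span_def by (auto simp: vec.span_singleton)
  with nonzero_lin[OF assms(2)] have "k \<noteq> 0" by auto
  then have "snd (u i) = (1 / k) *s snd (u l)" by (simp add: k)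
  then have "snd (u i) \<in> lin_span u {l}"
    unfolding lin_span_def by (auto simp: vec.span_singleton)
  moreover have "locus u (insert i {l}) \<noteq> {}"
    using ne assms(3) locus_insert[of u i "{l}"] by (auto simp: locus_single)
  ultimately have "locus u {l} \<subseteq> locus u {i}" by (rule locus_subset_if_in_span)
  with assms(3) show ?thesis by (auto simp: locus_single)
qed

text \<open>
  The hyperplanes are the atoms of the poset, which makes them recognizable after an abstract
  isomorphism.
\<close>

lemma hyps_eq_atoms:
  "hyps = atoms L"
unfolding atoms_def
proof (intro equalityI subsetI)
  fix h assume "h \<in> hyps"
  then obtain i where i: "i \<in> A" "h = zero_locus (u i)" by auto
  have "x = h \<or> x = UNIV" if x: "x \<in> L" "h \<subseteq> x" for x
  proof (cases "members x = {}")
    case True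
    then have "x = UNIV" using locus_members[OF x(1)] by (simp add: locus_def)
    then show ?thesis ..
  next
    case False
    then obtain l where l: "l \<in> A" "x \<subseteq> zero_locus (u l)" unfolding members_def by auto
    then have "h = zero_locus (u l)" using hyperplane_subset_eq[OF i(1) l(1)] i(2) x(2) by auto
    then show ?thesis using l x by auto
  qed
  then show "h \<in> {h \<in> L. h \<noteq> UNIV \<and> (\<forall>x\<in>L. h \<subseteq> x \<longrightarrow> x = h \<or> x = UNIV)}"
    using i hyperplane_in_L hyperplane_not_UNIV by auto
next
  fix h assume h: "h \<in> {h \<in> L. h \<noteq> UNIV \<and> (\<forall>x\<in>L. h \<subseteq> x \<longrightarrow> x = h \<or> x = UNIV)}"
  then have "members h \<noteq> {}" using locus_members[of h] by (auto simp: locus_def)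
  then obtain i where i: "i \<in> A" "h \<subseteq> zero_locus (u i)" unfolding members_def by auto
  then have "zero_locus (u i) = h" using h hyperplane_in_L[OF i(1)] hyperplane_not_UNIV[OF i(1)] by auto
  then show "h \<in> hyps" using i by auto
qed

subsection \<open>The rank of a flat is its codimension\<close>

lemma lin_rank_strict:
  assumes "y \<in> L" "z \<in> L" "z \<subset> y"
  shows "lin_rank u (members y) < lin_rank u (members z)"
proof -
  have sub: "members y \<subseteq> members z" using assms by (intro members_antimono) auto
  have "members y \<noteq> members z" using members_inj assms by blast
  with sub obtain i where i: "i \<in> members z" "i \<notin> members y" by auto
  have "snd (u i) \<notin> lin_span u (members y)"
  proof
    assume s: "snd (u i) \<in> lin_span u (members y)"
    have "locus u (members z) \<subseteq> locus u (insert i (members y))"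
      using sub i by (intro locus_antimono) auto
    then have "locus u (insert i (members y)) \<noteq> {}" using flat_locus_nonempty[OF assms(2)] by auto
    from locus_subset_if_in_span[OF s this] have "y \<subseteq> zero_locus (u i)"
      using locus_members[OF assms(1)] by (simp add: locus_single)
    then show False using i unfolding members_def by auto
  qed
  then have "lin_rank u (insert i (members y)) = Suc (lin_rank u (members y))"
    by (simp add: lin_rank_insert)
  moreover have "lin_rank u (insert i (members y)) \<le> lin_rank u (members z)"
    using sub i by (intro lin_rank_mono) auto
  ultimately show ?thesis by simp
qed

lemma lin_rank_step:
  assumes "y \<in> L" "x \<in> L" "x \<subset> y"
  shows "\<exists>w\<in>L. x \<subseteq> w \<and> w \<subset> y \<and> lin_rank u (members w) = Suc (lin_rank u (members y))"
proof -
  have "\<not> members x \<subseteq> members y" using assms subset_iff_members by blast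
  then obtain i where i: "i \<in> members x" "i \<notin> members y" by auto
  define w where "w = locus u (insert i (members y))"
  have sub: "insert i (members y) \<subseteq> members x" using i assms members_antimono[of x y] by auto
  have "x \<subseteq> w" using locus_antimono[OF sub] locus_members[OF assms(2)] unfolding w_def by auto
  moreover have "w \<subset> y"
  proof -
    have "w \<subseteq> y" using locus_antimono[of "members y" "insert i (members y)" u]
        locus_members[OF assms(1)] unfolding w_def by auto
    moreover have "w \<subseteq> zero_locus (u i)"
      unfolding w_def by (auto simp: locus_def zero_locus_def)
    moreover have "\<not> y \<subseteq> zero_locus (u i)" using i unfolding members_def by auto
    ultimately show ?thesis by auto
  qed
  moreover have wne: "w \<noteq> {}" using \<open>x \<subseteq> w\<close> flats_nonempty[OF assms(2)] by auto
  have iA: "insert i (members y) \<subseteq> A" using sub members_subset by blast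
  have wL: "w \<in> L" using locus_in_L[OF iA] wne unfolding w_def by auto
  moreover have "lin_rank u (members w) = Suc (lin_rank u (members y))"
  proof (rule antisym)
    have "snd (u l) \<in> lin_span u (insert i (members y))" if "l \<in> members w" for l
      using that wne unfolding w_def
      by (intro in_span_if_locus_subset) (auto simp: members_def locus_single)
    then have "lin_rank u (members w) \<le> lin_rank u (insert i (members y))"
      unfolding lin_rank_def lin_span_def by (intro vec.dim_mono) auto
    then show "lin_rank u (members w) \<le> Suc (lin_rank u (members y))"
      by (simp add: lin_rank_insert split: if_splits)
    show "Suc (lin_rank u (members y)) \<le> lin_rank u (members w)"
      using lin_rank_strict[OF assms(1) wL \<open>w \<subset> y\<close>] by simp
  qed
  ultimately show ?thesis by blast
qed

lemma rk_flat:
  assumes "x \<in> L"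
  shows "rk UNIV hyps x = lin_rank u (members x)"
proof -
  have "rk UNIV hyps x = lin_rank u (members x) - lin_rank u (members UNIV)"
    using finite_L assms lin_rank_strict lin_rank_step
    by (intro rk_eq_grading) auto
  moreover have "members UNIV = {}" using hyperplane_not_UNIV unfolding members_def by auto
  ultimately show ?thesis by (simp add: lin_rank_def)
qed

lemma rk_subarrangement:
  assumes H: "flats UNIV H \<subseteq> L" "finite H"
    and up: "\<And>y z. y \<in> L \<Longrightarrow> z \<in> flats UNIV H \<Longrightarrow> z \<subseteq> y \<Longrightarrow> y \<in> flats UNIV H"
    and y: "y \<in> flats UNIV H" and w: "w \<in> flats UNIV H" "w \<subseteq> y"
  shows "rk y (restriction H y) w = rk UNIV hyps w - rk UNIV hyps y"
proof -
  have fl: "flats y (restriction H y) = {z \<in> flats UNIV H. z \<subseteq> y}" by (rule flats_restriction[OF y])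
  have "rk y (restriction H y) w = lin_rank u (members w) - lin_rank u (members y)"
  proof (rule rk_eq_grading)
    show "finite (flats y (restriction H y))"
      unfolding fl using finite_subset[OF H(1) finite_L] by simp
    show "y \<noteq> {}" using flats_nonempty[OF y] .
    show "w \<in> flats y (restriction H y)" unfolding fl using w by auto
    show "lin_rank u (members v) < lin_rank u (members z)"
      if "v \<in> flats y (restriction H y)" "z \<in> flats y (restriction H y)" "z \<subset> v" for v z
      using that H(1) unfolding fl by (intro lin_rank_strict) auto
    show "\<exists>z\<in>flats y (restriction H y). w \<subseteq> z \<and> z \<subset> v \<and>
        lin_rank u (members z) = Suc (lin_rank u (members v))"
      if v0: "v \<in> flats y (restriction H y)" and wv: "w \<subset> v" for v
    proof -
      have v: "v \<in> flats UNIV H" "v \<subseteq> y" using v0 unfolding fl by auto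
      obtain z where z: "z \<in> L" "w \<subseteq> z" "z \<subset> v"
        "lin_rank u (members z) = Suc (lin_rank u (members v))"
        using lin_rank_step[of v w] v w H(1) wv by blast
      then have "z \<in> flats y (restriction H y)" using up[OF z(1) w(1) z(2)] v unfolding fl by auto
      with z show ?thesis by blast
    qed
  qed
  then show ?thesis using rk_flat y w H(1) by (simp add: subset_iff)
qed

subsection \<open>Central and independent subfamilies in terms of the intersection poset\<close>

lemma central_iff:
  assumes "S \<subseteq> A"
  shows "locus u S \<noteq> {} \<longleftrightarrow> poset_central L (hyp ` S)"
proof
  assume "locus u S \<noteq> {}"
  then show "poset_central L (hyp ` S)"
    using locus_in_L[OF assms] unfolding poset_central_def
    by (intro bexI[of _ "locus u S"]) (auto simp: locus_def zero_locus_def)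
next
  assume "poset_central L (hyp ` S)"
  then obtain x where "x \<in> L" "x \<subseteq> locus u S" unfolding poset_central_def locus_eq_Inter by auto
  then show "locus u S \<noteq> {}" using flats_nonempty by blast
qed

lemma lin_indep_iff_poset:
  assumes "S \<subseteq> A"
  shows "lin_indep u S \<longleftrightarrow> poset_central L (hyp ` S) \<and>
    poset_irredundant L (hyp ` S)"
proof -
  have *: "(\<not> locus u (S - {i}) \<subseteq> locus u {i}) \<longleftrightarrow>
      (\<exists>x\<in>L. (\<forall>k\<in>hyp ` S - {hyp i}. x \<subseteq> k) \<and> \<not> x \<subseteq> hyp i)"
    if i: "i \<in> S" and central: "locus u S \<noteq> {}" for i
  proof -
    have diff: "hyp ` S - {hyp i} = hyp ` (S - {i})"
      using distinct assms i unfolding inj_on_def by blast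
    have "locus u S \<subseteq> locus u (S - {i})" by (rule locus_antimono) auto
    then have L: "locus u (S - {i}) \<in> L" using central assms by (intro locus_in_L) auto
    have below: "(\<forall>k\<in>hyp ` (S - {i}). x \<subseteq> k) \<longleftrightarrow> x \<subseteq> locus u (S - {i})" for x
      by (auto simp: locus_eq_Inter)
    show ?thesis unfolding diff locus_single below
    proof
      assume "\<not> locus u (S - {i}) \<subseteq> hyp i"
      then show "\<exists>x\<in>L. x \<subseteq> locus u (S - {i}) \<and> \<not> x \<subseteq> hyp i" using L by auto
    qed (meson subset_trans)
  qed
  have "finite S" using finite_subset[OF assms finite_A] .
  show ?thesis
  proof (cases "locus u S = {}")
    case True
    then show ?thesis
      unfolding lin_indep_iff_irredundant[OF \<open>finite S\<close>] central_iff[OF assms, symmetric] by simp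
  next
    case False
    have "(\<forall>i\<in>S. \<not> locus u (S - {i}) \<subseteq> locus u {i}) \<longleftrightarrow> poset_irredundant L (hyp ` S)"
      unfolding poset_irredundant_def image_iff ball_simps by (rule ball_cong[OF refl *[OF _ False]])
    then show ?thesis
      unfolding lin_indep_iff_irredundant[OF \<open>finite S\<close>] central_iff[OF assms, symmetric]
      using False by simp
  qed
qed

end

lemma poset_iso_image:
  assumes f: "bij_betw f P P'" and ord: "\<And>x y. x \<in> P \<Longrightarrow> y \<in> P \<Longrightarrow> x \<subseteq> y \<longleftrightarrow> f x \<subseteq> f y"
    and T: "T \<subseteq> P"
  shows "poset_central P' (f ` T) \<longleftrightarrow> poset_central P T"
    and "poset_irredundant P' (f ` T) \<longleftrightarrow> poset_irredundant P T"
proof -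
  have P': "P' = f ` P" and inj: "inj_on f P" using f by (auto simp: bij_betw_def)
  show "poset_central P' (f ` T) \<longleftrightarrow> poset_central P T"
    using T ord unfolding poset_central_def P' by (auto simp: subset_iff)
  have diff: "f ` T - {f h} = f ` (T - {h})" if "h \<in> T" for h
    using T inj that unfolding inj_on_def by blast
  have "(\<exists>x\<in>P'. (\<forall>k\<in>f ` T - {f h}. x \<subseteq> k) \<and> \<not> x \<subseteq> f h) \<longleftrightarrow>
      (\<exists>x\<in>P. (\<forall>k\<in>T - {h}. x \<subseteq> k) \<and> \<not> x \<subseteq> h)" if h: "h \<in> T" for h
  proof -
    have "h \<in> P" using h T by auto
    have "(\<forall>k\<in>f ` T - {f h}. f x \<subseteq> k) \<longleftrightarrow> (\<forall>k\<in>T - {h}. x \<subseteq> k)" if "x \<in> P" for x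
      unfolding diff[OF h] using T ord[OF that] by (auto simp: subset_iff)
    then show ?thesis unfolding P' using ord[OF _ \<open>h \<in> P\<close>] by auto
  qed
  then show "poset_irredundant P' (f ` T) \<longleftrightarrow> poset_irredundant P T"
    unfolding poset_irredundant_def by auto
qed

lemma atoms_image:
  assumes f: "bij_betw f P P'" and ord: "\<And>x y. x \<in> P \<Longrightarrow> y \<in> P \<Longrightarrow> x \<subseteq> y \<longleftrightarrow> f x \<subseteq> f y"
    and top: "UNIV \<in> P" "UNIV \<in> P'"
  shows "f ` atoms P =
    atoms P'"
proof -
  have P': "P' = f ` P" and inj: "inj_on f P" using f by (auto simp: bij_betw_def)
  obtain t where "t \<in> P" "f t = UNIV" using top(2) unfolding P' by auto
  then have fU: "f UNIV = UNIV" using ord[of t UNIV] top(1) by auto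
  have eq: "f x = f y \<longleftrightarrow> x = y" if "x \<in> P" "y \<in> P" for x y
    using inj that unfolding inj_on_def by auto
  have eqU: "f x = UNIV \<longleftrightarrow> x = UNIV" if "x \<in> P" for x
    using eq[OF that top(1)] fU by simp
  have max: "(\<forall>x\<in>f ` P. f h \<subseteq> x \<longrightarrow> x = f h \<or> x = UNIV) \<longleftrightarrow> (\<forall>x\<in>P. h \<subseteq> x \<longrightarrow> x = h \<or> x = UNIV)"
    if "h \<in> P" for h
    using that by (simp add: ord[symmetric] eq eqU)
  have img: "f ` {h \<in> P. R h} = {h \<in> f ` P. R' h}" if "\<And>h. h \<in> P \<Longrightarrow> R' (f h) \<longleftrightarrow> R h" for R R'
    using that by auto
  show ?thesis unfolding atoms_def P'
  proof (rule img)
    fix h assume h: "h \<in> P"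
    show "(f h \<noteq> UNIV \<and> (\<forall>x\<in>f ` P. f h \<subseteq> x \<longrightarrow> x = f h \<or> x = UNIV)) \<longleftrightarrow>
        (h \<noteq> UNIV \<and> (\<forall>x\<in>P. h \<subseteq> x \<longrightarrow> x = h \<or> x = UNIV))"
      by (simp only: max[OF h] eqU[OF h])
  qed
qed

lemma (in arrangement) card_subfamilies:
  "card {S. S \<subseteq> A \<and> Q (hyp ` S)} = card {T. T \<subseteq> hyps \<and> Q T}"
proof (rule bij_betw_same_card)
  have inj: "inj_on ((`) hyp) (Pow A)"
    by (rule inj_on_image_Pow[OF distinct])
  show "bij_betw ((`) hyp) {S. S \<subseteq> A \<and> Q (hyp ` S)}
      {T. T \<subseteq> hyps \<and> Q T}"
    unfolding bij_betw_def
  proof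
    show "inj_on ((`) hyp) {S. S \<subseteq> A \<and> Q (hyp ` S)}"
      by (rule inj_on_subset[OF inj]) auto
    show "(`) hyp ` {S. S \<subseteq> A \<and> Q (hyp ` S)} = {T. T \<subseteq> hyps \<and> Q T}"
      by (auto simp: image_iff subset_image_iff) 
  qed
qed

lemma finite_vec_UNIV: "finite (UNIV :: 'a set) \<Longrightarrow> finite (UNIV :: ('a ^ 'd::finite) set)"
  by (rule card_ge_0_finite) (simp add: card_gt_0_iff)

section \<open>A pair of arrangements with isomorphic intersection posets\<close>

text \<open>
  The family \<open>u\<close> will be the arrangement over the number field and \<open>v\<close> its reduction. The assumption
  \<open>relation\<close> is what remains of Cramer's rule after reduction: a linear relation over the number
  field can be cleared of denominators so that the coefficient of \<open>l\<close> stays nonzero.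
\<close>

locale reduction_pair = U: arrangement u A + V: arrangement v A
  for u :: "'i \<Rightarrow> ('a::field, 'd::finite) affine_poly"
    and v :: "'i \<Rightarrow> ('b::field, 'd) affine_poly" and A +
  assumes iso: "\<exists>f. bij_betw f U.L V.L \<and> (\<forall>x\<in>U.L. \<forall>y\<in>U.L. x \<subseteq> y \<longleftrightarrow> f x \<subseteq> f y)"
    and indep_lifts: "\<And>I. I \<subseteq> A \<Longrightarrow> lin_indep v I \<Longrightarrow> lin_indep u I"
    and relation: "\<And>S I l. S \<subseteq> A \<Longrightarrow> I \<subseteq> S \<Longrightarrow> lin_indep v I \<Longrightarrow>
      (\<And>i. i \<in> S \<Longrightarrow> snd (u i) \<in> lin_span u I) \<Longrightarrow> locus u S \<noteq> {} \<Longrightarrow> l \<in> S \<Longrightarrow>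
      \<exists>D c. D \<noteq> 0 \<and> (\<forall>X. D * eval_affine (v l) X = (\<Sum>i\<in>I. c i * eval_affine (v i) X))"
begin

lemma card_eq:
  assumes Q: "\<And>f T. bij_betw f U.L V.L \<Longrightarrow> (\<And>x y. x \<in> U.L \<Longrightarrow> y \<in> U.L \<Longrightarrow> x \<subseteq> y \<longleftrightarrow> f x \<subseteq> f y) \<Longrightarrow>
      T \<subseteq> U.L \<Longrightarrow> Q' (f ` T) \<longleftrightarrow> Q T"
  shows "card {S. S \<subseteq> A \<and> Q (U.hyp ` S)} =
    card {S. S \<subseteq> A \<and> Q' (V.hyp ` S)}"
proof -
  obtain f where f_iso: "bij_betw f U.L V.L \<and> (\<forall>x\<in>U.L. \<forall>y\<in>U.L. x \<subseteq> y \<longleftrightarrow> f x \<subseteq> f y)"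
    using iso ..
  have f: "bij_betw f U.L V.L" using f_iso ..
  have ord: "x \<subseteq> y \<longleftrightarrow> f x \<subseteq> f y" if "x \<in> U.L" "y \<in> U.L" for x y
    using f_iso that by (simp del: subset_eq)
  have sub: "U.hyps \<subseteq> U.L" using U.hyperplane_in_L by auto
  have "f ` U.hyps = V.hyps"
    using atoms_image[OF f ord U.UNIV_in_L V.UNIV_in_L]
    by (simp only: U.hyps_eq_atoms[symmetric] V.hyps_eq_atoms[symmetric])
  then have img: "bij_betw f U.hyps V.hyps"
    using f sub unfolding bij_betw_def by (auto intro: inj_on_subset)
  have "card {T. T \<subseteq> U.hyps \<and> Q T} = card {T. T \<subseteq> V.hyps \<and> Q' T}"
  proof (rule bij_betw_same_card)
    have Qf: "Q' (f ` T) \<longleftrightarrow> Q T" if "T \<subseteq> U.hyps" for T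
      using Q[OF f ord] that sub by blast
    have pow: "bij_betw ((`) f) (Pow U.hyps) (Pow V.hyps)" by (rule bij_betw_Pow[OF img])
    show "bij_betw ((`) f) {T. T \<subseteq> U.hyps \<and> Q T} {T. T \<subseteq> V.hyps \<and> Q' T}"
      unfolding bij_betw_def
    proof
      show "inj_on ((`) f) {T. T \<subseteq> U.hyps \<and> Q T}"
        using pow by (auto simp: bij_betw_def intro: inj_on_subset)
      have surj: "f ` U.hyps = V.hyps" using img by (rule bij_betw_imp_surj_on)
      show "(`) f ` {T. T \<subseteq> U.hyps \<and> Q T} = {T. T \<subseteq> V.hyps \<and> Q' T}"
      proof (intro equalityI subsetI)
        fix T assume "T \<in> (`) f ` {T. T \<subseteq> U.hyps \<and> Q T}"
        then obtain S where S: "S \<subseteq> U.hyps" "Q S" "T = f ` S" by auto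
        then show "T \<in> {T. T \<subseteq> V.hyps \<and> Q' T}"
          using Qf[OF S(1)] image_mono[OF S(1), of f] unfolding surj by simp
      next
        fix T assume T: "T \<in> {T. T \<subseteq> V.hyps \<and> Q' T}"
        then have "T \<subseteq> f ` U.hyps" unfolding surj by simp
        then obtain S where S: "S \<subseteq> U.hyps" "T = f ` S" by (rule subset_imageE)
        then show "T \<in> (`) f ` {T. T \<subseteq> U.hyps \<and> Q T}"
          using T Qf[OF S(1)] by (intro image_eqI[of _ _ S]) simp_all
      qed
    qed
  qed
  then show ?thesis
    using U.card_subfamilies[of Q] V.card_subfamilies[of Q'] by simp
qed

text \<open>
  Independence over the residue field implies independence over the number field, and both sides have
  the same number of independent families because independence is a property of the poset.
\<close>

lemma lin_indep_eq:
  assumes "I \<subseteq> A"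
  shows "lin_indep u I \<longleftrightarrow> lin_indep v I"
proof -
  have sets: "{S. S \<subseteq> A \<and> lin_indep v S} \<subseteq> {S. S \<subseteq> A \<and> lin_indep u S}"
    using indep_lifts by auto
  have "card {S. S \<subseteq> A \<and> lin_indep u S} = card {S. S \<subseteq> A \<and> lin_indep v S}"
    using card_eq[of "\<lambda>T. poset_central V.L T \<and> poset_irredundant V.L T"
        "\<lambda>T. poset_central U.L T \<and> poset_irredundant U.L T"] poset_iso_image[of _ U.L V.L]
    by (simp add: U.lin_indep_iff_poset V.lin_indep_iff_poset cong: conj_cong)
  moreover have "finite {S. S \<subseteq> A \<and> lin_indep u S}" using U.finite_A by simp
  ultimately have "{S. S \<subseteq> A \<and> lin_indep v S} = {S. S \<subseteq> A \<and> lin_indep u S}"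
    using card_subset_eq[OF _ sets] by simp
  with assms show ?thesis by auto
qed

lemma common_basis:
  assumes "S \<subseteq> A"
  shows "\<exists>I\<subseteq>S. lin_indep u I \<and> lin_indep v I \<and> (\<forall>i\<in>S. snd (u i) \<in> lin_span u I) \<and>
    (\<forall>i\<in>S. snd (v i) \<in> lin_span v I) \<and> card I = lin_rank v S"
proof -
  obtain I where I: "I \<subseteq> S" "lin_indep v I" "\<forall>i\<in>S. snd (v i) \<in> lin_span v I"
    "card I = lin_rank v S" using exists_basis[of S v] by auto
  have ui: "lin_indep u I" using indep_lifts I assms by auto
  have "snd (u i) \<in> lin_span u I" if "i \<in> S" for i
  proof (rule ccontr)
    assume n: "snd (u i) \<notin> lin_span u I"
    then have iI: "i \<notin> I" using lin_span_base[of i I u] by auto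
    have "lin_indep u (insert i I)" by (rule lin_indep_insert[OF ui n])
    then have "lin_indep v (insert i I)" using lin_indep_eq[of "insert i I"] that I(1) assms by auto
    moreover have "insert i I - {i} = I" using iI by auto
    ultimately have "snd (v i) \<notin> lin_span v I" unfolding lin_indep_iff_not_in_span by auto
    then show False using I(3) that by auto
  qed
  then show ?thesis using I ui by auto
qed

lemma lin_rank_eq:
  assumes "S \<subseteq> A"
  shows "lin_rank u S = lin_rank v S"
proof -
  obtain I where I: "I \<subseteq> S" "lin_indep u I" "\<forall>i\<in>S. snd (u i) \<in> lin_span u I" "card I = lin_rank v S"
    using common_basis[OF assms] by auto
  have inj: "inj_on (\<lambda>i. snd (u i)) I" and ind: "vec.independent (lin_parts u I)"
    using I(2) unfolding lin_indep_def by auto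
  have "card (lin_parts u I) = vec.dim (lin_parts u S)"
  proof (rule vec.basis_card_eq_dim[OF _ _ ind])
    show "lin_parts u I \<subseteq> lin_parts u S" using I(1) by auto
    show "lin_parts u S \<subseteq> vec.span (lin_parts u I)"
      using I(3) unfolding lin_span_def by auto
  qed
  then show ?thesis using I(4) card_image[OF inj] unfolding lin_rank_def by simp
qed

text \<open>
  A common zero of the reduction of a basis is a zero of the reductions of all members, by the cleared
  relations. So central families reduce to central ones, and the poset isomorphism shows that
  their numbers agree.
\<close>

lemma central_eq:
  assumes "S \<subseteq> A"
  shows "locus u S \<noteq> {} \<longleftrightarrow> locus v S \<noteq> {}"
proof -
  have dir: "locus v S \<noteq> {}" if S: "S \<subseteq> A" "locus u S \<noteq> {}" for S
  proof -
    obtain I where I: "I \<subseteq> S" "lin_indep v I" "\<forall>i\<in>S. snd (u i) \<in> lin_span u I"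
      using common_basis[OF S(1)] by auto
    obtain X where X: "X \<in> locus v I" using lin_indep_locus_nonempty[OF I(2)] by auto
    have "eval_affine (v l) X = 0" if l: "l \<in> S" for l
    proof -
      have span: "\<And>i. i \<in> S \<Longrightarrow> snd (u i) \<in> lin_span u I" using I(3) by simp
      obtain D c where D: "D \<noteq> 0" "D * eval_affine (v l) X = (\<Sum>i\<in>I. c i * eval_affine (v i) X)"
        using relation[OF S(1) I(1,2) span S(2) l] by auto
      have "D * eval_affine (v l) X = 0"
        unfolding D(2) using X by (intro sum.neutral) (auto simp: locus_def)
      then show ?thesis using D(1) by simp
    qed
    then show ?thesis unfolding locus_def by auto
  qed
  then have sets: "{S. S \<subseteq> A \<and> locus u S \<noteq> {}} \<subseteq> {S. S \<subseteq> A \<and> locus v S \<noteq> {}}" by auto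
  have "card {S. S \<subseteq> A \<and> locus u S \<noteq> {}} = card {S. S \<subseteq> A \<and> locus v S \<noteq> {}}"
    using card_eq[of "poset_central V.L" "poset_central U.L"] poset_iso_image(1)[of _ U.L V.L]
    by (simp add: U.central_iff V.central_iff cong: conj_cong)
  moreover have "finite {S. S \<subseteq> A \<and> locus v S \<noteq> {}}" using U.finite_A by simp
  ultimately have "{S. S \<subseteq> A \<and> locus u S \<noteq> {}} = {S. S \<subseteq> A \<and> locus v S \<noteq> {}}"
    using card_subset_eq[OF _ sets] by simp
  with assms show ?thesis by auto
qed

text \<open>
  The polynomials that vanish at a point of the residue field are closed under implication: if the
  zero locus of \<open>T\<close> over the number field lies on a hyperplane, then so does \<open>z\<close>, by a cleared relation.
\<close>

lemma zeros_are_members: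
  assumes S: "S = A \<or> (\<exists>x\<in>U.L. S = U.members x)" and T: "T = {i \<in> S. eval_affine (v i) z = 0}"
  shows "locus u T \<in> U.L" and "U.members (locus u T) = T"
proof -
  have TA: "T \<subseteq> A" using S T U.members_subset by auto
  have "z \<in> locus v T" unfolding T locus_def by auto
  then have ne: "locus u T \<noteq> {}" using central_eq[OF TA] by auto
  show L: "locus u T \<in> U.L" by (rule U.locus_in_L[OF TA ne])
  have "U.members (locus u T) \<subseteq> S"
  proof (cases "S = A")
    case True
    then show ?thesis using U.members_subset by simp
  next
    case False
    then obtain x where x: "x \<in> U.L" "S = U.members x" using S by auto
    have "x \<subseteq> locus u T"
      using locus_antimono[of T S u] U.locus_members[OF x(1)] x(2) T by auto
    then show ?thesis using U.members_antimono x(2) by auto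
  qed
  moreover have "eval_affine (v l) z = 0" if l: "l \<in> U.members (locus u T)" for l
  proof -
    obtain I where I: "I \<subseteq> T" "lin_indep v I" "\<forall>i\<in>T. snd (u i) \<in> lin_span u I"
      using common_basis[OF TA] by auto
    have eq: "locus u I = locus u T" by (rule locus_basis[OF I(1) _ ne]) (use I(3) in auto)
    have sub: "locus u T \<subseteq> locus u {l}" using l by (simp add: U.members_def locus_single)
    then have "snd (u l) \<in> lin_span u I" using ne by (intro in_span_if_locus_subset) (auto simp: eq)
    then have span: "\<And>i. i \<in> insert l T \<Longrightarrow> snd (u i) \<in> lin_span u I" using I(3) by auto
    have ins: "insert l T \<subseteq> A" using l TA U.members_subset by auto
    have "locus u (insert l T) \<noteq> {}" using sub ne locus_insert[of u l T] by auto
    then obtain D c where D: "D \<noteq> 0" "D * eval_affine (v l) z = (\<Sum>i\<in>I. c i * eval_affine (v i) z)"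
      using relation[OF ins subset_insertI2[OF I(1)] I(2) span _ insertI1] by auto
    have "D * eval_affine (v l) z = 0"
      unfolding D(2) using I(1) unfolding T by (intro sum.neutral) auto
    then show ?thesis using D(1) by simp
  qed
  ultimately show "U.members (locus u T) = T"
    using U.members_locus[OF TA] unfolding T by auto
qed

text \<open>
  The possible values of the sets \<open>S\<^sub>n(X)\<close>, indexed like the localizations in the flag series.
\<close>

fun localized :: "('a ^ 'd) set option \<Rightarrow> 'i set" where
  "localized None = A"
| "localized (Some x) = U.members x"

lemma flats_localization_opt:
  assumes "t \<in> insert None (Some ` U.L)"
  shows "flats UNIV (localization_opt U.hyps t) = {y \<in> U.L. U.members y \<subseteq> localized t}"
proof (cases t)
  case None
  then show ?thesis using U.members_subset by auto
next
  case (Some x)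
  then have "x \<in> U.L" using assms by auto
  then show ?thesis using Some flats_localization[of x U.hyps] U.subset_iff_members[of x] by auto
qed

end

text \<open>
  Counting the points of all flats contained in \<open>y\<close> and inverting. The flat \<open>w\<close> has \<open>q^(d - rk w)\<close> points,
  since reduction preserves the codimension.
\<close>

lemma (in reduction_pair) card_points_with_zeros:
  fixes t :: "('a ^ 'd) set option"
  assumes fin: "finite (UNIV :: 'b set)"
    and t: "t \<in> insert None (Some ` U.L)" and y: "y \<in> U.L" "U.members y \<subseteq> localized t"
  defines "q \<equiv> of_nat CARD('b) :: complex"
  shows "of_nat (card {z. {i \<in> localized t. eval_affine (v i) z = 0} = U.members y}) =
     q ^ CARD('d) * (1 / q) ^ rk UNIV U.hyps y *
     poincare y (restriction (localization_opt U.hyps t) y) (- (1 / q))"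
proof -
  let ?rk = "rk UNIV U.hyps"
  have q0: "q \<noteq> 0" using fin unfolding q_def by simp
  define H where "H = localization_opt U.hyps t"
  define Po where "Po = flats UNIV H"
  define P where "P = flats y (restriction H y)"
  have Po: "Po = {y \<in> U.L. U.members y \<subseteq> localized t}"
    unfolding Po_def H_def by (rule flats_localization_opt[OF t])
  have yP: "y \<in> Po" using y Po by auto
  have P: "P = {z \<in> Po. z \<subseteq> y}" unfolding P_def Po_def using flats_restriction yP Po_def by blast
  have PL: "w \<in> U.L" "U.members w \<subseteq> localized t" "w \<in> Po" "w \<subseteq> y" if "w \<in> P" for w
    using that P Po by auto
  have finP: "finite P" using U.finite_L unfolding P Po by simp
  define zeros where "zeros z = {i \<in> localized t. eval_affine (v i) z = 0}" for z
  define f where "f w = (of_nat (card {z. zeros z = U.members w}) :: complex)" for w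
  define g where "g w = q ^ CARD('d) * (1 / q) ^ ?rk w" for w
  have st: "localized t = A \<or> (\<exists>x\<in>U.L. localized t = U.members x)" using t by (cases t) auto
  have finH: "finite H" unfolding H_def
    by (cases t) (auto simp: U.finite_A localization_def)
  have g: "g w = (\<Sum>x \<in> {x \<in> P. x \<subseteq> w}. f x)" if w: "w \<in> P" for w
  proof -
    have locw: "locus v (U.members w) \<noteq> {}"
      using central_eq[OF U.members_subset] U.flat_locus_nonempty PL(1)[OF w] by auto
    have le: "?rk w \<le> CARD('d)"
      using U.rk_flat[OF PL(1)[OF w]] lin_rank_le[of u] by simp
    have "card (locus v (U.members w)) = CARD('b) ^ (CARD('d) - ?rk w)"
      using card_locus[OF fin locw] lin_rank_eq[OF U.members_subset] U.rk_flat[OF PL(1)[OF w]] by simp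
    then have "of_nat (card (locus v (U.members w))) = q ^ (CARD('d) - ?rk w)"
      by (simp add: q_def del: of_nat_power add: of_nat_power[symmetric])
    also have "\<dots> = g w" using le q0 by (simp add: g_def power_diff power_one_over)
    finally have "g w = of_nat (card (locus v (U.members w)))" by simp
    also have "locus v (U.members w) = (\<Union>x\<in>{x \<in> P. x \<subseteq> w}. {z. zeros z = U.members x})"
    proof (intro equalityI subsetI)
      fix z assume z: "z \<in> locus v (U.members w)"
      define x where "x = locus u (zeros z)"
      have x: "x \<in> U.L" "U.members x = zeros z"
        using zeros_are_members[OF st zeros_def[of z]] unfolding x_def by auto
      have "U.members w \<subseteq> zeros z"
        using z PL(2)[OF w] unfolding zeros_def locus_def by auto
      then have "x \<subseteq> w" using U.subset_iff_members[OF x(1) PL(1)[OF w]] x(2) by simp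
      moreover have "x \<in> P"
        using x \<open>x \<subseteq> w\<close> PL(4)[OF w] unfolding P Po zeros_def by auto
      ultimately show "z \<in> (\<Union>x\<in>{x \<in> P. x \<subseteq> w}. {z. zeros z = U.members x})" using x by auto
    next
      fix z assume "z \<in> (\<Union>x\<in>{x \<in> P. x \<subseteq> w}. {z. zeros z = U.members x})"
      then obtain x where "x \<in> P" "x \<subseteq> w" "zeros z = U.members x" by auto
      then have "U.members w \<subseteq> zeros z" using U.members_antimono by auto
      then show "z \<in> locus v (U.members w)" unfolding zeros_def locus_def by auto
    qed
    also have "card \<dots> = (\<Sum>x\<in>{x \<in> P. x \<subseteq> w}. card {z. zeros z = U.members x})"
    proof (rule card_UN_disjoint)
      show "finite {x \<in> P. x \<subseteq> w}" using finP by simp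
      show "\<forall>x\<in>{x \<in> P. x \<subseteq> w}. finite {z. zeros z = U.members x}"
        by (intro ballI finite_subset[OF subset_UNIV finite_vec_UNIV[OF fin]])
      show "\<forall>x\<in>{x \<in> P. x \<subseteq> w}. \<forall>x'\<in>{x \<in> P. x \<subseteq> w}. x \<noteq> x' \<longrightarrow>
          {z. zeros z = U.members x} \<inter> {z. zeros z = U.members x'} = {}"
      proof (intro ballI impI)
        fix x x' assume x: "x \<in> {x \<in> P. x \<subseteq> w}" "x' \<in> {x \<in> P. x \<subseteq> w}" "x \<noteq> x'"
        then have "U.members x \<noteq> U.members x'" using U.members_inj[OF PL(1) PL(1), of x x'] by auto
        then show "{z. zeros z = U.members x} \<inter> {z. zeros z = U.members x'} = {}" by auto
      qed
    qed
    finally show ?thesis by (simp add: f_def)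
  qed
  have mono: "?rk y \<le> ?rk w" if "w \<in> P" for w
    using U.rk_flat PL[OF that] y lin_rank_mono[OF U.members_antimono[OF PL(4)[OF that]]] by simp
  have rk: "rk y (restriction H y) w = ?rk w - ?rk y" if "w \<in> P" for w
  proof (rule U.rk_subarrangement)
    show "flats UNIV H \<subseteq> U.L" using Po Po_def by auto
    show "y' \<in> flats UNIV H" if "y' \<in> U.L" "z \<in> flats UNIV H" "z \<subseteq> y'" for y' z
      using that Po U.members_antimono[OF that(3)] unfolding Po_def by auto
  qed (use finH yP PL[OF that] Po_def in auto)
  have yinP: "y \<in> P" using yP P by auto
  have sub: "{w \<in> P. w \<subseteq> y} = P" using PL(4) by blast
  have "f y = (\<Sum>w\<in>P. of_int (moebius P y w) * g w)"
    using moebius_inversion[OF finP yinP g] unfolding sub by simp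
  also have "\<dots> = (\<Sum>w\<in>P. q ^ CARD('d) * (1 / q) ^ ?rk y *
      (of_int (moebius P y w) * (- (- (1 / q))) ^ rk y (restriction H y) w))"
    by (intro sum.cong refl) (simp add: g_def rk mono power_add[symmetric] mult.assoc mult.left_commute)
  also have "\<dots> = q ^ CARD('d) * (1 / q) ^ ?rk y * poincare y (restriction H y) (- (1 / q))"
    unfolding poincare_def P_def sum_distrib_left by simp
  finally show ?thesis unfolding f_def zeros_def H_def .
qed

section \<open>Discrete valuation rings\<close>

lemma ring_ideal_iff:
  "ring_ideal I \<longleftrightarrow> 0 \<in> I \<and> (\<forall>x\<in>I. \<forall>y\<in>I. x + y \<in> I) \<and> (\<forall>c. \<forall>x\<in>I. c * x \<in> I)"
  for I :: "'o::comm_ring_1 set"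
proof -
  interpret Modules.module "(*) :: 'o \<Rightarrow> 'o \<Rightarrow> 'o" by unfold_locales (auto simp: algebra_simps)
  show ?thesis unfolding ring_ideal_def subspace_def by auto
qed

lemma ring_hom_on_UNIV:
  fixes f :: "'a::comm_ring_1 \<Rightarrow> 'b::comm_ring_1"
  assumes "ring_hom_on UNIV f"
  shows "f 1 = 1" "f (x + y) = f x + f y" "f (x * y) = f x * f y" "f 0 = 0" "f (- x) = - f x"
    "f (x - y) = f x - f y" "f (sum g S) = (\<Sum>s\<in>S. f (g s))"
proof -
  show one: "f 1 = 1" and add: "f (x + y) = f x + f y" and "f (x * y) = f x * f y" for x y
    using assms by (auto simp: ring_hom_on_def)
  have "f 0 + f 0 = f 0 + 0" using add[of 0 0] by simp
  then show zero: "f 0 = 0" by (simp only: add_left_cancel)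
  have "f x + f (- x) = 0" for x using add[of x "- x"] zero by simp
  then show neg: "f (- x) = - f x" for x by (simp add: eq_neg_iff_add_eq_0 add.commute)
  show "f (x - y) = f x - f y" using add[of x "- y"] neg by simp
  show "f (sum g S) = (\<Sum>s\<in>S. f (g s))"
    by (induction S rule: infinite_finite_induct) (auto simp: zero add)
qed

text \<open>
  The kernel of the residue map is the set of nonunits, so the nonunits form an ideal, which has a
  generator. It is nonzero since the unique nonzero prime ideal consists of nonunits.
\<close>

lemma dvr_uniformizer:
  fixes res :: "'o::idom \<Rightarrow> 'f::field"
  assumes "discrete_valuation_ring TYPE('o)" and res: "residue_map res"
  obtains p where "uniformizer p" "p \<noteq> 0" "\<And>x. res x = 0 \<longleftrightarrow> p dvd x"
proof -
  have hom: "ring_hom_on UNIV res" and ker: "{x. res x = 0} = max_ideal"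
    using res by (auto simp: residue_map_def)
  note h = ring_hom_on_UNIV[OF hom]
  have "ring_ideal (max_ideal :: 'o set)"
    unfolding ker[symmetric] ring_ideal_iff by (simp add: h)
  then obtain p :: 'o where p: "max_ideal = range ((*) p)"
    using assms(1) unfolding discrete_valuation_ring_def by metis
  have kp: "res x = 0 \<longleftrightarrow> p dvd x" for x
    using ker p by (auto simp: dvd_def image_iff set_eq_iff)
  obtain P :: "'o set" where P: "prime_ideal P" "P \<noteq> {0}"
    using assms(1) unfolding discrete_valuation_ring_def by auto
  have "P \<subseteq> max_ideal"
  proof
    fix x assume x: "x \<in> P"
    have "\<not> x dvd 1"
    proof
      assume "x dvd 1"
      then obtain y where "1 = x * y" by (rule dvdE)
      then have "1 = y * x" by (simp add: mult.commute)
      then have "z \<in> P" for z using P(1) x unfolding prime_ideal_def ring_ideal_iff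
        by (metis mult.assoc mult.right_neutral)
      then show False using P(1) unfolding prime_ideal_def by auto
    qed
    then show "x \<in> max_ideal" by (simp add: max_ideal_def)
  qed
  moreover have "0 \<in> P" using P(1) unfolding prime_ideal_def ring_ideal_iff by auto
  ultimately have "p \<noteq> 0" using P(2) p by auto
  moreover have "uniformizer p" using p by (simp add: uniformizer_def)
  ultimately show thesis using that[of p] kp by blast
qed

text \<open>
  If all powers of \<open>p\<close> divided \<open>x\<close>, the quotients would generate a strictly increasing chain of ideals,
  whose union could not be principal.
\<close>

lemma dvr_power_dvd_bounded:
  fixes p x :: "'o::idom"
  assumes pid: "\<And>I :: 'o set. ring_ideal I \<Longrightarrow> \<exists>a. I = range ((*) a)"
    and p: "p \<noteq> 0" "\<not> p dvd 1" and x: "x \<noteq> 0"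
  shows "\<exists>n. \<not> p ^ n dvd x"
proof (rule ccontr)
  assume "\<not> (\<exists>n. \<not> p ^ n dvd x)"
  then have "\<forall>n. \<exists>y. x = p ^ n * y" by (auto simp: dvd_def)
  then obtain y where y: "\<And>n. x = p ^ n * y n" by metis
  have y0: "y n \<noteq> 0" for n using x y[of n] by auto
  have step: "y n = p * y (Suc n)" for n
  proof -
    have "p ^ n * y n = p ^ Suc n * y (Suc n)" by (rule trans[OF y[symmetric] y])
    then have "p ^ n * y n = p ^ n * (p * y (Suc n))" by (simp only: power_Suc2 mult.assoc)
    then show ?thesis using p(1) by simp
  qed
  have mono: "y (n + k) dvd y n" for n k
  proof (induction k)
    case (Suc k)
    have "y (n + Suc k) dvd y (n + k)" using step[of "n + k"] by simp
    then show ?case using Suc by (rule dvd_trans)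
  qed simp
  define I where "I = {a. \<exists>n. y n dvd a}"
  have "ring_ideal I"
    unfolding ring_ideal_iff I_def
  proof (intro conjI ballI allI)
    fix a b assume "a \<in> {a. \<exists>n. y n dvd a}" "b \<in> {a. \<exists>n. y n dvd a}"
    then obtain m n where "y m dvd a" "y n dvd b" by auto
    then have "y (m + n) dvd a" "y (m + n) dvd b"
      using mono[of m n] mono[of n m] by (auto simp: add.commute intro: dvd_trans)
    then have "y (m + n) dvd a + b" by (rule dvd_add)
    then show "a + b \<in> {a. \<exists>n. y n dvd a}" by blast
  qed (auto intro: dvd_mult)
  then obtain g where g: "I = range ((*) g)" using pid by blast
  have "g \<in> I" unfolding g by (auto intro!: image_eqI[of _ _ 1])
  then obtain m where m: "y m dvd g" unfolding I_def by auto
  have "y (Suc m) \<in> I" unfolding I_def by (auto intro: exI[of _ "Suc m"])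
  then have "g dvd y (Suc m)" unfolding g by auto
  with m have "y m dvd y (Suc m)" by (rule dvd_trans)
  then obtain c where "y (Suc m) = y m * c" by (rule dvdE)
  then have "y (Suc m) * 1 = y (Suc m) * (p * c)" using step[of m] by (simp add: mult_ac)
  then have "1 = p * c" using y0 by (simp only: mult_cancel_left) simp
  then have "p dvd 1" by (rule dvdI)
  then show False using p(2) by simp
qed

lemma valuation_ge_iff:
  fixes p x :: "'o::idom"
  assumes p: "uniformizer p" and x: "x \<noteq> 0" and bounded: "\<exists>n. \<not> p ^ n dvd x"
  shows "n \<le> valuation x \<longleftrightarrow> p ^ n dvd x"
proof -
  have "p' ^ k dvd x \<longleftrightarrow> p ^ k dvd x" if "uniformizer p'" for p' k
  proof -
    have "range ((*) p') = range ((*) p)" using that p by (simp add: uniformizer_def)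
    moreover have "p * 1 \<in> range ((*) p)" "p' * 1 \<in> range ((*) p')" by (rule rangeI)+
    ultimately have "p \<in> range ((*) p')" "p' \<in> range ((*) p)" by simp_all
    then have "p' dvd p" "p dvd p'" by (blast intro: dvdI)+
    then show ?thesis using dvd_power_same dvd_trans by metis
  qed
  then have val: "valuation x = (GREATEST n. p ^ n dvd x)"
    unfolding valuation_def using p by metis
  from bounded obtain b where b: "\<not> p ^ b dvd x" by auto
  have bound: "n \<le> b" if "p ^ n dvd x" for n
    using that b le_imp_power_dvd[of b n p] by (meson dvd_trans nle_le)
  show ?thesis
  proof
    assume n: "n \<le> valuation x"
    have "p ^ valuation x dvd x" unfolding val
      by (rule GreatestI_nat[of _ 0 b]) (use bound in auto)
    then show "p ^ n dvd x" using le_imp_power_dvd[OF n, of p] by (rule dvd_trans[rotated])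
  next
    assume "p ^ n dvd x"
    then show "n \<le> valuation x" unfolding val by (rule Greatest_le_nat[of _ _ b]) (use bound in auto)
  qed
qed

lemma compact_dvr_open_coset:
  assumes "compact_dvr TYPE('o::{idom, topological_space})" "uniformizer (p :: 'o)"
  shows "open {y. p ^ n dvd y - x}"
proof -
  have iff: "open U \<longleftrightarrow> (\<forall>x\<in>U. \<exists>n. \<forall>y. p ^ n dvd y - x \<longrightarrow> y \<in> U)" for U
    using assms unfolding compact_dvr_def by blast
  have "p ^ n dvd z - x" if "p ^ n dvd y - x" "p ^ n dvd z - y" for y z
    using dvd_add[OF that] by simp
  then show ?thesis unfolding iff by blast
qed

text \<open>
  The residue classes form an open cover of a compact space.
\<close>

lemma compact_dvr_finite_residue_field:
  fixes res :: "'o::{idom, topological_space} \<Rightarrow> 'f::field"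
  assumes dvr: "compact_dvr TYPE('o)" and p: "uniformizer p"
    and res: "residue_map res" and ker: "\<And>x. res x = 0 \<longleftrightarrow> p dvd x"
  shows "finite (UNIV :: 'f set)"
proof -
  have hom: "ring_hom_on UNIV res" and surj: "surj res" using res by (auto simp: residue_map_def)
  have comp: "compact (UNIV :: 'o set)" using dvr by (simp add: compact_dvr_def)
  let ?C = "\<lambda>a. {y. p ^ 1 dvd y - a}"
  have "\<forall>T \<in> range ?C. open T" by (blast intro: compact_dvr_open_coset[OF dvr p])
  moreover have "UNIV \<subseteq> \<Union>(range ?C)"
  proof
    fix x :: 'o
    have "x \<in> ?C x" by simp
    then show "x \<in> \<Union>(range ?C)" by blast
  qed
  ultimately obtain D where D: "D \<subseteq> range ?C" "finite D" "UNIV \<subseteq> \<Union>D"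
    using comp unfolding compact_eq_Heine_Borel by meson
  then obtain E where E: "finite E" "D = ?C ` E" by (meson finite_subset_image)
  have "z \<in> res ` E" for z
  proof -
    obtain x where x: "z = res x" using surj by (metis surjD)
    obtain a where a: "a \<in> E" "p dvd x - a" using D(3) E(2) by auto
    then have "res x = res a" using ker[of "x - a"] ring_hom_on_UNIV(6)[OF hom] by simp
    then show ?thesis using x a by auto
  qed
  then have "UNIV = res ` E" by auto
  then show ?thesis using E(1) by (metis finite_imageI)
qed

section \<open>Integrals of functions of the residual flats\<close>

text \<open>
  The balls of \<open>\<oo>\<^sup>d\<close> are the cosets of \<open>p\<^sup>n \<oo>\<^sup>d\<close>. Each is the disjoint union of \<open>q\<^sup>d\<close> balls of the
  next level, its children, which are indexed by the vectors over the residue field.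
\<close>

locale haar_dvr =
  fixes p :: "'o::{idom, topological_space}" and res :: "'o \<Rightarrow> 'f::field"
    and M :: "('o ^ 'd::finite) measure" and q :: nat
  assumes q_card: "q = CARD('f)" and p0: "p \<noteq> 0" and ker: "\<And>x. res x = 0 \<longleftrightarrow> p dvd x"
    and hom: "ring_hom_on UNIV res" and surj: "surj res"
    and open_residue_class: "\<And>n x. open {y. p ^ n dvd y - x}"
    and finite_f: "finite (UNIV :: 'f set)"
    and haar: "haar_measure M"
begin

lemmas res_simps = ring_hom_on_UNIV[OF hom]

definition lift :: "'f \<Rightarrow> 'o" where "lift = inv_into UNIV res"

lemma res_lift [simp]: "res (lift z) = z"
  unfolding lift_def using surj by (simp add: surj_f_inv_f)

definition coset :: "'o ^ 'd \<Rightarrow> nat \<Rightarrow> ('o ^ 'd) set" where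
  "coset X n = {Y. \<forall>j. p ^ n dvd Y $ j - X $ j}"

definition child :: "'o ^ 'd \<Rightarrow> nat \<Rightarrow> 'f ^ 'd \<Rightarrow> 'o ^ 'd" where
  "child X n z = (\<chi> j. X $ j + p ^ n * lift (z $ j))"

lemma coset_self: "X \<in> coset X n"
  by (simp add: coset_def)

lemma coset_0: "coset X 0 = UNIV"
  by (simp add: coset_def)

lemma coset_trans: "Z \<in> coset Y n \<Longrightarrow> Y \<in> coset X n \<Longrightarrow> Z \<in> coset X n"
  unfolding coset_def mem_Collect_eq
proof
  fix j assume "\<forall>j. p ^ n dvd Z $ j - Y $ j" "\<forall>j. p ^ n dvd Y $ j - X $ j"
  then have "p ^ n dvd (Z $ j - Y $ j) + (Y $ j - X $ j)" by (intro dvd_add) auto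
  then show "p ^ n dvd Z $ j - X $ j" by simp
qed

lemma coset_antimono: "m \<le> n \<Longrightarrow> coset X n \<subseteq> coset X m"
  unfolding coset_def using le_imp_power_dvd dvd_trans by blast

lemma open_coset: "open (coset X n)"
  unfolding open_vec_def
proof
  fix Y assume Y: "Y \<in> coset X n"
  let ?A = "\<lambda>j. {y. p ^ n dvd y - X $ j}"
  show "\<exists>A. (\<forall>i. open (A i) \<and> Y $ i \<in> A i) \<and> (\<forall>y. (\<forall>i. y $ i \<in> A i) \<longrightarrow> y \<in> coset X n)"
    by (rule exI[of _ ?A]) (use Y open_residue_class in \<open>auto simp: coset_def\<close>)
qed

lemma sets_M: "sets M = sets borel" and space_M: "space M = UNIV"
  using haar sets_eq_imp_space_eq[of M borel] by (auto simp: haar_measure_def)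

lemma coset_sets [measurable]: "coset X n \<in> sets M"
  using open_coset by (simp add: sets_M)

lemma finite_M: "finite_measure M"
  using haar by (intro finite_measureI) (simp add: haar_measure_def space_M)

lemma coset_translate: "coset X n = (+) X ` coset 0 n"
proof (intro equalityI subsetI)
  fix Y assume "Y \<in> coset X n"
  then have "Y - X \<in> coset 0 n" by (simp add: coset_def)
  then have "X + (Y - X) \<in> (+) X ` coset 0 n" by (rule imageI)
  then show "Y \<in> (+) X ` coset 0 n" by simp
qed (auto simp: coset_def)

lemma measure_coset_translate: "measure M (coset X n) = measure M (coset 0 n)"
proof -
  have "\<forall>a. \<forall>C\<in>sets M. emeasure M ((+) a ` C) = emeasure M C"
    using haar unfolding haar_measure_def by blast
  then have "emeasure M ((+) X ` coset 0 n) = emeasure M (coset 0 n)" using coset_sets by blast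
  then show ?thesis unfolding measure_def coset_translate[of X] by (rule arg_cong)
qed

lemma coset_child_subset: "coset (child X n z) (Suc n) \<subseteq> coset X n"
proof -
  have "child X n z \<in> coset X n" by (simp add: coset_def child_def)
  then show ?thesis using coset_antimono[of n "Suc n" "child X n z"] by (auto intro: coset_trans)
qed

lemma coset_children_unique:
  assumes "Y \<in> coset X n"
  shows "\<exists>!z. Y \<in> coset (child X n z) (Suc n)"
proof -
  have "\<forall>j. \<exists>b. Y $ j - X $ j = p ^ n * b" using assms by (auto simp: coset_def dvd_def)
  then obtain b where b: "\<And>j. Y $ j - X $ j = p ^ n * b j" by metis
  have "Y \<in> coset (child X n z) (Suc n) \<longleftrightarrow> (\<forall>j. res (b j) = z $ j)" for z
  proof -
    have "p ^ Suc n dvd Y $ j - child X n z $ j \<longleftrightarrow> res (b j) = z $ j" for j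
    proof -
      have "Y $ j - child X n z $ j = p ^ n * (b j - lift (z $ j))"
        using b[of j] by (simp add: child_def algebra_simps)
      then have "p ^ Suc n dvd Y $ j - child X n z $ j \<longleftrightarrow> p ^ n * p dvd p ^ n * (b j - lift (z $ j))"
        by (simp add: mult.commute)
      also have "\<dots> \<longleftrightarrow> p dvd b j - lift (z $ j)" using p0 by (simp only: dvd_mult_cancel_left) simp
      finally show ?thesis by (simp add: ker[symmetric] res_simps)
    qed
    then show ?thesis by (simp add: coset_def)
  qed
  then show ?thesis by (intro ex1I[of _ "\<chi> j. res (b j)"]) (auto simp: vec_eq_iff)
qed

lemma finite_fd: "finite (UNIV :: ('f ^ 'd) set)"
  by (rule card_ge_0_finite) (simp add: card_gt_0_iff finite_f)

lemma indicator_coset_children: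
  "(indicator (coset X n) Y :: real) = (\<Sum>z\<in>UNIV. indicator (coset (child X n z) (Suc n)) Y)"
proof (cases "Y \<in> coset X n")
  case True
  then obtain z where z: "\<And>z'. Y \<in> coset (child X n z') (Suc n) \<longleftrightarrow> z' = z"
    using coset_children_unique[OF True] by auto
  have "(\<Sum>z\<in>UNIV. indicator (coset (child X n z) (Suc n)) Y :: real) = (\<Sum>z'\<in>UNIV. if z' = z then 1 else 0)"
    by (intro sum.cong) (auto simp: z indicator_def)
  then show ?thesis using True finite_fd by simp
next
  case False
  then have "Y \<notin> coset (child X n z) (Suc n)" for z using coset_child_subset by blast
  then show ?thesis using False by simp
qed

lemma q_pos: "q > 0"
  using finite_f by (simp add: card_gt_0_iff q_card)

lemma measure_coset: "measure M (coset X n) = (1 / real q ^ CARD('d)) ^ n"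
proof -
  interpret finite_measure M by (rule finite_M)
  have "measure M (coset 0 n) = (1 / real q ^ CARD('d)) ^ n"
  proof (induction n)
    case 0
    then show ?case using haar by (simp add: coset_0 haar_measure_def measure_def)
  next
    case (Suc n)
    have int: "integrable M (indicator (coset Z m) :: _ \<Rightarrow> real)" for Z m
      by (simp add: integrable_indicator_iff coset_sets emeasure_eq_measure space_M sets.Int_space_eq2)
    have "measure M (coset 0 n) = (\<integral>Y. indicator (coset 0 n) Y \<partial>M)" by (simp add: space_M)
    also have "\<dots> = (\<integral>Y. (\<Sum>z\<in>UNIV. indicator (coset (child 0 n z) (Suc n)) Y) \<partial>M)"
      unfolding indicator_coset_children[of 0 n] ..
    also have "\<dots> = (\<Sum>z\<in>UNIV. measure M (coset (child 0 n z) (Suc n)))"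
      by (subst Bochner_Integration.integral_sum) (auto simp: int space_M)
    also have "\<dots> = real q ^ CARD('d) * measure M (coset 0 (Suc n))"
      by (simp add: measure_coset_translate[of "child 0 n _"] q_card)
    finally show ?case using Suc q_pos by (simp add: field_simps)
  qed
  then show ?thesis by (simp add: measure_coset_translate[of X])
qed

lemma locally_constant_measurable:
  fixes g :: "'o ^ 'd \<Rightarrow> 'c::topological_space"
  assumes "\<And>X Y. Y \<in> coset X n \<Longrightarrow> g Y = g X"
  shows "g \<in> borel_measurable M"
proof (rule borel_measurableI)
  fix U :: "'c set"
  have "g -` U = (\<Union>X\<in>g -` U. coset X n)" using assms coset_self by auto
  moreover have "open (\<Union>X\<in>g -` U. coset X n)" using open_coset by auto
  ultimately have "open (g -` U)" by simp
  then show "g -` U \<inter> space M \<in> sets M" by (simp add: space_M sets_M)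
qed

end

definition zeros :: "('i \<Rightarrow> ('f::comm_ring_1, 'd::finite) affine_poly) \<Rightarrow> 'i set \<Rightarrow> 'f ^ 'd \<Rightarrow> 'i set" where
  "zeros v T z = {i \<in> T. eval_affine (v i) z = 0}"

text \<open>
  The truncated expectation for the Markov chain started at \<open>T\<close>: one step replaces \<open>T\<close> by the
  polynomials that vanish at a uniformly random point, and after \<open>N\<close> steps the chain must have
  reached the empty set.
\<close>

fun average :: "('i \<Rightarrow> ('f::comm_ring_1, 'd::finite) affine_poly) \<Rightarrow> ('i set \<Rightarrow> complex) \<Rightarrow> nat \<Rightarrow> 'i set \<Rightarrow> complex" where
  "average v \<tau> 0 T = (if T = {} then 1 else 0)"
| "average v \<tau> (Suc N) T =
    (\<Sum>z\<in>UNIV. \<tau> (zeros v T z) * average v \<tau> N (zeros v T z)) / of_nat CARD('f) ^ CARD('d)"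

text \<open>
  The assumption \<open>basis\<close> provides, for every family \<open>T\<close> whose reduction has a common zero, a
  subfamily that stays independent after reduction and generates \<open>T\<close> over the discrete valuation
  ring: the denominators \<open>D\<close> are units there.
\<close>

locale haar_family = haar_dvr p res M q
  for p :: "'o::{idom, topological_space}" and res :: "'o \<Rightarrow> 'f::field"
    and M :: "('o ^ 'd::finite) measure" and q +
  fixes A :: "'i set" and w :: "'i \<Rightarrow> ('o, 'd) affine_poly" and v :: "'i \<Rightarrow> ('f, 'd) affine_poly"
  assumes finite_A: "finite A" and v_res: "\<And>i. v i = map_affine res (w i)"
    and basis: "\<And>T. T \<subseteq> A \<Longrightarrow> locus v T \<noteq> {} \<Longrightarrow>
      \<exists>I\<subseteq>T. lin_indep v I \<and> (\<forall>l\<in>T. \<exists>D c. res D \<noteq> 0 \<and>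
        (\<forall>X. D * eval_affine (w l) X = (\<Sum>i\<in>I. c i * eval_affine (w i) X)))"
begin

definition residual :: "nat \<Rightarrow> 'o ^ 'd \<Rightarrow> 'i set" where
  "residual n X = {i \<in> A. p ^ n dvd eval_affine (w i) X}"

text \<open>
  The product over the levels after \<open>n\<close>. The level \<open>n\<close> is a parameter because the integral over a
  ball of level \<open>n\<close> is computed from the integrals over its children.
\<close>

definition trunc :: "('i set \<Rightarrow> complex) \<Rightarrow> nat \<Rightarrow> nat \<Rightarrow> 'o ^ 'd \<Rightarrow> complex" where
  "trunc \<tau> n N X = (if residual (n + N) X = {} then 1 else 0) * (\<Prod>m\<in>{n<..n + N}. \<tau> (residual m X))"

lemma residual_0: "residual 0 X = A"
  by (simp add: residual_def)

lemma residual_decreasing: "m \<le> n \<Longrightarrow> residual n X \<subseteq> residual m X"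
  unfolding residual_def using le_imp_power_dvd dvd_trans by blast

lemma residual_cong:
  assumes "Y \<in> coset X n" "m \<le> n"
  shows "residual m Y = residual m X"
proof -
  have "p ^ m dvd eval_affine (w i) Y \<longleftrightarrow> p ^ m dvd eval_affine (w i) X" for i
  proof -
    have "Y \<in> coset X m" using assms coset_antimono by blast
    then have "p ^ m dvd (\<Sum>j\<in>UNIV. snd (w i) $ j * (Y $ j - X $ j))"
      by (intro dvd_sum dvd_mult) (auto simp: coset_def)
    also have "\<dots> = eval_affine (w i) Y - eval_affine (w i) X"
      by (simp add: eval_affine_def algebra_simps sum_subtractf)
    finally show ?thesis by (metis dvd_diff_commute dvd_diff_left_iff dvd_diff_right_iff diff_add_cancel dvd_add_left_iff dvd_add_right_iff)
  qed
  then show ?thesis by (simp add: residual_def)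
qed

lemma res_eval: "res (eval_affine (w i) X) = eval_affine (v i) (\<chi> j. res (X $ j))"
  by (simp add: eval_affine_def v_res map_affine_def res_simps)

text \<open>
  The quotients \<open>a\<^sub>i\<close> of the values at \<open>X\<close> by \<open>p\<^sup>n\<close> satisfy the same linear relations as the
  polynomials, because \<open>p\<^sup>n\<close> can be cancelled. So their residues are the values of the reduced
  polynomials at a single point, found by solving for the members of a basis. For \<open>n = 0\<close>
  nothing is known about \<open>S\<^sub>0(X) = A\<close>, but the reduction of \<open>X\<close> serves.
\<close>

lemma residual_point:
  obtains z0 where "\<And>i a. i \<in> residual n X \<Longrightarrow> eval_affine (w i) X = p ^ n * a \<Longrightarrow> eval_affine (v i) z0 = res a"
proof (cases n)
  case 0
  show thesis by (rule that[of "\<chi> j. res (X $ j)"]) (auto simp: 0 res_eval[symmetric])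
next
  case (Suc k)
  have "(\<chi> j. res (X $ j)) \<in> locus v (residual n X)"
    using residual_decreasing[of 1 n X] Suc
    by (auto simp: locus_def res_eval[symmetric] ker residual_def)
  then obtain I where I: "I \<subseteq> residual n X" "lin_indep v I"
    and rel: "\<forall>l\<in>residual n X. \<exists>D c. res D \<noteq> 0 \<and>
        (\<forall>X. D * eval_affine (w l) X = (\<Sum>i\<in>I. c i * eval_affine (w i) X))"
    using basis[of "residual n X"] by (auto simp: residual_def)
  have "\<forall>i\<in>residual n X. \<exists>a. eval_affine (w i) X = p ^ n * a" by (auto simp: residual_def dvd_def)
  then obtain a where a: "\<And>i. i \<in> residual n X \<Longrightarrow> eval_affine (w i) X = p ^ n * a i" by metis
  obtain z0 where z0: "\<And>i. i \<in> I \<Longrightarrow> eval_affine (v i) z0 = res (a i)"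
    using lin_indep_solve[OF I(2), of "\<lambda>i. res (a i)"] by auto
  define Z where "Z = (\<chi> j. lift (z0 $ j))"
  have resZ: "res (eval_affine (w i) Z) = eval_affine (v i) z0" for i
    unfolding res_eval by (simp add: Z_def)
  have pn: "p ^ n \<noteq> 0" using p0 by simp
  show thesis
  proof (rule that[of z0])
    fix l b assume l: "l \<in> residual n X" "eval_affine (w l) X = p ^ n * b"
    have "p ^ n * b = p ^ n * a l" by (rule trans[OF l(2)[symmetric] a[OF l(1)]])
    then have b: "b = a l" using pn by (simp only: mult_cancel_left) simp
    obtain D c where D: "res D \<noteq> 0"
      "\<And>X. D * eval_affine (w l) X = (\<Sum>i\<in>I. c i * eval_affine (w i) X)" using rel l(1) by blast
    have "p ^ n * (D * a l) = D * eval_affine (w l) X" using a[OF l(1)] by simp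
    also have "\<dots> = (\<Sum>i\<in>I. c i * (p ^ n * a i))" unfolding D(2)
      using I(1) by (intro sum.cong) (auto simp: a)
    also have "\<dots> = p ^ n * (\<Sum>i\<in>I. c i * a i)" by (simp add: sum_distrib_left mult.left_commute)
    finally have "D * a l = (\<Sum>i\<in>I. c i * a i)" using mult_left_cancel[OF pn] by blast
    then have "res D * res (a l) = (\<Sum>i\<in>I. res (c i) * res (a i))"
      by (metis (no_types, lifting) res_simps(3,7) sum.cong)
    also have "\<dots> = (\<Sum>i\<in>I. res (c i) * eval_affine (v i) z0)" by (simp add: z0)
    also have "\<dots> = res D * eval_affine (v l) z0"
      using arg_cong[OF D(2)[of Z], of res] by (simp add: res_simps resZ)
    finally show "eval_affine (v l) z0 = res b" using D(1) b by simp
  qed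
qed

lemma residual_child:
  obtains z0 where "\<And>z. residual (Suc n) (child X n z) = zeros v (residual n X) (z0 + z)"
proof -
  obtain z0 where z0: "\<And>i a. i \<in> residual n X \<Longrightarrow> eval_affine (w i) X = p ^ n * a \<Longrightarrow> eval_affine (v i) z0 = res a"
    by (rule residual_point[of n X]) blast
  have pn: "p ^ n \<noteq> 0" using p0 by simp
  have "i \<in> residual (Suc n) (child X n z) \<longleftrightarrow> i \<in> zeros v (residual n X) (z0 + z)" for i z
  proof (cases "i \<in> residual n X")
    case False
    have "child X n z \<in> coset X n" using coset_child_subset coset_self by blast
    then have "i \<notin> residual n (child X n z)" using False residual_cong[of _ X n n] by auto
    then have "i \<notin> residual (Suc n) (child X n z)" using residual_decreasing[of n "Suc n"] by auto
    then show ?thesis using False by (simp add: zeros_def)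
  next
    case True
    then obtain a where a: "eval_affine (w i) X = p ^ n * a" by (auto simp: residual_def dvd_def)
    have "eval_affine (w i) (child X n z) =
        eval_affine (w i) X + p ^ n * (\<Sum>j\<in>UNIV. snd (w i) $ j * lift (z $ j))"
      by (simp add: eval_affine_def child_def distrib_left sum.distrib sum_distrib_left mult.left_commute)
    also have "\<dots> = p ^ n * (a + (\<Sum>j\<in>UNIV. snd (w i) $ j * lift (z $ j)))"
      by (simp add: a distrib_left)
    finally have "p ^ Suc n dvd eval_affine (w i) (child X n z) \<longleftrightarrow>
        p dvd a + (\<Sum>j\<in>UNIV. snd (w i) $ j * lift (z $ j))"
      using pn by (simp only: power_Suc2 dvd_mult_cancel_left) simp
    also have "\<dots> \<longleftrightarrow> eval_affine (v i) z0 + (\<Sum>j\<in>UNIV. snd (v i) $ j * z $ j) = 0"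
    proof -
      have "res (snd (w i) $ j) = snd (v i) $ j" for j by (simp add: v_res map_affine_def)
      then show ?thesis unfolding ker[symmetric] by (simp add: z0[OF True a] res_simps)
    qed
    also have "eval_affine (v i) z0 + (\<Sum>j\<in>UNIV. snd (v i) $ j * z $ j) = eval_affine (v i) (z0 + z)"
      by (simp add: eval_affine_def distrib_left sum.distrib)
    finally show ?thesis using True by (auto simp: zeros_def residual_def)
  qed
  then show thesis using that[of z0] by blast
qed

lemma norm_trunc_le:
  assumes "\<And>T. norm (\<tau> T) \<le> 1"
  shows "norm (trunc \<tau> n N X) \<le> 1"
proof -
  have "norm (\<Prod>m\<in>{n<..n + N}. \<tau> (residual m X)) \<le> 1"
    unfolding prod_norm[symmetric] using assms by (intro prod_le_1) auto
  then show ?thesis by (simp add: trunc_def)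
qed

lemma measurable_trunc: "trunc \<tau> n N \<in> borel_measurable M"
proof (rule locally_constant_measurable)
  fix X Y assume Y: "Y \<in> coset X (n + N)"
  have "(\<Prod>m\<in>{n<..n + N}. \<tau> (residual m Y)) = (\<Prod>m\<in>{n<..n + N}. \<tau> (residual m X))"
    by (intro prod.cong refl) (simp add: residual_cong[OF Y])
  then show "trunc \<tau> n N Y = trunc \<tau> n N X" by (simp add: trunc_def residual_cong[OF Y])
qed

lemma integrable_indicator_trunc:
  assumes "\<And>T. norm (\<tau> T) \<le> 1"
  shows "integrable M (\<lambda>Y. indicator (coset X k) Y *\<^sub>R trunc \<tau> n N Y)"
proof -
  interpret finite_measure M by (rule finite_M)
  have [measurable]: "trunc \<tau> n N \<in> borel_measurable M" by (rule measurable_trunc)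
  show ?thesis
    by (rule integrable_const_bound[of _ 1])
      (auto simp: indicator_def norm_trunc_le[OF assms])
qed

text \<open>
  The Markov property: the integral over a ball of level \<open>n\<close> depends only on the set \<open>S\<^sub>n(X)\<close>. The
  translation by \<open>z0\<close> only permutes the children.
\<close>

lemma integral_trunc_coset:
  assumes \<tau>: "\<And>T. norm (\<tau> T) \<le> 1"
  shows "(\<integral>Y. indicator (coset X n) Y *\<^sub>R trunc \<tau> n N Y \<partial>M) =
    (1 / of_nat q ^ CARD('d)) ^ n * average v \<tau> N (residual n X)"
proof (induction N arbitrary: n X)
  case 0
  have "(\<integral>Y. indicator (coset X n) Y *\<^sub>R trunc \<tau> n 0 Y \<partial>M) =
      (\<integral>Y. indicator (coset X n) Y *\<^sub>R average v \<tau> 0 (residual n X) \<partial>M)"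
    by (intro Bochner_Integration.integral_cong refl) (auto simp: indicator_def trunc_def residual_cong)
  also have "\<dots> = measure M (coset X n) *\<^sub>R average v \<tau> 0 (residual n X)"
    using finite_measure.emeasure_finite[OF finite_M, of "coset X n"]
    by (intro has_bochner_integral_integral_eq has_bochner_integral_indicator coset_sets) (simp add: less_top)
  finally show ?case by (simp add: measure_coset scaleR_conv_of_real)
next
  case (Suc N)
  obtain z0 where z0: "\<And>z. residual (Suc n) (child X n z) = zeros v (residual n X) (z0 + z)"
    by (rule residual_child[of n X]) blast
  have trunc_Suc: "trunc \<tau> n (Suc N) Y = \<tau> (residual (Suc n) Y) * trunc \<tau> (Suc n) N Y" for Y
  proof -
    have "{n<..n + Suc N} = insert (Suc n) {Suc n<..Suc n + N}" by auto
    then show ?thesis by (simp add: trunc_def)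
  qed
  let ?z = "\<lambda>z. zeros v (residual n X) (z0 + z)"
  let ?C = "\<lambda>z. coset (child X n z) (Suc n)"
  have "(\<integral>Y. indicator (coset X n) Y *\<^sub>R trunc \<tau> n (Suc N) Y \<partial>M) =
      (\<integral>Y. (\<Sum>z\<in>UNIV. \<tau> (?z z) * (indicator (?C z) Y *\<^sub>R trunc \<tau> (Suc n) N Y)) \<partial>M)"
  proof (intro Bochner_Integration.integral_cong refl)
    fix Y
    have "indicator (coset X n) Y *\<^sub>R trunc \<tau> n (Suc N) Y = (\<Sum>z\<in>UNIV. indicator (?C z) Y *\<^sub>R trunc \<tau> n (Suc N) Y)"
      unfolding indicator_coset_children[of X n] scaleR_sum_left ..
    also have "\<dots> = (\<Sum>z\<in>UNIV. \<tau> (?z z) * (indicator (?C z) Y *\<^sub>R trunc \<tau> (Suc n) N Y))"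
      by (intro sum.cong refl) (auto simp: indicator_def trunc_Suc z0[symmetric] residual_cong)
    finally show "indicator (coset X n) Y *\<^sub>R trunc \<tau> n (Suc N) Y = \<dots>" .
  qed
  also have "\<dots> = (\<Sum>z\<in>UNIV. \<tau> (?z z) * (\<integral>Y. indicator (?C z) Y *\<^sub>R trunc \<tau> (Suc n) N Y \<partial>M))"
    by (subst Bochner_Integration.integral_sum[OF integrable_mult_right[OF integrable_indicator_trunc[OF \<tau>]]])
      (simp only: integral_mult_right_zero)
  also have "\<dots> = (\<Sum>z\<in>UNIV. \<tau> (?z z) *
      ((1 / of_nat q ^ CARD('d)) ^ Suc n * average v \<tau> N (?z z)))"
    by (simp only: Suc.IH z0)
  also have "\<dots> = (\<Sum>z\<in>UNIV. \<tau> (zeros v (residual n X) z) *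
      ((1 / of_nat q ^ CARD('d)) ^ Suc n * average v \<tau> N (zeros v (residual n X) z)))"
    by (rule sum.reindex_bij_betw[of "(+) z0" UNIV UNIV]) (simp add: bij_plus)
  also have "\<dots> = (1 / of_nat q ^ CARD('d)) ^ n * average v \<tau> (Suc N) (residual n X)"
    by (simp add: sum_distrib_left sum_divide_distrib q_card algebra_simps)
  finally show ?case .
qed

lemma integral_trunc: "(\<And>T. norm (\<tau> T) \<le> 1) \<Longrightarrow> (\<integral>Y. trunc \<tau> 0 N Y \<partial>M) = average v \<tau> N A"
  using integral_trunc_coset[of \<tau> 0 0 N] by (simp add: coset_0 residual_0)

text \<open>
  Dominated convergence with the constant bound \<open>1\<close>.
\<close>

lemma integral_limit:
  assumes \<tau>: "\<And>T. norm (\<tau> T) \<le> 1"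
    and F: "\<And>X. (\<lambda>N. trunc \<tau> 0 N X) \<longlonglongrightarrow> F X"
  shows "integrable M F" and "(\<lambda>N. average v \<tau> N A) \<longlonglongrightarrow> (\<integral>X. F X \<partial>M)"
proof -
  interpret finite_measure M by (rule finite_M)
  have meas: "trunc \<tau> 0 N \<in> borel_measurable M" for N by (rule measurable_trunc)
  have measF: "F \<in> borel_measurable M" by (rule borel_measurable_LIMSEQ_metric[OF meas F])
  note dom = measF meas integrable_const[of "1::real"] AE_I2[OF F] AE_I2[OF norm_trunc_le[OF \<tau>]]
  show "integrable M F" by (rule integrable_dominated_convergence[OF dom])
  have "(\<lambda>N. \<integral>X. trunc \<tau> 0 N X \<partial>M) \<longlonglongrightarrow> (\<integral>X. F X \<partial>M)"
    by (rule integral_dominated_convergence[OF dom])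
  then show "(\<lambda>N. average v \<tau> N A) \<longlonglongrightarrow> (\<integral>X. F X \<partial>M)" by (simp add: integral_trunc[OF \<tau>])
qed

end

section \<open>Sums over flags\<close>

text \<open>
  A flag is built from its largest member, so products and sums over flags are needed below an
  arbitrary flat \<open>t\<close>, and \<open>None\<close> stands for no bound, as in the localizations. The factor belongs to two
  consecutive members \<open>x < t\<close> of a flag.
\<close>

definition flag_factor ::
    "'v set \<Rightarrow> 'v set set \<Rightarrow> 'c::comm_ring_1 \<Rightarrow> 'v set option \<Rightarrow> 'v set \<Rightarrow> 'c" where
  "flag_factor E H Y t x = poincare x (restriction (localization_opt H t) x) Y"

definition open_flag_poincare ::
    "'v set \<Rightarrow> 'v set set \<Rightarrow> 'c::comm_ring_1 \<Rightarrow> 'v set list \<Rightarrow> 'v set option \<Rightarrow> 'c" where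
  "open_flag_poincare E H Y F t =
    (\<Prod>k\<le>length F. flag_factor E H Y ((map Some F @ [t]) ! k) ((E # F) ! k))"

lemma flag_poincare_eq: "flag_poincare E H F Y = open_flag_poincare E H Y F None"
  unfolding flag_poincare_def open_flag_poincare_def flag_factor_def by (simp add: Let_def)

lemma open_flag_poincare_Nil: "open_flag_poincare E H Y [] t = flag_factor E H Y t E"
  by (simp add: open_flag_poincare_def)

lemma open_flag_poincare_snoc:
  "open_flag_poincare E H Y (F @ [y]) t = open_flag_poincare E H Y F (Some y) * flag_factor E H Y t y"
proof -
  have "(\<Prod>k\<le>length F. flag_factor E H Y ((map Some (F @ [y]) @ [t]) ! k) ((E # F @ [y]) ! k)) =
      (\<Prod>k\<le>length F. flag_factor E H Y ((map Some F @ [Some y]) ! k) ((E # F) ! k))"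
  proof (intro prod.cong refl)
    fix k assume "k \<in> {..length F}"
    then have k: "k \<le> length F" by simp
    have "(map Some (F @ [y]) @ [t]) ! k = (map Some F @ [Some y]) ! k"
      using k by (auto simp: nth_append)
    moreover have "(E # F @ [y]) ! k = (E # F) ! k"
      using k by (cases k) (auto simp: nth_append)
    ultimately show "flag_factor E H Y ((map Some (F @ [y]) @ [t]) ! k) ((E # F @ [y]) ! k) =
        flag_factor E H Y ((map Some F @ [Some y]) ! k) ((E # F) ! k)" by simp
  qed
  then show ?thesis by (simp add: open_flag_poincare_def nth_append)
qed

lemma finite_flags: "finite P \<Longrightarrow> finite (flags P)"
proof -
  assume "finite P"
  moreover have "flags P \<subseteq> {F. set F \<subseteq> P \<and> distinct F}"
  proof
    fix F assume "F \<in> flags P"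
    then have F: "set F \<subseteq> P" "sorted_wrt (\<lambda>x y. y \<subset> x) F" by (auto simp: flags_def)
    from F(2) have "distinct F" by (induction F) auto
    with F show "F \<in> {F. set F \<subseteq> P \<and> distinct F}" by simp
  qed
  ultimately show ?thesis using finite_subset_distinct finite_subset by blast
qed

definition below :: "'v set set \<Rightarrow> 'v set option \<Rightarrow> 'v set set" where
  "below P t = {y \<in> P. \<forall>x. t = Some x \<longrightarrow> x \<subset> y}"

definition flag_sum :: "'v set \<Rightarrow> 'v set set \<Rightarrow> 'c::field \<Rightarrow> ('v set \<Rightarrow> 'c) \<Rightarrow> 'v set set \<Rightarrow> 'v set option \<Rightarrow> 'c" where
  "flag_sum E H Y T P t =
    (\<Sum>F \<in> flags (below P t). open_flag_poincare E H Y F t * (\<Prod>x\<in>set F. T x / (1 - T x)))"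

lemma fHP_eq_flag_sum: "fHP E H Y T = flag_sum E H Y T (proper_flats E H) None"
  by (simp add: fHP_def flag_sum_def below_def flag_poincare_eq)

lemma flags_below:
  "flags (below P t) = insert [] (\<Union>y \<in> below P t. (\<lambda>F. F @ [y]) ` flags (below P (Some y)))"
proof (intro equalityI subsetI)
  fix F assume F: "F \<in> flags (below P t)"
  show "F \<in> insert [] (\<Union>y \<in> below P t. (\<lambda>F. F @ [y]) ` flags (below P (Some y)))"
  proof (cases F rule: rev_cases)
    case (snoc F' y)
    then have "y \<in> below P t" "F' \<in> flags (below P (Some y))"
      using F by (auto simp: flags_def sorted_wrt_append below_def)
    then show ?thesis using snoc by auto
  qed simp
next
  fix F assume "F \<in> insert [] (\<Union>y \<in> below P t. (\<lambda>F. F @ [y]) ` flags (below P (Some y)))"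
  then show "F \<in> flags (below P t)"
    by (fastforce simp: flags_def sorted_wrt_append below_def)
qed

text \<open>
  A nonempty flag below \<open>t\<close> consists of its largest member \<open>y\<close> and a flag below \<open>y\<close>.
\<close>

lemma flag_sum_rec:
  assumes "finite P"
  shows "flag_sum E H Y T P t = flag_factor E H Y t E +
    (\<Sum>y \<in> below P t. T y * flag_factor E H Y t y * (flag_sum E H Y T P (Some y) / (1 - T y)))"
proof -
  let ?ff = "flag_factor E H Y t"
  let ?g = "\<lambda>F t. open_flag_poincare E H Y F t * (\<Prod>x\<in>set F. T x / (1 - T x))"
  have fin: "finite (below P t)" "finite (flags (below P t))" for t
    using assms by (auto simp: below_def intro!: finite_flags)
  let ?U = "\<Union>y \<in> below P t. (\<lambda>F. F @ [y]) ` flags (below P (Some y))"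
  have "flag_sum E H Y T P t = ?g [] t + (\<Sum>F\<in>?U. ?g F t)"
    unfolding flag_sum_def flags_below[of P t] using fin by (subst sum.insert) auto
  also have "(\<Sum>F\<in>?U. ?g F t) =
      (\<Sum>y\<in>below P t. \<Sum>F \<in> (\<lambda>F. F @ [y]) ` flags (below P (Some y)). ?g F t)"
    using fin by (subst sum.UNION_disjoint) auto
  also have "\<dots> = (\<Sum>y\<in>below P t. \<Sum>F \<in> flags (below P (Some y)). ?g (F @ [y]) t)"
    by (intro sum.cong refl sum.reindex_cong[of "\<lambda>F. F @ [_]"]) (auto simp: inj_on_def)
  also have "\<dots> = (\<Sum>y\<in>below P t. T y * ?ff y * (flag_sum E H Y T P (Some y) / (1 - T y)))"
  proof (intro sum.cong refl)
    fix y assume "y \<in> below P t"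
    have "?g (F @ [y]) t = T y * ?ff y / (1 - T y) * ?g F (Some y)"
      if "F \<in> flags (below P (Some y))" for F
    proof -
      have "y \<notin> set F" using that by (auto simp: flags_def below_def)
      then show ?thesis by (simp add: open_flag_poincare_snoc)
    qed
    then have "(\<Sum>F \<in> flags (below P (Some y)). ?g (F @ [y]) t) =
        (\<Sum>F \<in> flags (below P (Some y)). T y * ?ff y / (1 - T y) * ?g F (Some y))"
      by (rule sum.cong[OF refl])
    also have "\<dots> = T y * ?ff y * (flag_sum E H Y T P (Some y) / (1 - T y))"
      by (simp add: flag_sum_def sum_distrib_left sum_divide_distrib)
    finally show "(\<Sum>F \<in> flags (below P (Some y)). ?g (F @ [y]) t) = \<dots>" .
  qed
  finally show ?thesis by (simp add: open_flag_poincare_Nil)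
qed

section \<open>The limit of the averages\<close>

lemma contraction_tendsto_zero:
  fixes x e :: "nat \<Rightarrow> real"
  assumes rec: "\<And>n. x (Suc n) \<le> r * x n + e n" and r: "0 \<le> r" "r < 1"
    and nonneg: "\<And>n. 0 \<le> x n" and e: "e \<longlonglongrightarrow> 0"
  shows "x \<longlonglongrightarrow> 0"
proof (rule LIMSEQ_I)
  fix d :: real assume d: "0 < d"
  have "(1 - r) * (d / 2) > 0" using d r by simp
  then obtain N where N: "\<And>n. n \<ge> N \<Longrightarrow> norm (e n - 0) < (1 - r) * (d / 2)"
    using LIMSEQ_D[OF e] by blast
  have bound: "x (N + k) \<le> r ^ k * x N + d / 2" for k
  proof (induction k)
    case 0
    then show ?case using d by simp
  next
    case (Suc k)
    have "x (N + Suc k) \<le> r * x (N + k) + e (N + k)" using rec[of "N + k"] by simp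
    also have "\<dots> \<le> r * (r ^ k * x N + d / 2) + (1 - r) * (d / 2)"
      using N[of "N + k"] Suc r(1) by (intro add_mono mult_left_mono) auto
    also have "\<dots> = r ^ Suc k * x N + d / 2" by (simp add: field_simps)
    finally show ?case .
  qed
  have "(\<lambda>k. r ^ k * x N) \<longlonglongrightarrow> 0 * x N"
    using r by (intro tendsto_mult tendsto_const LIMSEQ_power_zero) auto
  then have "(\<lambda>k. r ^ k * x N) \<longlonglongrightarrow> 0" by simp
  then obtain K where K: "\<And>k. k \<ge> K \<Longrightarrow> norm (r ^ k * x N - 0) < d / 2"
    using LIMSEQ_D[of _ 0 "d / 2"] d by (metis half_gt_zero)
  show "\<exists>n0. \<forall>n\<ge>n0. norm (x n - 0) < d"
  proof (intro exI allI impI)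
    fix n assume n: "n \<ge> N + K"
    then have "x (N + (n - N)) \<le> r ^ (n - N) * x N + d / 2" by (intro bound)
    moreover have "norm (r ^ (n - N) * x N - 0) < d / 2" using n by (intro K) simp
    ultimately show "norm (x n - 0) < d" using n nonneg[of n] by simp
  qed
qed

text \<open>
  The distance to the fixed point of the limiting recursion is contracted up to an error that tends to
  zero.
\<close>

lemma affine_recursion_tendsto:
  fixes a b :: "nat \<Rightarrow> complex"
  assumes rec: "\<And>n. a (Suc n) = t * a n + b n" and t: "norm t < 1" and b: "b \<longlonglongrightarrow> \<beta>"
  shows "a \<longlonglongrightarrow> \<beta> / (1 - t)"
proof -
  have t1: "1 - t \<noteq> 0" using t by auto
  define l where "l = \<beta> / (1 - t)"
  have l: "l = t * l + \<beta>" using t1 by (simp add: l_def field_simps)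
  have "(\<lambda>n. norm (a n - l)) \<longlonglongrightarrow> 0"
  proof (rule contraction_tendsto_zero)
    show "norm (a (Suc n) - l) \<le> norm t * norm (a n - l) + norm (b n - \<beta>)" for n
    proof -
      have "a (Suc n) - l = t * (a n - l) + (b n - \<beta>)"
        unfolding rec by (subst l) (simp add: algebra_simps)
      then have "norm (a (Suc n) - l) \<le> norm (t * (a n - l)) + norm (b n - \<beta>)"
        by (simp only: norm_triangle_ineq)
      then show ?thesis by (simp only: norm_mult)
    qed
    show "(\<lambda>n. norm (b n - \<beta>)) \<longlonglongrightarrow> 0" using b by (simp add: tendsto_norm_zero LIM_zero)
  qed (use t in auto)
  then show ?thesis unfolding l_def[symmetric] by (simp add: tendsto_norm_zero_iff LIM_zero_cancel)
qed

context reduction_pair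
begin

text \<open>
  The points over the residue field are grouped by the flat that they determine.
\<close>

lemma average_Suc:
  fixes \<tau> :: "'i set \<Rightarrow> complex" and q :: complex
  assumes fin: "finite (UNIV :: 'b set)" and q: "q = of_nat CARD('b)"
    and t: "t \<in> insert None (Some ` U.L)"
  shows "average v \<tau> (Suc N) (localized t) =
    (\<Sum>y\<in>{y \<in> U.L. U.members y \<subseteq> localized t}. (1 / q) ^ rk UNIV U.hyps y * \<tau> (U.members y) *
      flag_factor UNIV U.hyps (- (1 / q)) t y * average v \<tau> N (U.members y))"
proof -
  let ?S = "localized t"
  let ?ff = "flag_factor UNIV U.hyps (- (1 / q)) t"
  let ?rk = "rk UNIV U.hyps"
  let ?Lt = "{y \<in> U.L. U.members y \<subseteq> ?S}"
  let ?g = "\<lambda>z. locus u (zeros v (?S) z)"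
  let ?h = "\<lambda>T. \<tau> T * average v \<tau> N T"
  have q0: "q \<noteq> 0" using fin q by simp
  have st: "?S = A \<or> (\<exists>x\<in>U.L. ?S = U.members x)" using t by (cases t) auto
  note zm = zeros_are_members[OF st zeros_def]
  have g_in: "?g ` UNIV \<subseteq> ?Lt"
    using zm by (auto simp: zeros_def)
  have g_eq: "?g z = y \<longleftrightarrow> zeros v (?S) z = U.members y" if "y \<in> U.L" for y z
    using zm[of z] U.locus_members[OF that] by auto
  have "(\<Sum>z\<in>UNIV. ?h (zeros v (?S) z)) = (\<Sum>y\<in>?Lt. \<Sum>z\<in>{z \<in> UNIV. ?g z = y}. ?h (zeros v (?S) z))"
    using finite_vec_UNIV[OF fin] U.finite_L g_in by (intro sum.group[symmetric]) auto
  also have "\<dots> = (\<Sum>y\<in>?Lt. of_nat (card {z. {i \<in> ?S. eval_affine (v i) z = 0} = U.members y}) * ?h (U.members y))"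
  proof (intro sum.cong refl)
    fix y assume y: "y \<in> ?Lt"
    have "(\<Sum>z\<in>{z \<in> UNIV. ?g z = y}. ?h (zeros v (?S) z)) = (\<Sum>z\<in>{z. zeros v (?S) z = U.members y}. ?h (U.members y))"
      using g_eq y by (intro sum.cong) auto
    then show "(\<Sum>z\<in>{z \<in> UNIV. ?g z = y}. ?h (zeros v (?S) z)) =
        of_nat (card {z. {i \<in> ?S. eval_affine (v i) z = 0} = U.members y}) * ?h (U.members y)"
      by (simp add: zeros_def)
  qed
  also have "\<dots> = (\<Sum>y\<in>?Lt. q ^ CARD('d) * ((1 / q) ^ ?rk y * \<tau> (U.members y) *
      ?ff y * average v \<tau> N (U.members y)))"
    using card_points_with_zeros[OF fin t] by (intro sum.cong refl) (simp add: q flag_factor_def)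
  finally show ?thesis
    using q0 by (simp add: q sum_distrib_left[symmetric])
qed

text \<open>
  The factor at a repeated flat is the Poincare polynomial of the empty arrangement; this is the term
  that is moved to the left side of the recursion.
\<close>

lemma flag_factor_self:
  assumes "y \<in> U.L"
  shows "flag_factor UNIV U.hyps Y (Some y) y = 1"
proof -
  let ?H = "localization U.hyps y"
  have fl: "flats UNIV ?H = {x \<in> U.L. y \<subseteq> x}" by (rule flats_localization[OF assms])
  then have yin: "y \<in> flats UNIV ?H" using assms by auto
  have one: "flats y (restriction ?H y) = {y}"
    using flats_restriction[OF yin] fl assms by auto
  have "rk y (restriction ?H y) y = rk UNIV U.hyps y - rk UNIV U.hyps y"
    using fl yin by (intro U.rk_subarrangement) (auto simp: U.finite_A localization_def)
  then show ?thesis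
    unfolding flag_factor_def poincare_def by (simp add: one moebius_self)
qed

lemma rk_proper_pos:
  assumes "y \<in> U.L" "y \<noteq> UNIV"
  shows "rk UNIV U.hyps y > 0"
proof -
  have "y \<subset> UNIV" using assms by auto
  then show ?thesis using U.lin_rank_strict[OF U.UNIV_in_L assms(1)] U.rk_flat[OF assms(1)] by simp
qed

lemma members_UNIV: "U.members UNIV = {}"
  using U.hyperplane_not_UNIV unfolding U.members_def by auto

text \<open>
  The limits for the chains started at the flats are computed by induction, starting from the ambient
  space, at which the chain has already reached the empty set. At each further flat \<open>y\<close> the recursion
  has the contraction factor \<open>T y\<close>, of absolute value less than one.
\<close>

lemma average_tendsto_flag_sum:
  fixes \<tau> :: "'i set \<Rightarrow> complex" and q :: complex and T :: "('a ^ 'd) set \<Rightarrow> complex"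
  assumes fin: "finite (UNIV :: 'b set)" and q: "q = of_nat CARD('b)"
    and \<tau>: "\<tau> {} = 1" and T: "\<And>y. y \<in> U.L \<Longrightarrow> T y = (1 / q) ^ rk UNIV U.hyps y * \<tau> (U.members y)"
    and small: "\<And>y. y \<in> proper_flats UNIV U.hyps \<Longrightarrow> norm (T y) < 1"
  shows "(\<lambda>N. average v \<tau> N A) \<longlonglongrightarrow> fHP UNIV U.hyps (- (1 / q)) T"
proof -
  let ?P = "proper_flats UNIV U.hyps"
  let ?ff = "flag_factor UNIV U.hyps (- (1 / q))"
  let ?\<Phi> = "flag_sum UNIV U.hyps (- (1 / q)) T ?P"
  have P: "?P = U.L - {UNIV}" by (simp add: proper_flats_def)
  have finP: "finite ?P" using U.finite_L P by simp
  define val where "val y = (if y = UNIV then 1 else ?\<Phi> (Some y) / (1 - T y))" for y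
  have T_UNIV: "T UNIV = 1"
    using T[OF U.UNIV_in_L] U.rk_flat[OF U.UNIV_in_L] \<tau> by (simp add: members_UNIV lin_rank_def)
  have above: "{x \<in> U.L. \<forall>y. t = Some y \<longrightarrow> y \<subset> x} = insert UNIV (below ?P t)"
    if "t \<in> insert None (Some ` ?P)" for t
    using that P U.UNIV_in_L by (auto simp: below_def)
  have limit_sum: "(\<lambda>N. \<Sum>x\<in>{x \<in> U.L. \<forall>y. t = Some y \<longrightarrow> y \<subset> x}. T x * ?ff t x * average v \<tau> N (U.members x))
      \<longlonglongrightarrow> ?\<Phi> t"
    if t: "t \<in> insert None (Some ` ?P)"
      and lim: "\<And>x. x \<in> U.L \<Longrightarrow> \<forall>y. t = Some y \<longrightarrow> y \<subset> x \<Longrightarrow>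
        (\<lambda>N. average v \<tau> N (U.members x)) \<longlonglongrightarrow> val x" for t
  proof -
    have "?\<Phi> t = ?ff t UNIV + (\<Sum>y\<in>below ?P t. T y * ?ff t y * val y)"
      unfolding flag_sum_rec[OF finP, of _ _ _ _ t]
      by (intro arg_cong2[where f = "(+)"] refl sum.cong) (auto simp: val_def below_def P)
    also have "\<dots> = (\<Sum>x\<in>insert UNIV (below ?P t). T x * ?ff t x * val x)"
      using finP by (subst sum.insert) (auto simp: below_def P T_UNIV val_def)
    finally have \<Phi>: "?\<Phi> t = (\<Sum>x\<in>{x \<in> U.L. \<forall>y. t = Some y \<longrightarrow> y \<subset> x}. T x * ?ff t x * val x)"
      unfolding above[OF t] .
    show ?thesis unfolding \<Phi>
      by (intro tendsto_sum tendsto_mult tendsto_const lim) auto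
  qed
  have empty: "average v \<tau> N {} = 1" for N
  proof (induction N)
    case (Suc N)
    have "CARD('b) > 0" using fin by (simp add: card_gt_0_iff)
    then show ?case using Suc \<tau> by (simp add: zeros_def)
  qed simp
  have lim: "(\<lambda>N. average v \<tau> N (U.members y)) \<longlonglongrightarrow> val y" if "y \<in> U.L" for y
    using that
  proof (induction "card {x \<in> U.L. y \<subset> x}" arbitrary: y rule: less_induct)
    case less
    show ?case
    proof (cases "y = UNIV")
      case True
      then show ?thesis by (simp add: members_UNIV empty val_def)
    next
      case False
      then have y: "y \<in> ?P" using less.prems P by auto
      have t: "Some y \<in> insert None (Some ` U.L)" using less.prems by auto
      let ?b = "\<lambda>N. \<Sum>x\<in>{x \<in> U.L. y \<subset> x}. T x * ?ff (Some y) x * average v \<tau> N (U.members x)"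
      have set: "{x \<in> U.L. U.members x \<subseteq> U.members y} = insert y {x \<in> U.L. y \<subset> x}"
        using U.subset_iff_members[OF less.prems] less.prems by auto
      have "average v \<tau> (Suc N) (U.members y) = T y * average v \<tau> N (U.members y) + ?b N" for N
      proof -
        have "average v \<tau> (Suc N) (U.members y) = (\<Sum>x\<in>insert y {x \<in> U.L. y \<subset> x}.
            T x * ?ff (Some y) x * average v \<tau> N (U.members x))"
          unfolding average_Suc[OF fin q t, of \<tau> N, unfolded localized.simps] set
          using T less.prems by (intro sum.cong refl) auto
        then show ?thesis
          using U.finite_L by (subst (asm) sum.insert) (auto simp: flag_factor_self[OF less.prems])
      qed
      moreover have "?b \<longlonglongrightarrow> ?\<Phi> (Some y)"
      proof -
        have "(\<lambda>N. average v \<tau> N (U.members x)) \<longlonglongrightarrow> val x" if x: "x \<in> U.L" "y \<subset> x" for x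
        proof (rule less.hyps[OF _ x(1)])
          have "{z \<in> U.L. x \<subset> z} \<subset> {z \<in> U.L. y \<subset> z}" using x by auto
          then show "card {z \<in> U.L. x \<subset> z} < card {z \<in> U.L. y \<subset> z}"
            using U.finite_L by (intro psubset_card_mono) auto
        qed
        then show ?thesis using limit_sum[of "Some y"] y by simp
      qed
      ultimately have "(\<lambda>N. average v \<tau> N (U.members y)) \<longlonglongrightarrow> ?\<Phi> (Some y) / (1 - T y)"
        using small[OF y] by (intro affine_recursion_tendsto) auto
      then show ?thesis using False by (simp add: val_def)
    qed
  qed
  have "(\<lambda>N. average v \<tau> (Suc N) (localized None)) \<longlonglongrightarrow> ?\<Phi> None"
  proof -
    have "{y \<in> U.L. U.members y \<subseteq> localized None} = {x \<in> U.L. \<forall>y. None = Some y \<longrightarrow> y \<subset> x}"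
      using U.members_subset by auto
    then have "average v \<tau> (Suc N) (localized None) = (\<Sum>x\<in>{x \<in> U.L. \<forall>y. None = Some y \<longrightarrow> y \<subset> x}.
        T x * ?ff None x * average v \<tau> N (U.members x))" for N
      unfolding average_Suc[OF fin q insertI1] using T by (intro sum.cong) auto
    then show ?thesis using limit_sum[of None] lim by simp
  qed
  then show ?thesis unfolding fHP_eq_flag_sum localized.simps by (rule LIMSEQ_imp_Suc)
qed

end

section \<open>Lifting linear relations from the residue field\<close>

lemma ring_of_integers_closed:
  fixes x y :: "'k::field_char_0"
  shows "0 \<in> (ring_of_integers :: 'k set)" "1 \<in> (ring_of_integers :: 'k set)"
    "x \<in> ring_of_integers \<Longrightarrow> y \<in> ring_of_integers \<Longrightarrow> x + y \<in> ring_of_integers"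
    "x \<in> ring_of_integers \<Longrightarrow> y \<in> ring_of_integers \<Longrightarrow> x * y \<in> ring_of_integers"
    "x \<in> ring_of_integers \<Longrightarrow> - x \<in> ring_of_integers"
  by (auto simp: ring_of_integers_def algebraic_int_add_mult int_imp_algebraic_int)

text \<open>
  The homomorphism is only additive and multiplicative on \<open>R\<close>, so closure of \<open>R\<close> is needed for each
  application to a compound term.
\<close>

locale subring_hom =
  fixes R :: "'a::comm_ring_1 set" and f :: "'a \<Rightarrow> 'b::comm_ring_1"
  assumes zero: "0 \<in> R" and one: "1 \<in> R"
    and add: "\<And>x y. x \<in> R \<Longrightarrow> y \<in> R \<Longrightarrow> x + y \<in> R"
    and mult: "\<And>x y. x \<in> R \<Longrightarrow> y \<in> R \<Longrightarrow> x * y \<in> R"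
    and uminus: "\<And>x. x \<in> R \<Longrightarrow> - x \<in> R"
    and hom: "ring_hom_on R f"
begin

lemma hom_one: "f 1 = 1" and hom_add: "x \<in> R \<Longrightarrow> y \<in> R \<Longrightarrow> f (x + y) = f x + f y"
  and hom_mult: "x \<in> R \<Longrightarrow> y \<in> R \<Longrightarrow> f (x * y) = f x * f y"
  using hom by (auto simp: ring_hom_on_def)

lemma hom_zero: "f 0 = 0"
proof -
  have "f 0 + f 0 = f 0 + 0" using hom_add[OF zero zero] by simp
  then show ?thesis by (simp only: add_left_cancel)
qed

lemma hom_uminus: "x \<in> R \<Longrightarrow> f (- x) = - f x"
  using hom_add[of x "- x"] uminus[of x] hom_zero by (simp add: eq_neg_iff_add_eq_0 add.commute)

lemma sum_closed: "(\<And>s. s \<in> S \<Longrightarrow> g s \<in> R) \<Longrightarrow> sum g S \<in> R \<and> f (sum g S) = (\<Sum>s\<in>S. f (g s))"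
  by (induction S rule: infinite_finite_induct) (auto simp: hom_zero hom_add zero add)

lemma prod_closed: "(\<And>s. s \<in> S \<Longrightarrow> g s \<in> R) \<Longrightarrow> prod g S \<in> R \<and> f (prod g S) = (\<Prod>s\<in>S. f (g s))"
  by (induction S rule: infinite_finite_induct) (auto simp: hom_one hom_mult one mult)

lemma det_closed:
  fixes M :: "'a ^ 'd::finite ^ 'd"
  assumes "\<And>i j. M $ i $ j \<in> R"
  shows "det M \<in> R" and "f (det M) = det (\<chi> i j. f (M $ i $ j))"
proof -
  let ?t = "\<lambda>p. of_int (sign p) * (\<Prod>i\<in>UNIV. M $ i $ p i)"
  have t: "?t p \<in> R \<and> f (?t p) = of_int (sign p) * (\<Prod>i\<in>UNIV. f (M $ i $ p i))" for p :: "'d \<Rightarrow> 'd"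
  proof -
    have "(\<Prod>i\<in>UNIV. M $ i $ p i) \<in> R" "f (\<Prod>i\<in>UNIV. M $ i $ p i) = (\<Prod>i\<in>UNIV. f (M $ i $ p i))"
      using prod_closed[of UNIV "\<lambda>i. M $ i $ p i"] assms by auto
    then show ?thesis by (cases p rule: sign_cases) (auto simp: uminus hom_uminus)
  qed
  have "det M \<in> R \<and> f (det M) = (\<Sum>p | p permutes UNIV. f (?t p))"
    unfolding Determinants.det_def using t by (intro sum_closed) blast
  then show "det M \<in> R" "f (det M) = det (\<chi> i j. f (M $ i $ j))"
    using t by (auto simp: Determinants.det_def)
qed

end

definition integral_poly :: "'a set \<Rightarrow> ('a::comm_ring_1, 'd::finite) affine_poly \<Rightarrow> bool" where
  "integral_poly R L \<longleftrightarrow> fst L \<in> R \<and> (\<forall>j. snd L $ j \<in> R)"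

text \<open>
  The rows of the square matrix \<open>M\<close> are the linear parts of \<open>I\<close> and unit vectors. Its determinant
  reduces to a nonzero element.
\<close>

lemma integral_frame:
  fixes R :: "'k::field set" and \<psi> :: "'k \<Rightarrow> 'f::field" and I :: "('k, 'd::finite) affine_poly set"
  assumes "subring_hom R \<psi>" and int: "\<And>L. L \<in> I \<Longrightarrow> integral_poly R L"
    and ind: "lin_indep (map_affine \<psi>) I"
  shows "\<exists>(e :: _ \<Rightarrow> 'd) M. inj_on e I \<and> (\<forall>L\<in>I. row (e L) M = snd L) \<and>
    (\<forall>i j. M $ i $ j \<in> R) \<and> \<psi> (det M) \<noteq> 0"
proof -
  interpret subring_hom R \<psi> by fact
  obtain e :: "_ \<Rightarrow> 'd" and w a where e: "inj_on e I" "\<forall>L\<in>I. w (e L) = snd (map_affine \<psi> L)"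
    "\<forall>k. k \<notin> e ` I \<longrightarrow> w k = axis (a k) 1" and det: "det (\<chi> k. w k) \<noteq> 0"
    using lin_indep_complete_to_frame[OF ind] by blast
  define M where "M = (\<chi> k. if k \<in> e ` I then snd (inv_into I e k) else axis (a k) (1 :: 'k))"
  have M_e: "row (e L) M = snd L" if "L \<in> I" for L
    using that e(1) by (simp add: M_def Finite_Cartesian_Product.row_def vec_eq_iff)
  have M_R: "M $ i $ j \<in> R" for i j
  proof (cases "i \<in> e ` I")
    case True
    then have "inv_into I e i \<in> I" by (rule inv_into_into)
    then show ?thesis using True int by (simp add: M_def integral_poly_def)
  next
    case False
    then show ?thesis by (simp add: M_def axis_def zero one)
  qed
  have "(\<chi> i j. \<psi> (M $ i $ j)) = (\<chi> k. w k)"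
  proof -
    have "\<psi> (M $ i $ j) = w i $ j" for i j
    proof (cases "i \<in> e ` I")
      case True
      then obtain L where "L \<in> I" "i = e L" by auto
      then show ?thesis using e(1,2) by (simp add: M_def map_affine_def)
    next
      case False
      then show ?thesis using e(3) by (simp add: M_def axis_def hom_zero hom_one)
    qed
    then show ?thesis by (simp add: vec_eq_iff)
  qed
  then have "\<psi> (det M) \<noteq> 0" using det det_closed(2)[of M] M_R by simp
  then show ?thesis using e(1) M_e M_R by blast
qed

lemma lin_indep_lifts:
  fixes R :: "'k::field set" and \<psi> :: "'k \<Rightarrow> 'f::field" and I :: "('k, 'd::finite) affine_poly set"
  assumes hom: "subring_hom R \<psi>" and int: "\<And>L. L \<in> I \<Longrightarrow> integral_poly R L"
    and ind: "lin_indep (map_affine \<psi>) I"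
  shows "lin_indep (\<lambda>L. L) I"
proof -
  obtain e :: "_ \<Rightarrow> 'd" and M where e: "inj_on e I" "\<forall>L\<in>I. row (e L) M = snd L" and det: "\<psi> (det M) \<noteq> 0"
    using integral_frame[OF assms] by blast
  have "det M \<noteq> 0" using det subring_hom.hom_zero[OF hom] by auto
  then have ind: "vec.independent (rows M)" and rows: "\<And>i j. row i M = row j M \<Longrightarrow> i = j"
    using det_dependent_rows[of M] Determinants.det_identical_rows[where A = M] by blast+
  have "snd ` I \<subseteq> rows M"
  proof
    fix x assume "x \<in> snd ` I"
    then obtain L where "L \<in> I" "x = row (e L) M" using e(2) by auto
    then show "x \<in> rows M" unfolding Finite_Cartesian_Product.rows_def by blast
  qed
  then have "vec.independent (snd ` I)" by (rule vec.independent_mono[OF ind])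
  moreover have "inj_on snd I"
  proof (rule inj_onI)
    fix L L' assume L: "L \<in> I" "L' \<in> I" "snd L = snd L'"
    then have "row (e L) M = row (e L') M" using e(2) by simp
    then have "e L = e L'" by (rule rows)
    then show "L = L'" using e(1) L by (simp add: inj_on_def)
  qed
  ultimately show ?thesis unfolding lin_indep_def by simp
qed

text \<open>
  Cramer's rule for the matrix of the frame expresses the coefficients of the linear part of \<open>l\<close> with
  the common denominator \<open>D\<close>, the determinant, which does not vanish in the residue field. The common
  zero extends the relation to the constant terms.
\<close>

lemma integral_relation:
  fixes R :: "'k::field set" and \<psi> :: "'k \<Rightarrow> 'f::field" and I :: "('k, 'd::finite) affine_poly set"
  assumes sh: "subring_hom R \<psi>" and int: "\<And>L. L \<in> S \<Longrightarrow> integral_poly R L" and IS: "I \<subseteq> S"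
    and ind: "lin_indep (map_affine \<psi>) I"
    and span: "\<And>L. L \<in> S \<Longrightarrow> snd L \<in> lin_span (\<lambda>L. L) I"
    and central: "locus (\<lambda>L. L) S \<noteq> {}" and l: "l \<in> S"
  shows "\<exists>D C. D \<in> R \<and> \<psi> D \<noteq> 0 \<and> (\<forall>L\<in>I. C L \<in> R) \<and> D * fst l = (\<Sum>L\<in>I. C L * fst L) \<and>
    (\<forall>j. D * snd l $ j = (\<Sum>L\<in>I. C L * snd L $ j))"
proof -
  have intI: "\<And>L. L \<in> I \<Longrightarrow> integral_poly R L" using int IS by auto
  interpret subring_hom R \<psi> by fact
  obtain e :: "_ \<Rightarrow> 'd" and M where e: "inj_on e I" "\<forall>L\<in>I. row (e L) M = snd L"
    and MR: "\<forall>i j. M $ i $ j \<in> R" and det: "\<psi> (det M) \<noteq> 0"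
    using integral_frame[OF sh intI ind] by blast
  have indK: "lin_indep (\<lambda>L. L) I" by (rule lin_indep_lifts[OF sh intI ind])
  obtain c where c: "snd l = (\<Sum>L\<in>I. c L *s snd L)"
    using span_coefficients[OF indK span[OF l]] by blast
  obtain X0 where "X0 \<in> locus (\<lambda>L. L) S" using central by blast
  then have "X0 \<in> locus (\<lambda>L. L) (insert l I)" using IS l unfolding locus_def by auto
  then have fst: "fst l = (\<Sum>L\<in>I. c L * fst L)"
    using eval_affine_combination(1)[of "\<lambda>L. L" l c I X0] c by simp
  define x where "x = (\<chi> k. if k \<in> e ` I then c (inv_into I e k) else 0)"
  have "(\<Sum>k\<in>UNIV. x $ k *s row k M) = (\<Sum>k\<in>e ` I. x $ k *s row k M)"
    by (rule sum.mono_neutral_right) (auto simp: x_def)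
  also have "\<dots> = (\<Sum>L\<in>I. x $ e L *s row (e L) M)"
    using e(1) by (simp add: sum.reindex)
  also have "\<dots> = snd l"
    unfolding c using e by (intro sum.cong) (auto simp: x_def)
  finally have sum: "(\<Sum>k\<in>UNIV. x $ k *s row k M) = snd l" .
  have C: "det M * c L \<in> R" if "L \<in> I" for L
  proof -
    let ?N = "(\<chi> i. if i = e L then snd l else row i M)"
    have "det ?N = x $ e L * det M"
      using cramer_lemma_transpose[of "e L" x M] unfolding sum .
    also have "x $ e L = c L" using that e(1) by (simp add: x_def)
    finally have "det M * c L = det ?N" by (simp add: mult.commute)
    moreover have "?N $ i $ j \<in> R" for i j
      using MR int[OF l] by (simp add: integral_poly_def Finite_Cartesian_Product.row_def)
    ultimately show ?thesis using det_closed(1)[of ?N] by simp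
  qed
  show ?thesis
  proof (intro exI[of _ "det M"] exI[of _ "\<lambda>L. det M * c L"] conjI ballI allI)
    show "det M \<in> R" using det_closed(1)[of M] MR by blast
    show "det M * fst l = (\<Sum>L\<in>I. det M * c L * fst L)"
      by (simp add: fst sum_distrib_left mult.assoc)
    show "det M * snd l $ j = (\<Sum>L\<in>I. det M * c L * snd L $ j)" for j
      by (simp add: c sum_distrib_left mult.assoc)
  qed (use det C in auto)
qed

lemma map_affine_relation:
  assumes "subring_hom R f" and l: "integral_poly R l" and I: "\<And>L. L \<in> I \<Longrightarrow> integral_poly R L"
    and D: "D \<in> R" and C: "\<And>L. L \<in> I \<Longrightarrow> C L \<in> R"
    and fst: "D * fst l = (\<Sum>L\<in>I. C L * fst L)"
    and snd: "\<And>j. D * snd l $ j = (\<Sum>L\<in>I. C L * snd L $ j)"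
  shows "f D * eval_affine (map_affine f l) X = (\<Sum>L\<in>I. f (C L) * eval_affine (map_affine f L) X)"
proof -
  interpret subring_hom R f by fact
  have rel: "f D * f a = (\<Sum>L\<in>I. f (C L) * f (b L))"
    if "D * a = (\<Sum>L\<in>I. C L * b L)" "a \<in> R" "\<And>L. L \<in> I \<Longrightarrow> b L \<in> R" for a b
  proof -
    have "f D * f a = f (D * a)" by (rule hom_mult[OF D that(2), symmetric])
    also have "\<dots> = (\<Sum>L\<in>I. f (C L * b L))" unfolding that(1) using sum_closed[of I "\<lambda>L. C L * b L"] C that mult by simp
    also have "\<dots> = (\<Sum>L\<in>I. f (C L) * f (b L))" using C that hom_mult by (intro sum.cong) auto
    finally show ?thesis .
  qed
  have "f D * eval_affine (map_affine f l) X = f D * f (fst l) + (\<Sum>j\<in>UNIV. f D * f (snd l $ j) * X $ j)"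
    by (simp add: eval_affine_def map_affine_def distrib_left sum_distrib_left mult.assoc)
  also have "\<dots> = (\<Sum>L\<in>I. f (C L) * f (fst L)) + (\<Sum>j\<in>UNIV. (\<Sum>L\<in>I. f (C L) * f (snd L $ j)) * X $ j)"
    using rel[OF fst] rel[OF snd] l I by (simp add: integral_poly_def)
  also have "(\<Sum>j\<in>UNIV. (\<Sum>L\<in>I. f (C L) * f (snd L $ j)) * X $ j) =
      (\<Sum>L\<in>I. f (C L) * (\<Sum>j\<in>UNIV. f (snd L $ j) * X $ j))"
    unfolding sum_distrib_right sum_distrib_left mult.assoc by (rule sum.swap)
  finally show ?thesis
    by (simp add: eval_affine_def map_affine_def distrib_left sum.distrib)
qed

section \<open>Good reduction\<close>

text \<open>
  A priori two polynomials may reduce to proportional ones. The isomorphism preserves the number of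
  atoms and thereby excludes this.
\<close>

lemma reduction_distinct_hyperplanes:
  fixes A :: "('k::field, 'd::finite) affine_poly set" and B :: "('f::field, 'd) affine_poly set"
  assumes A: "finite A" "inj_on zero_locus A" "\<forall>L\<in>A. nondegenerate L" and B: "finite B" "\<forall>L\<in>B. nondegenerate L"
    and f: "bij_betw f (arr_flats A) (arr_flats B)"
    and ord: "\<forall>x\<in>arr_flats A. \<forall>y\<in>arr_flats A. x \<subseteq> y \<longleftrightarrow> f x \<subseteq> f y"
  shows "card (hyperplanes B) = card A"
proof -
  interpret U: arrangement "\<lambda>L. L" A
    using A by unfold_locales (auto simp: nondegenerate_def)
  obtain B' where B': "B' \<subseteq> B" "inj_on zero_locus B'" "zero_locus ` B = zero_locus ` B'"
    using subset_image_inj[of "zero_locus ` B" zero_locus B] by auto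
  interpret V: arrangement "\<lambda>L. L" B'
    using B B' finite_subset by unfold_locales (auto simp: nondegenerate_def)
  have hA: "hyperplanes A = U.hyps" and hB: "hyperplanes B = V.hyps"
    using B'(3) by (auto simp: hyperplanes_def)
  have f': "bij_betw f U.L V.L" using f unfolding hA hB .
  have ord': "x \<subseteq> y \<longleftrightarrow> f x \<subseteq> f y" if "x \<in> U.L" "y \<in> U.L" for x y
    using ord[unfolded hA, THEN bspec, OF that(1), THEN bspec, OF that(2)] .
  have "f ` U.hyps = V.hyps"
    using atoms_image[OF f' ord' U.UNIV_in_L V.UNIV_in_L]
    by (simp only: U.hyps_eq_atoms[symmetric] V.hyps_eq_atoms[symmetric])
  moreover have "inj_on f U.hyps"
    by (rule inj_on_subset[OF bij_betw_imp_inj_on[OF f'] image_subsetI[OF U.hyperplane_in_L]])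
  ultimately have "card V.hyps = card U.hyps" using card_image[of f U.hyps] by simp
  also have "\<dots> = card A" using A(2) by (simp add: card_image)
  finally show ?thesis unfolding hB .
qed

lemma good_reduction_pair:
  fixes A :: "('k::field, 'd::finite) affine_poly set" and \<psi> :: "'k \<Rightarrow> 'f::field"
  assumes A: "finite A" "inj_on zero_locus A" "\<forall>L\<in>A. nondegenerate L"
    and hom: "subring_hom R \<psi>" and int: "\<And>L. L \<in> A \<Longrightarrow> integral_poly R L"
    and nondeg: "\<forall>L\<in>map_affine \<psi> ` A. nondegenerate L"
    and f: "bij_betw f (arr_flats A) (arr_flats (map_affine \<psi> ` A))"
    and ord: "\<forall>x\<in>arr_flats A. \<forall>y\<in>arr_flats A. x \<subseteq> y \<longleftrightarrow> f x \<subseteq> f y"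
  shows "reduction_pair (\<lambda>L. L) (map_affine \<psi>) A"
proof -
  have "card (hyperplanes (map_affine \<psi> ` A)) = card A"
    by (rule reduction_distinct_hyperplanes[OF A _ nondeg f ord]) (use A in simp)
  then have inj: "inj_on (\<lambda>L. zero_locus (map_affine \<psi> L)) A"
    using A(1) by (intro eq_card_imp_inj_on) (auto simp: hyperplanes_def image_image)
  show ?thesis
  proof
    show "finite A" by fact
    show "inj_on (\<lambda>i. zero_locus (map_affine \<psi> i)) A" by fact
    show "snd i \<noteq> 0" "snd (map_affine \<psi> i) \<noteq> 0" if "i \<in> A" for i
      using that A(3) nondeg by (auto simp: nondegenerate_def)
    show "inj_on (\<lambda>i. zero_locus i) A" using A(2) by simp
    show "\<exists>f. bij_betw f (flats UNIV ((\<lambda>i. zero_locus i) ` A)) (flats UNIV ((\<lambda>i. zero_locus (map_affine \<psi> i)) ` A)) \<and>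
        (\<forall>x\<in>flats UNIV ((\<lambda>i. zero_locus i) ` A). \<forall>y\<in>flats UNIV ((\<lambda>i. zero_locus i) ` A). x \<subseteq> y \<longleftrightarrow> f x \<subseteq> f y)"
      using f ord unfolding hyperplanes_def image_image by blast
    show "lin_indep (\<lambda>L. L) I" if "I \<subseteq> A" "lin_indep (map_affine \<psi>) I" for I
      using that int by (intro lin_indep_lifts[OF hom]) auto
    show "\<exists>D c. D \<noteq> 0 \<and> (\<forall>X. D * eval_affine (map_affine \<psi> l) X = (\<Sum>i\<in>I. c i * eval_affine (map_affine \<psi> i) X))"
      if S: "S \<subseteq> A" "I \<subseteq> S" "lin_indep (map_affine \<psi>) I"
        "\<And>i. i \<in> S \<Longrightarrow> snd i \<in> lin_span (\<lambda>L. L) I" "locus (\<lambda>L. L) S \<noteq> {}" "l \<in> S" for S I l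
    proof -
      have intS: "\<And>L. L \<in> S \<Longrightarrow> integral_poly R L" using int S(1) by auto
      obtain D C where D: "D \<in> R" "\<psi> D \<noteq> 0" "\<forall>L\<in>I. C L \<in> R" "D * fst l = (\<Sum>L\<in>I. C L * fst L)"
        "\<forall>j. D * snd l $ j = (\<Sum>L\<in>I. C L * snd L $ j)"
        using integral_relation[OF hom intS S(2-6)] by blast
      have "\<psi> D * eval_affine (map_affine \<psi> l) X = (\<Sum>L\<in>I. \<psi> (C L) * eval_affine (map_affine \<psi> L) X)" for X
        using D S(2,6) intS by (intro map_affine_relation[OF hom]) auto
      then show ?thesis using D(2) by (intro exI[of _ "\<psi> D"] exI[of _ "\<lambda>L. \<psi> (C L)"]) simp
    qed
  qed
qed

section \<open>Rational continuation\<close>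

lemma poly_funs_sum: "(\<And>a. a \<in> S \<Longrightarrow> f a \<in> poly_funs I) \<Longrightarrow> (\<lambda>t. \<Sum>a\<in>S. f a t) \<in> poly_funs I"
  by (induction S rule: infinite_finite_induct) (auto intro: poly_funs.intros)

lemma poly_funs_prod: "(\<And>a. a \<in> S \<Longrightarrow> f a \<in> poly_funs I) \<Longrightarrow> (\<lambda>t. \<Prod>a\<in>S. f a t) \<in> poly_funs I"
  by (induction S rule: infinite_finite_induct) (auto intro: poly_funs.intros)

lemma poly_funs_diff:
  assumes "P \<in> poly_funs I" "Q \<in> poly_funs I"
  shows "(\<lambda>t. P t - Q t) \<in> poly_funs I"
proof -
  have "(\<lambda>t. P t + (- 1) * Q t) \<in> poly_funs I"
    using assms by (intro poly_funs.add poly_funs.mult poly_funs.const)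
  then show ?thesis by simp
qed

lemma poly_funs_on_ray:
  assumes "P \<in> poly_funs I"
  shows "\<exists>p. \<forall>m. P (\<lambda>x. m * w x) = poly p m"
  using assms
proof induction
  case (const c)
  show ?case by (intro exI[of _ "[:c:]"]) simp
next
  case (var x)
  show ?case by (intro exI[of _ "[:0, w x:]"]) simp
next
  case (add P Q)
  then obtain p r where "\<forall>m. P (\<lambda>x. m * w x) = poly p m" "\<forall>m. Q (\<lambda>x. m * w x) = poly r m" by blast
  then show ?case by (intro exI[of _ "p + r"]) simp
next
  case (mult P Q)
  then obtain p r where "\<forall>m. P (\<lambda>x. m * w x) = poly p m" "\<forall>m. Q (\<lambda>x. m * w x) = poly r m" by blast
  then show ?case by (intro exI[of _ "p * r"]) simp
qed

lemma qpow_add_nat: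
  assumes "q > 0"
  shows "qpow q (\<lambda>x. s x + of_nat n) = (\<lambda>x. (1 / of_nat q) ^ n * qpow q s x)"
proof
  fix x
  have q: "(of_nat q :: complex) \<noteq> 0" using assms by simp
  have "of_nat q powr (- (s x + of_nat n)) = of_nat q powr (- of_nat n) * of_nat q powr (- s x :: complex)"
    by (simp add: powr_add[symmetric] algebra_simps)
  also have "of_nat q powr (- of_nat n) = (1 / of_nat q :: complex) ^ n"
    using q by (simp add: powr_minus powr_complexpow power_one_over inverse_eq_divide)
  finally show "qpow q (\<lambda>x. s x + of_nat n) x = (1 / of_nat q) ^ n * qpow q s x"
    by (simp add: qpow_def)
qed

text \<open>
  Replacing \<open>s\<close> by \<open>s + n\<close> multiplies all \<open>q\<^sup>-\<^sup>s\<close> by the same number \<open>q\<^sup>-\<^sup>n\<close>. On the line of multiples of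
  the given point, \<open>R\<close> is a polynomial in one variable with infinitely many zeros.
\<close>

lemma poly_fun_zero_if_zero_on_half_space:
  assumes I: "finite I" and q: "q > 1" and R: "R \<in> poly_funs I"
    and zero: "\<And>t. \<forall>x\<in>I. 0 \<le> Re (t x) \<Longrightarrow> R (qpow q t) = 0"
  shows "R (qpow q s) = 0"
proof -
  obtain p where p: "\<And>m. R (\<lambda>x. m * qpow q s x) = poly p m"
    using poly_funs_on_ray[OF R] by blast
  obtain n0 :: nat where n0: "\<forall>x\<in>I. - Re (s x) \<le> real n0"
  proof -
    obtain b where "\<forall>x\<in>I. - Re (s x) \<le> b" using bdd_above_finite[of "(\<lambda>x. - Re (s x)) ` I"] I
      by (auto simp: bdd_above_def)
    moreover obtain n :: nat where "b \<le> real n" using real_arch_simple by blast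
    ultimately have "\<forall>x\<in>I. - Re (s x) \<le> real n" by force
    then show thesis by (rule that)
  qed
  let ?m = "\<lambda>n. (1 / of_nat q :: complex) ^ n"
  have "poly p (?m n) = 0" if "n \<ge> n0" for n
  proof -
    have "poly p (?m n) = R (qpow q (\<lambda>x. s x + of_nat n))"
      using q by (simp add: p[symmetric] qpow_add_nat)
    also have "\<dots> = 0" using n0 that by (intro zero) force
    finally show ?thesis .
  qed
  then have "?m ` {n0..} \<subseteq> {m. poly p m = 0}" by auto
  moreover have "infinite (?m ` {n0..})"
  proof
    assume "finite (?m ` {n0..})"
    moreover have "inj_on ?m {n0..}"
    proof (rule inj_onI)
      fix a b assume "?m a = ?m b"
      then have "(of_nat (q ^ a) :: complex) = of_nat (q ^ b)" by (simp add: power_one_over)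
      then have "q ^ a = q ^ b" by (simp only: of_nat_eq_iff)
      then show "a = b" using q by simp
    qed
    ultimately have "finite {n0..}" by (rule finite_imageD)
    then show False using infinite_Ici by blast
  qed
  ultimately have "infinite {m. poly p m = 0}" using finite_subset by blast
  then have "p = 0" using poly_roots_finite by blast
  then show ?thesis using p[of 1] by simp
qed

lemma zeta_eqI:
  fixes A :: "('k::comm_ring_1, 'd::finite) affine_poly set"
  assumes fin: "finite (arr_proper_flats A)" and q: "q > 1"
    and P: "P \<in> poly_funs (arr_proper_flats A)" and Q: "Q \<in> poly_funs (arr_proper_flats A)"
    and PQ: "\<And>t. \<forall>x \<in> arr_proper_flats A. 0 \<le> Re (t x) \<Longrightarrow>
      Q (qpow q t) * zeta_integral M q \<phi> A t = P (qpow q t)"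
    and Qs: "Q (qpow q s) \<noteq> 0"
  shows "zeta M q \<phi> A s = P (qpow q s) / Q (qpow q s)"
  unfolding zeta_def
proof (rule the_equality)
  let ?P = "arr_proper_flats A"
  show "\<exists>P' \<in> poly_funs (?P). \<exists>Q' \<in> poly_funs (?P).
       (\<forall>t. (\<forall>x \<in> ?P. 0 \<le> Re (t x)) \<longrightarrow>
            Q' (qpow q t) * zeta_integral M q \<phi> A t = P' (qpow q t)) \<and>
       Q' (qpow q s) \<noteq> 0 \<and> P (qpow q s) / Q (qpow q s) = P' (qpow q s) / Q' (qpow q s)"
    using P Q PQ Qs by blast
  fix z
  assume "\<exists>P' \<in> poly_funs (?P). \<exists>Q' \<in> poly_funs (?P).
       (\<forall>t. (\<forall>x \<in> ?P. 0 \<le> Re (t x)) \<longrightarrow>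
            Q' (qpow q t) * zeta_integral M q \<phi> A t = P' (qpow q t)) \<and>
       Q' (qpow q s) \<noteq> 0 \<and> z = P' (qpow q s) / Q' (qpow q s)"
  then obtain P' Q' where P': "P' \<in> poly_funs (?P)" "Q' \<in> poly_funs (?P)"
    and PQ': "\<forall>t. (\<forall>x \<in> ?P. 0 \<le> Re (t x)) \<longrightarrow>
            Q' (qpow q t) * zeta_integral M q \<phi> A t = P' (qpow q t)"
    and Qs': "Q' (qpow q s) \<noteq> 0" and z: "z = P' (qpow q s) / Q' (qpow q s)" by blast
  let ?R = "\<lambda>t. P t * Q' t - P' t * Q t"
  have "?R (qpow q s) = 0"
  proof (rule poly_fun_zero_if_zero_on_half_space[OF fin q, of ?R])
    show "?R \<in> poly_funs (?P)"
      using P Q P' by (intro poly_funs_diff poly_funs.mult)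
    show "?R (qpow q t) = 0" if "\<forall>x\<in>?P. 0 \<le> Re (t x)" for t
    proof -
      have "P' (qpow q t) = Q' (qpow q t) * zeta_integral M q \<phi> A t" using PQ' that by simp
      moreover have "P (qpow q t) = Q (qpow q t) * zeta_integral M q \<phi> A t" using PQ[OF that] by simp
      ultimately show ?thesis by simp
    qed
  qed
  then show "z = P (qpow q s) / Q (qpow q s)"
    using Qs Qs' unfolding z by (simp add: field_simps)
qed

definition fHP_num :: "'v set \<Rightarrow> 'v set set \<Rightarrow> complex \<Rightarrow> ('v set \<Rightarrow> complex) \<Rightarrow> complex" where
  "fHP_num E H Y T = (\<Sum>F \<in> flags (proper_flats E H). flag_poincare E H F Y *
     ((\<Prod>x \<in> set F. T x) * (\<Prod>x \<in> proper_flats E H - set F. 1 - T x)))"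

definition fHP_den :: "'v set \<Rightarrow> 'v set set \<Rightarrow> ('v set \<Rightarrow> complex) \<Rightarrow> complex" where
  "fHP_den E H T = (\<Prod>x \<in> proper_flats E H. 1 - T x)"

lemma fHP_den_zero_iff: "finite (proper_flats E H) \<Longrightarrow>
    fHP_den E H T = 0 \<longleftrightarrow> (\<exists>x\<in>proper_flats E H. T x = 1)"
  by (auto simp: fHP_den_def)

lemma fHP_fraction:
  assumes fin: "finite (proper_flats E H)" and T: "fHP_den E H T \<noteq> 0"
  shows "fHP E H Y T = fHP_num E H Y T / fHP_den E H T"
  unfolding fHP_def fHP_num_def sum_divide_distrib
proof (intro sum.cong refl)
  fix F assume "F \<in> flags (proper_flats E H)"
  then have sub: "set F \<subseteq> proper_flats E H" by (simp add: flags_def)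
  have nz: "(\<Prod>x \<in> proper_flats E H - set F. 1 - T x) \<noteq> 0"
    using fin T by (auto simp: fHP_den_zero_iff)
  have "fHP_den E H T = (\<Prod>x \<in> proper_flats E H - set F. 1 - T x) * (\<Prod>x \<in> set F. 1 - T x)"
    unfolding fHP_den_def by (rule prod.subset_diff[OF sub fin])
  then show "flag_poincare E H F Y * (\<Prod>x\<in>set F. T x / (1 - T x)) = flag_poincare E H F Y *
     ((\<Prod>x \<in> set F. T x) * (\<Prod>x \<in> proper_flats E H - set F. 1 - T x)) / fHP_den E H T"
    using nz by (simp add: prod_dividef)
qed

lemma fHP_cong:
  assumes "\<And>x. x \<in> proper_flats E H \<Longrightarrow> T x = T' x"
  shows "fHP E H Y T = fHP E H Y T'"
  unfolding fHP_def using assms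
  by (intro sum.cong arg_cong2[where f = "(*)"] prod.cong refl) (auto simp: flags_def)

lemma fHP_poly_funs:
  assumes "\<And>x. x \<in> proper_flats E H \<Longrightarrow> (\<lambda>t. T t x) \<in> poly_funs I"
  shows "(\<lambda>t. fHP_num E H Y (T t)) \<in> poly_funs I" "(\<lambda>t. fHP_den E H (T t)) \<in> poly_funs I"
  unfolding fHP_num_def fHP_den_def using assms
  by (intro poly_funs_sum poly_funs.mult poly_funs.const poly_funs_prod poly_funs_diff; auto simp: flags_def)+

section \<open>The substitutions are mutually inverse\<close>

lemma proper_flats_localization:
  assumes "x \<in> flats UNIV H"
  shows "proper_flats UNIV (localization H x) = {y \<in> proper_flats UNIV H. x \<subseteq> y}"
  using flats_localization[OF assms] by (auto simp: proper_flats_def)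

text \<open>
  Interchanging the two sums leaves the sum of the Moebius function over an interval, which vanishes
  unless the interval is a single flat. The term of that flat is \<open>r x - rk x\<close>, and \<open>g\<close> adds the rank
  back.
\<close>

lemma g_exp_h_exp:
  assumes fin: "finite (hyperplanes A)" and x: "x \<in> arr_proper_flats A"
  shows "g_exp A (h_exp A r) x = r x"
proof -
  let ?P = "arr_proper_flats A" and ?L = "arr_flats A"
  let ?d = "\<lambda>z. r z - of_nat (rk UNIV (hyperplanes A) z)"
  have PL: "?P \<subseteq> ?L" by (auto simp: proper_flats_def)
  have xL: "x \<in> ?L" using x PL by auto
  have finL: "finite ?L" by (rule finite_flats[OF fin])
  then have finP: "finite ?P" using PL finite_subset by blast
  have "(\<Sum>y \<in> proper_flats UNIV (localization (hyperplanes A) x). h_exp A r y) =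
      (\<Sum>y \<in> {y \<in> ?P. x \<subseteq> y}. \<Sum>z | z \<in> {z \<in> ?P. x \<subseteq> z} \<and> y \<subseteq> z. ?d z * of_int (moebius ?L z y))"
    unfolding proper_flats_localization[OF xL]
  proof (intro sum.cong refl)
    fix y assume y: "y \<in> {y \<in> ?P. x \<subseteq> y}"
    then have "{z \<in> ?P. y \<subseteq> z} = {z. z \<in> {z \<in> ?P. x \<subseteq> z} \<and> y \<subseteq> z}" by blast
    then show "h_exp A r y = (\<Sum>z | z \<in> {z \<in> ?P. x \<subseteq> z} \<and> y \<subseteq> z. ?d z * of_int (moebius ?L z y))"
      using y PL proper_flats_localization[of y "hyperplanes A"] by (auto simp: h_exp_def)
  qed
  also have "\<dots> = (\<Sum>z \<in> {z \<in> ?P. x \<subseteq> z}. \<Sum>y | y \<in> {y \<in> ?P. x \<subseteq> y} \<and> y \<subseteq> z. ?d z * of_int (moebius ?L z y))"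
    using finP by (intro sum.swap_restrict) auto
  also have "\<dots> = (\<Sum>z \<in> {z \<in> ?P. x \<subseteq> z}. ?d z * of_int (\<Sum>y \<in> {y \<in> ?L. y \<subseteq> z \<and> x \<subseteq> y}. moebius ?L z y))"
  proof (intro sum.cong refl)
    fix z assume z: "z \<in> {z \<in> ?P. x \<subseteq> z}"
    then have "{y. y \<in> {y \<in> ?P. x \<subseteq> y} \<and> y \<subseteq> z} = {y \<in> ?L. y \<subseteq> z \<and> x \<subseteq> y}"
      by (auto simp: proper_flats_def)
    then show "(\<Sum>y | y \<in> {y \<in> ?P. x \<subseteq> y} \<and> y \<subseteq> z. ?d z * of_int (moebius ?L z y)) =
        ?d z * of_int (\<Sum>y \<in> {y \<in> ?L. y \<subseteq> z \<and> x \<subseteq> y}. moebius ?L z y)"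
      by (simp add: sum_distrib_left)
  qed
  also have "\<dots> = (\<Sum>z \<in> {z \<in> ?P. x \<subseteq> z}. if z = x then ?d z else 0)"
  proof (intro sum.cong refl)
    fix z assume "z \<in> {z \<in> ?P. x \<subseteq> z}"
    then have "z \<in> ?L" using PL by auto
    from moebius_interval_sum[OF finL this xL]
    show "?d z * of_int (\<Sum>y \<in> {y \<in> ?L. y \<subseteq> z \<and> x \<subseteq> y}. moebius ?L z y) = (if z = x then ?d z else 0)"
      by simp
  qed
  also have "\<dots> = ?d x" using finP x by simp
  finally show ?thesis by (simp add: g_exp_def)
qed

section \<open>The integrand\<close>

text \<open>
  The contribution \<open>\<tau>(S\<^sub>n(X))\<close> of a single level to the integrand.
\<close>

definition weight :: "nat \<Rightarrow> ('k::comm_ring_1, 'd::finite) affine_poly set \<Rightarrow> (('k ^ 'd) set \<Rightarrow> complex) \<Rightarrow>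
    ('k, 'd) affine_poly set \<Rightarrow> complex" where
  "weight q A s T = (\<Prod>y\<in>arr_proper_flats A. if {L \<in> A. y \<subseteq> zero_locus L} \<subseteq> T then qpow q s y else 1)"

lemma of_real_power_powr:
  assumes "q > 0"
  shows "complex_of_real ((1 / real q) ^ k) powr s = (of_nat q powr (- s)) ^ k"
proof -
  have r: "(1 / real q) ^ k > 0" using assms by simp
  have "ln ((1 / real q) ^ k) = - (real k * ln (real q))"
    using assms by (simp add: ln_realpow ln_div)
  then have "complex_of_real ((1 / real q) ^ k) powr s = exp (s * - (of_nat k * of_real (ln (real q))))"
    using r assms by (simp add: powr_def Ln_of_real del: of_real_power)
  also have "\<dots> = exp (of_nat k * (- s * of_real (ln (real q))))" by (simp add: algebra_simps)
  also have "\<dots> = exp (- s * of_real (ln (real q))) ^ k" by (simp only: exp_of_nat_mult)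
  also have "exp (- s * of_real (ln (real q))) = of_nat q powr (- s)"
    using assms Ln_of_real[of "real q"] by (simp add: powr_def)
  finally show ?thesis .
qed

lemma qpow_norm_le_1:
  assumes "q > 0" "0 \<le> Re (s x)"
  shows "norm (qpow q s x) \<le> 1"
proof -
  have "norm (qpow q s x) = real q powr (- Re (s x))"
    unfolding qpow_def using assms(1) by (subst norm_powr_real_powr) auto
  also have "\<dots> \<le> real q powr 0" using assms by (intro powr_mono) auto
  finally show ?thesis using assms(1) by simp
qed

lemma norm_weight_le_1:
  assumes "q > 0" "\<And>x. x \<in> arr_proper_flats A \<Longrightarrow> 0 \<le> Re (s x)"
  shows "norm (weight q A s T) \<le> 1"
  unfolding weight_def prod_norm[symmetric]
  using assms by (intro prod_le_1) (simp add: qpow_norm_le_1)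

text \<open>
  If some polynomial vanishes at \<open>X\<close>, no truncation contributes, and the integrand is zero because of the
  factor of the corresponding hyperplane. Otherwise the level sets are eventually empty, and the
  factor of a flat \<open>y\<close> occurs for the levels \<open>m\<close> up to \<open>k y\<close>, the least valuation of a
  polynomial that vanishes on \<open>y\<close>.
\<close>

lemma zeta_integrand_limit:
  fixes A :: "('k::field, 'd::finite) affine_poly set" and \<phi> :: "'k \<Rightarrow> 'o::idom"
  assumes A: "arrangement (\<lambda>L. L) A" and p: "uniformizer p"
    and bounded: "\<And>x :: 'o. x \<noteq> 0 \<Longrightarrow> \<exists>n. \<not> p ^ n dvd x" and q: "q > 1"
  defines "S \<equiv> \<lambda>n X. {L \<in> A. p ^ n dvd eval_affine (map_affine \<phi> L) X}"
  shows "(\<lambda>N. (if S N X = {} then 1 else 0) * (\<Prod>m\<in>{0<..N}. weight q A s (S m X)))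
    \<longlonglongrightarrow> zeta_integrand q \<phi> A s X"
proof -
  let ?P = "arr_proper_flats A"
  interpret arrangement "\<lambda>L. L" A by fact
  let ?e = "\<lambda>L. eval_affine (map_affine \<phi> L) X"
  have Lhyps: "L = arr_flats A" and Phyps: "?P = L - {UNIV}"
    by (simp_all add: hyperplanes_def proper_flats_def)
  have norm_set: "{absval q (?e L) | L. L \<in> A \<and> y \<subseteq> zero_locus L} = (\<lambda>L. absval q (?e L)) ` members y" for y
    unfolding members_def by auto
  have finP: "finite (?P)" unfolding Phyps using finite_L by simp
  show ?thesis
  proof (cases "\<exists>l\<in>A. ?e l = 0")
    case True
    then obtain l where l: "l \<in> A" "?e l = 0" by auto
    have "members (zero_locus l) = {l}"
      using l distinct hyperplane_subset_eq unfolding members_def inj_on_def by blast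
    then have "local_norm q \<phi> A (zero_locus l) X = 0"
      unfolding local_norm_def norm_set using l by (simp add: absval_def)
    moreover have "zero_locus l \<in> ?P"
      unfolding Phyps using hyperplane_in_L[OF l(1)] hyperplane_not_UNIV[OF l(1)] by simp
    ultimately have "zeta_integrand q \<phi> A s X = 0"
      unfolding zeta_integrand_def using finP by (intro prod_zero) auto
    moreover have "l \<in> S N X" for N using l by (simp add: S_def)
    then have "S N X \<noteq> {}" for N by blast
    ultimately show ?thesis by simp
  next
    case False
    let ?val = "\<lambda>L. valuation (?e L)"
    have dvd: "p ^ n dvd ?e L \<longleftrightarrow> n \<le> ?val L" if "L \<in> A" for L n
      using valuation_ge_iff[OF p _ bounded] False that by blast
    define N0 where "N0 = Suc (\<Sum>L\<in>A. ?val L)"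
    have val_less: "?val L < N0" if "L \<in> A" for L
      unfolding N0_def using member_le_sum[OF that, of ?val] finite_A by simp
    define k where "k y = Min (?val ` members y)" for y
    have nonempty: "members y \<noteq> {}" if "y \<in> ?P" for y
      using that locus_members[of y] unfolding Phyps by (auto simp: locus_def)
    have fin: "finite (?val ` members y)" for y using finite_members by simp
    have kin: "k y \<in> ?val ` members y" if "y \<in> ?P" for y
      unfolding k_def using fin nonempty[OF that] by (intro Min_in) auto
    have k_le: "k y \<le> ?val L" if "L \<in> members y" for y L
      unfolding k_def using fin that by (intro Min_le) auto
    have in_S: "{L \<in> A. y \<subseteq> zero_locus L} \<subseteq> S m X \<longleftrightarrow> m \<le> k y" if y: "y \<in> ?P" for y m
    proof -
      have "{L \<in> A. y \<subseteq> zero_locus L} \<subseteq> S m X \<longleftrightarrow> (\<forall>L\<in>members y. m \<le> ?val L)"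
        using dvd by (auto simp: S_def members_def)
      also have "\<dots> \<longleftrightarrow> m \<le> k y"
        unfolding k_def using fin nonempty[OF y] by (subst Min_ge_iff) auto
      finally show ?thesis .
    qed
    have norm: "local_norm q \<phi> A y X = (1 / real q) ^ k y" if y: "y \<in> ?P" for y
      unfolding local_norm_def norm_set
    proof (rule Max_eqI)
      have abs: "absval q (?e L) = (1 / real q) ^ ?val L" if "L \<in> members y" for L
        using False that by (auto simp: absval_def members_def)
      show "finite ((\<lambda>L. absval q (?e L)) ` members y)" using finite_members by simp
      show "a \<le> (1 / real q) ^ k y" if a: "a \<in> (\<lambda>L. absval q (?e L)) ` members y" for a
      proof -
        from a obtain L where "L \<in> members y" "a = (1 / real q) ^ ?val L" using abs by auto
        then show ?thesis using q k_le by (auto intro!: power_decreasing)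
      qed
      obtain L where "L \<in> members y" "k y = ?val L" using kin[OF y] by auto
      then show "(1 / real q) ^ k y \<in> (\<lambda>L. absval q (?e L)) ` members y" using abs by auto
    qed
    have k_less: "k y < N0" if y: "y \<in> ?P" for y
    proof -
      obtain L where "L \<in> members y" "k y = ?val L" using kin[OF y] by auto
      then show ?thesis using val_less[of L] members_subset[of y] by auto
    qed
    have "(if S N X = {} then 1 else 0) * (\<Prod>m\<in>{0<..N}. weight q A s (S m X)) = zeta_integrand q \<phi> A s X"
      if N: "N \<ge> N0" for N
    proof -
      have "S N X = {}" using dvd val_less N by (force simp: S_def)
      moreover have "(\<Prod>m\<in>{0<..N}. weight q A s (S m X)) =
          (\<Prod>y\<in>?P. \<Prod>m\<in>{0<..N}. if m \<le> k y then qpow q s y else 1)"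
        unfolding weight_def by (subst prod.swap) (intro prod.cong refl, simp add: in_S)
      moreover have "(\<Prod>m\<in>{0<..N}. if m \<le> k y then qpow q s y else 1) =
          complex_of_real (local_norm q \<phi> A y X) powr s y" if y: "y \<in> ?P" for y
      proof -
        have "{0<..N} \<inter> {m. m \<le> k y} = {0<..k y}" using k_less[OF y] N by auto
        then have "(\<Prod>m\<in>{0<..N}. if m \<le> k y then qpow q s y else 1) = qpow q s y ^ k y"
          by (simp add: prod.If_cases)
        then show ?thesis using of_real_power_powr[of q "k y" "s y"] q
          by (simp add: norm[OF y] qpow_def del: of_real_power)
      qed
      ultimately show ?thesis by (simp add: zeta_integrand_def)
    qed
    then show ?thesis by (intro tendsto_eventually eventually_sequentiallyI[of N0])
  qed
qed

lemma qpow_g_exp: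
  fixes A :: "('k::field, 'd::finite) affine_poly set"
  assumes fin: "finite A" and q: "q > 0" and y: "y \<in> arr_proper_flats A"
  shows "qpow q (g_exp A s) y =
    (1 / of_nat q) ^ rk UNIV (hyperplanes A) y * (\<Prod>z\<in>{z \<in> arr_proper_flats A. y \<subseteq> z}. qpow q s z)"
proof -
  let ?P = "{z \<in> arr_proper_flats A. y \<subseteq> z}"
  let ?r = "rk UNIV (hyperplanes A) y"
  have q0: "(of_nat q :: complex) \<noteq> 0" using q by simp
  have yL: "y \<in> arr_flats A" using y by (simp add: proper_flats_def)
  have finP: "finite ?P"
    using finite_flats[of "hyperplanes A" UNIV] fin by (simp add: hyperplanes_def proper_flats_def)
  have "qpow q (g_exp A s) y = of_nat q powr (- of_nat (?r) +
      (\<Sum>z\<in>?P. - s z))"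
    by (simp add: qpow_def g_exp_def proper_flats_localization[OF yL] sum_negf)
  also have "\<dots> = of_nat q powr (- of_nat (?r)) *
      of_nat q powr (\<Sum>z\<in>?P. - s z)"
    by (rule powr_add)
  also have "of_nat q powr (- of_nat (?r)) = (1 / of_nat q :: complex) ^ ?r"
    using q0 by (simp add: powr_minus powr_complexpow power_one_over inverse_eq_divide)
  also have "of_nat q powr (\<Sum>z\<in>?P. - s z) =
      (\<Prod>z\<in>?P. qpow q s z)"
    using finP q0 by (simp add: qpow_def powr_sum)
  finally show ?thesis .
qed

text \<open>
  Regularity of the series at these points is part of the conclusion, because the continuation needs a
  denominator that does not vanish there.
\<close>

lemma zeta_integral_eq_fHP:
  fixes A :: "('k::field_char_0, 'd::finite) affine_poly set"
    and \<phi> :: "'k \<Rightarrow> 'o::{idom, topological_space}"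
    and res :: "'o \<Rightarrow> 'f::field"
    and M :: "('o ^ 'd) measure"
  assumes A: "integral_arrangement A" and dvr: "compact_dvr TYPE('o)"
    and \<phi>: "ring_hom_on ring_of_integers \<phi>" and res: "residue_map res" and q: "q = CARD('f)"
    and good: "good_reduction \<phi> res A" and M: "haar_measure M"
  shows "q > 1"
    and "\<forall>x \<in> arr_proper_flats A. 0 \<le> Re (s x) \<Longrightarrow>
      (\<forall>x \<in> arr_proper_flats A. qpow q (g_exp A s) x \<noteq> 1) \<and>
      integrable M (zeta_integrand q \<phi> A s) \<and>
      zeta_integral M q \<phi> A s = fHP UNIV (hyperplanes A) (- (1 / of_nat q)) (qpow q (g_exp A s))"
proof -
  let ?F = "fHP UNIV (hyperplanes A) (- (1 / of_nat q))"
  let ?H = "hyperplanes A"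
  let ?Z = "zeta_integrand q \<phi> A s"
  let ?P = "arr_proper_flats A"
  let ?rk = "rk UNIV ?H"
  let ?R = "ring_of_integers"
  let ?\<psi> = "res \<circ> \<phi>"
  have dvr': "discrete_valuation_ring TYPE('o)" using dvr by (simp add: compact_dvr_def)
  obtain p :: 'o where p: "uniformizer p" "p \<noteq> 0" and ker: "\<And>x. res x = 0 \<longleftrightarrow> p dvd x"
    by (rule dvr_uniformizer[OF dvr' res]) blast
  have hom: "ring_hom_on UNIV res" and surj: "surj res" using res by (auto simp: residue_map_def)
  have np: "\<not> p dvd 1" using ker[of 1] ring_hom_on_UNIV(1)[OF hom] by simp
  have bounded: "\<exists>n. \<not> p ^ n dvd x" if "x \<noteq> 0" for x :: 'o
    by (rule dvr_power_dvd_bounded[OF _ p(2) np that])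
      (use dvr' in \<open>auto simp: discrete_valuation_ring_def\<close>)
  have fin: "finite (UNIV :: 'f set)" by (rule compact_dvr_finite_residue_field[OF dvr p(1) res ker])
  have "card {0, 1 :: 'f} \<le> CARD('f)" using fin by (intro card_mono) auto
  then show q1: "q > 1" by (simp add: q)
  have fA: "finite A" "inj_on zero_locus A" "\<forall>L\<in>A. nondegenerate L"
    and int: "\<And>L. L \<in> A \<Longrightarrow> integral_poly ?R L"
    using A by (auto simp: integral_arrangement_def integral_poly_def)
  have sh: "subring_hom ?R \<phi>"
    using \<phi> by unfold_locales (auto intro: ring_of_integers_closed)
  have "ring_hom_on ?R ?\<psi>"
    using \<phi> by (simp add: ring_hom_on_def ring_hom_on_UNIV[OF hom])
  then have sh\<psi>: "subring_hom ?R ?\<psi>"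
    by unfold_locales (auto intro: ring_of_integers_closed)
  obtain f where "\<forall>L\<in>map_affine ?\<psi> ` A. nondegenerate L"
    "bij_betw f (arr_flats A) (arr_flats (map_affine ?\<psi> ` A))"
    "\<forall>x\<in>arr_flats A. \<forall>y\<in>arr_flats A. x \<subseteq> y \<longleftrightarrow> f x \<subseteq> f y"
    using good unfolding good_reduction_def Let_def by blast
  from good_reduction_pair[OF fA sh\<psi> int this]
  interpret P: reduction_pair "\<lambda>L. L" "map_affine ?\<psi>" A .
  have comp: "map_affine ?\<psi> L = map_affine res (map_affine \<phi> L)" for L
    by (simp add: map_affine_def vec_eq_iff)
  interpret H: haar_family p res M q A "map_affine \<phi>" "map_affine ?\<psi>"
  proof
    show "\<exists>I\<subseteq>T. lin_indep (map_affine ?\<psi>) I \<and> (\<forall>l\<in>T. \<exists>D c. res D \<noteq> 0 \<and>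
        (\<forall>X. D * eval_affine (map_affine \<phi> l) X = (\<Sum>i\<in>I. c i * eval_affine (map_affine \<phi> i) X)))"
      if T: "T \<subseteq> A" "locus (map_affine ?\<psi>) T \<noteq> {}" for T
    proof -
      have central: "locus (\<lambda>L. L) T \<noteq> {}" using P.central_eq[OF T(1)] T(2) by simp
      obtain I where I: "I \<subseteq> T" "lin_indep (map_affine ?\<psi>) I" "\<forall>i\<in>T. snd i \<in> lin_span (\<lambda>L. L) I"
        using P.common_basis[OF T(1)] by blast
      have span: "\<And>L. L \<in> T \<Longrightarrow> snd L \<in> lin_span (\<lambda>L. L) I" using I(3) by blast
      have intT: "\<And>L. L \<in> T \<Longrightarrow> integral_poly ?R L" using int T(1) by auto
      have "\<exists>D c. res D \<noteq> 0 \<and>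
        (\<forall>X. D * eval_affine (map_affine \<phi> l) X = (\<Sum>i\<in>I. c i * eval_affine (map_affine \<phi> i) X))"
        if l: "l \<in> T" for l
      proof -
        obtain D C where D: "D \<in> ?R" "?\<psi> D \<noteq> 0" "\<forall>L\<in>I. C L \<in> ?R"
          "D * fst l = (\<Sum>L\<in>I. C L * fst L)" "\<forall>j. D * snd l $ j = (\<Sum>L\<in>I. C L * snd L $ j)"
          using integral_relation[OF sh\<psi> intT I(1,2) span central l] by blast
        have "\<phi> D * eval_affine (map_affine \<phi> l) X = (\<Sum>L\<in>I. \<phi> (C L) * eval_affine (map_affine \<phi> L) X)" for X
          using D I(1) l intT by (intro map_affine_relation[OF sh]) auto
        then show ?thesis using D(2) by (intro exI[of _ "\<phi> D"] exI[of _ "\<lambda>L. \<phi> (C L)"]) simp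
      qed
      then show ?thesis using I by blast
    qed
  qed (use q p ker hom surj compact_dvr_open_coset[OF dvr p(1)] fin M fA(1) comp in auto)
  assume s: "\<forall>x \<in> ?P. 0 \<le> Re (s x)"
  let ?\<tau> = "weight q A s" and ?T = "qpow q (g_exp A s)"
  have hyps: "P.U.hyps = ?H" by (simp add: hyperplanes_def)
  have q0: "q > 0" using q1 by simp
  have \<tau>1: "norm (?\<tau> T) \<le> 1" for T using s by (intro norm_weight_le_1[OF q0]) auto
  have members: "P.U.members y = {L \<in> A. y \<subseteq> zero_locus L}" for y by (simp add: P.U.members_def)
  have proper: "y \<in> P.U.L" "y \<noteq> UNIV" if "y \<in> ?P" for y
    using that by (auto simp: proper_flats_def hyps)
  have \<tau>_members: "?\<tau> (P.U.members y) = (\<Prod>z\<in>{z \<in> ?P. y \<subseteq> z}. qpow q s z)"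
    if "y \<in> P.U.L" for y
  proof -
    have "?\<tau> (P.U.members y) = (\<Prod>z\<in>?P. if y \<subseteq> z then qpow q s z else 1)"
      unfolding weight_def members[symmetric]
      using P.U.subset_iff_members[OF that] proper(1) by (intro prod.cong) auto
    then show ?thesis
      using P.U.finite_L
      by (subst prod.inter_filter) (simp_all add: proper_flats_def hyps)
  qed
  have T_eq: "?T y = (1 / of_nat q) ^ ?rk y * ?\<tau> (P.U.members y)"
    if "y \<in> ?P" for y
    using qpow_g_exp[OF fA(1) q0 that] \<tau>_members[OF proper(1)[OF that]] by simp
  define T where "T y = (1 / of_nat q) ^ ?rk y * ?\<tau> (P.U.members y)" for y
  have small: "norm (T y) < 1" if y: "y \<in> ?P" for y
  proof -
    have "0 < ?rk y" using P.rk_proper_pos[OF proper[OF y]] by (simp add: hyps)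
    then have "(1 / real q) ^ ?rk y < 1" using q1 by (intro power_less_one_iff[THEN iffD2]) auto
    moreover have "norm (T y) \<le> (1 / real q) ^ ?rk y * 1"
      unfolding T_def norm_mult norm_power
      using \<tau>1 by (intro mult_mono) (auto simp: norm_divide)
    ultimately show ?thesis by simp
  qed
  have \<tau>0: "?\<tau> {} = 1"
  proof -
    have none: "{z \<in> ?P. UNIV \<subseteq> z} = {}" by (auto simp: proper_flats_def)
    show ?thesis using \<tau>_members[OF P.U.UNIV_in_L] unfolding P.members_UNIV none by simp
  qed
  have "(\<lambda>N. average (map_affine ?\<psi>) ?\<tau> N A) \<longlonglongrightarrow> fHP UNIV P.U.hyps (- (1 / of_nat q)) T"
    using q \<tau>0 small unfolding hyps[symmetric]
    by (intro P.average_tendsto_flag_sum[OF fin]) (auto simp: T_def hyps)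
  moreover have lim: "(\<lambda>N. H.trunc ?\<tau> 0 N X) \<longlonglongrightarrow> ?Z X" for X
    using zeta_integrand_limit[OF P.U.arrangement_axioms p(1) bounded q1, of \<phi> X s]
    by (simp add: H.trunc_def H.residual_def)
  note H.integral_limit[of ?\<tau>, OF \<tau>1 lim]
  ultimately have eq: "zeta_integral M q \<phi> A s = ?F T"
    and int: "integrable M (?Z)"
    unfolding zeta_integral_def hyps by (auto intro: LIMSEQ_unique)
  have "?F T = ?F ?T"
    by (rule fHP_cong) (simp add: T_eq T_def)
  moreover have "?T x \<noteq> 1" if "x \<in> ?P" for x
    using small[OF that] T_eq[OF that] by (auto simp: T_def)
  ultimately show "(\<forall>x \<in> ?P. ?T x \<noteq> 1) \<and> integrable M (?Z) \<and>
      zeta_integral M q \<phi> A s = ?F ?T"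
    using eq int by simp
qed

lemma zeta_eq_fHP:
  fixes A :: "('k::field_char_0, 'd::finite) affine_poly set"
  assumes fin: "finite A" and q: "q > 1"
    and integral: "\<And>s. \<forall>x \<in> arr_proper_flats A. 0 \<le> Re (s x) \<Longrightarrow>
      (\<forall>x \<in> arr_proper_flats A. qpow q (g_exp A s) x \<noteq> 1) \<and>
      zeta_integral M q \<phi> A s = fHP UNIV (hyperplanes A) Y (qpow q (g_exp A s))"
    and s: "\<forall>x \<in> arr_proper_flats A. qpow q (g_exp A s) x \<noteq> 1"
  shows "zeta M q \<phi> A s = fHP UNIV (hyperplanes A) Y (qpow q (g_exp A s))"
proof -
  let ?P = "arr_proper_flats A" and ?H = "hyperplanes A"
  let ?F = "fHP UNIV ?H Y"
  let ?num = "fHP_num UNIV ?H Y"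
  let ?den = "fHP_den UNIV ?H"
  define T where "T t y = (1 / of_nat q :: complex) ^ rk UNIV ?H y * (\<Prod>z\<in>{z \<in> ?P. y \<subseteq> z}. t z)" for t y
  have T: "qpow q (g_exp A t) y = T (qpow q t) y" if "y \<in> ?P" for t y
    using qpow_g_exp[OF fin _ that] q by (simp add: T_def)
  have finP: "finite ?P"
    using finite_flats[of ?H UNIV] fin by (simp add: hyperplanes_def proper_flats_def)
  have poly: "(\<lambda>t. T t y) \<in> poly_funs ?P" for y
    unfolding T_def by (intro poly_funs.mult poly_funs.const poly_funs_prod poly_funs.var) auto
  have frac: "?F (qpow q (g_exp A t)) = ?num (T (qpow q t)) / ?den (T (qpow q t))"
    and den: "?den (T (qpow q t)) \<noteq> 0"
    if "\<forall>x \<in> ?P. qpow q (g_exp A t) x \<noteq> 1" for t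
  proof -
    show den: "?den (T (qpow q t)) \<noteq> 0"
      using that T by (simp add: fHP_den_zero_iff[OF finP])
    have "?F (qpow q (g_exp A t)) = ?F (T (qpow q t))"
      by (rule fHP_cong) (rule T)
    then show "?F (qpow q (g_exp A t)) = ?num (T (qpow q t)) / ?den (T (qpow q t))"
      using fHP_fraction[OF finP den] by simp
  qed
  have "zeta M q \<phi> A s = ?num (T (qpow q s)) / ?den (T (qpow q s))"
  proof (rule zeta_eqI[OF finP q])
    show "(\<lambda>t. ?num (T t)) \<in> poly_funs ?P" "(\<lambda>t. ?den (T t)) \<in> poly_funs ?P"
      by (rule fHP_poly_funs, rule poly)+
    show "?den (T (qpow q t)) * zeta_integral M q \<phi> A t = ?num (T (qpow q t))"
      if "\<forall>x \<in> ?P. 0 \<le> Re (t x)" for t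
      using integral[OF that] frac[of t] den[of t] by simp
    show "?den (T (qpow q s)) \<noteq> 0" by (rule den[OF s])
  qed
  then show ?thesis using frac[OF s] by simp
qed

theorem theorem2:
  fixes A :: "('k::field_char_0, 'd::finite) affine_poly set"
    and \<phi> :: "'k \<Rightarrow> 'o::{idom, topological_space}"
    and res :: "'o \<Rightarrow> 'f::field"
    and M :: "('o ^ 'd) measure"
    and q :: nat
  assumes "number_field TYPE('k)"
    and "integral_arrangement A"
    and "compact_dvr TYPE('o)"
    and "ring_hom_on ring_of_integers \<phi>"
    and "residue_map res"
    and "q = CARD('f)"
    and "good_reduction \<phi> res A"
    and "haar_measure M"
  shows "(\<forall>s. (\<forall>x \<in> arr_proper_flats A. 0 \<le> Re (s x)) \<longrightarrow>
            integrable M (zeta_integrand q \<phi> A s) \<and>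
            zeta_integral M q \<phi> A s =
              fHP UNIV (hyperplanes A) (- (1 / of_nat q)) (qpow q (g_exp A s))) \<and>
         (\<forall>s. (\<forall>x \<in> arr_proper_flats A. qpow q (g_exp A s) x \<noteq> 1) \<longrightarrow>
            zeta M q \<phi> A s =
              fHP UNIV (hyperplanes A) (- (1 / of_nat q)) (qpow q (g_exp A s))) \<and>
         (\<forall>r. (\<forall>x \<in> arr_proper_flats A. 0 \<le> Re (h_exp A r x)) \<longrightarrow>
            fHP UNIV (hyperplanes A) (- (1 / of_nat q)) (qpow q r) =
              zeta_integral M q \<phi> A (h_exp A r)) \<and>
         (\<forall>r. (\<forall>x \<in> arr_proper_flats A. qpow q r x \<noteq> 1) \<longrightarrow>
            fHP UNIV (hyperplanes A) (- (1 / of_nat q)) (qpow q r) =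
              zeta M q \<phi> A (h_exp A r))"
proof -
  let ?F = "fHP UNIV (hyperplanes A) (- (1 / of_nat q))" and ?P = "arr_proper_flats A"
  note main = zeta_integral_eq_fHP[OF assms(2-8)]
  have fin: "finite A" using assms(2) by (simp add: integral_arrangement_def)
  have zeta: "zeta M q \<phi> A s = ?F (qpow q (g_exp A s))"
    if "\<forall>x \<in> ?P. qpow q (g_exp A s) x \<noteq> 1" for s
    by (rule zeta_eq_fHP[OF fin main(1) _ that]) (use main(2) in blast)
  have gh: "qpow q (g_exp A (h_exp A r)) x = qpow q r x" if "x \<in> ?P" for r x
    using g_exp_h_exp[OF _ that, of r] fin by (simp add: qpow_def hyperplanes_def)
  have fHP: "fHP UNIV (hyperplanes A) Y (qpow q (g_exp A (h_exp A r))) = fHP UNIV (hyperplanes A) Y (qpow q r)"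
    for Y r by (rule fHP_cong) (rule gh)
  have "?F (qpow q r) = zeta M q \<phi> A (h_exp A r)"
    if "\<forall>x \<in> ?P. qpow q r x \<noteq> 1" for r
    using zeta[of "h_exp A r"] that gh fHP by simp
  moreover have "?F (qpow q r) = zeta_integral M q \<phi> A (h_exp A r)"
    if "\<forall>x \<in> ?P. 0 \<le> Re (h_exp A r x)" for r
    using main(2)[OF that] fHP by simp
  ultimately show ?thesis using main(2) zeta by blast
qed

end
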